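(* Let $L\in(0,\infty]$, let $\omega\in H^{-1}_{\mathrm{loc}}[0,L)$ be a real-valued distribution and let $\upsilon$ be a non-negative Borel measure on $[0,L)$. Let $\mathcal{H}=H'_\ast[0,L)\times L^2([0,L);\upsilon)$ and let $\mathrm{T}\subseteq\mathcal{H}\times\mathcal{H}$ be the linear relation consisting of all pairs $(f,g)\in\mathcal{H}\times\mathcal{H}$ such that $$-f_1''=\omega g_1+\upsilon g_2\qquad\text{and}\qquad \upsilon f_2=\upsilon g_1 .$$ Then $\mathrm{T}$ is self-adjoint in $\mathcal{H}$.
   Context: All functions are complex-valued unless stated otherwise. $H^1_{\mathrm{loc}}[0,L)$ is the space of locally absolutely continuous functions $f$ on $[0,L)$ with $f'\in L^2_{\mathrm{loc}}[0,L)$ (square integrable on $[0,c]$ for each $c<L$). $H^1_{\mathrm{c}}[0,L)$ is the space of $f\in H^1_{\mathrm{loc}}[0,L)$ with $f,f'\in L^2[0,L)$ and support compact in $[0,L)$ ($f(0)\neq0$ is allowed). $H^{-1}_{\mathrm{loc}}[0,L)$ is the topological dual of $H^1_{\mathrm{c}}[0,L)$. The formula $\chi(h)=-\int_0^L \mathsf{q}(x)h'(x)\,dx$ gives a one-to-one correspondence between $\mathsf{q}\in L^2_{\mathrm{loc}}[0,L)$ and $\chi\in H^{-1}_{\mathrm{loc}}[0,L)$; $\chi$ is real-valued if $\mathsf{q}$ is real-valued almost everywhere. Borel measures on $[0,L)$ are understood to be finite on compact subsets of $[0,L)$. $H'[0,L)$ is the space of $f\in H^1_{\mathrm{loc}}[0,L)$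 with $f'\in L^2[0,L)$ and, if $L<\infty$, additionally $\lim_{x\to L}f(x)=0$. $H'_\ast[0,L)=\{f\in H'[0,L): f(0)=0\}$ is a Hilbert space with scalar product $\int_0^L f'(x)\overline{g'(x)}\,dx$. The Hilbert space $\mathcal{H}$ carries the scalar product $$\langle f,g\rangle_{\mathcal H}=\int_0^L f_1'(x)\overline{g_1'(x)}\,dx+\int_{[0,L)}f_2\,\overline{g_2}\,d\upsilon,$$ where $f_1,f_2$ are the components of $f\in\mathcal H$. The first equation defining $\mathrm{T}$ means that there is a constant $\Delta\in\mathbb{C}$ with $\Delta h(0)+\int_0^L f_1'h'\,dx=\omega(g_1h)+\int_{[0,L)}g_2h\,d\upsilon$ for all $h\in H^1_{\mathrm{c}}[0,L)$; the second means $f_2=g_1$ $\upsilon$-almost everywhere. A linear relation is a linear subspace of $\mathcal H\times\mathcal H$; its adjoint is $\mathrm{T}^\ast=\{(f,g)\in\mathcal H\times\mathcal H:\langle g,u\rangle_{\mathcal H}=\langle f,v\rangle_{\mathcal H}\ \text{for all }(u,v)\in\mathrm{T}\}$, and self-adjoint means $\mathrm{T}=\mathrm{T}^\ast$. *)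

theory Defs
  imports "HOL-Analysis.Analysis"
begin

text \<open>The interval [0,L), where L may be infinite.\<close>

definition Ico :: "ereal \<Rightarrow> real set" where
  "Ico L = {x. 0 \<le> x \<and> ereal x < L}"

text \<open>A function on [0,L) is represented by the function on the whole real line that extends it by
  zero, so that equality in HOL is equality on [0,L).\<close>

definition funs_on :: "real set \<Rightarrow> (real \<Rightarrow> complex) set" where
  "funs_on A = {f. \<forall>x. x \<notin> A \<longrightarrow> f x = 0}"


section \<open>Square integrable functions\<close>

definition sq_int :: "'a measure \<Rightarrow> ('a \<Rightarrow> complex) set" where
  "sq_int M = {f \<in> borel_measurable M. integrable M (\<lambda>x. (cmod (f x))\<^sup>2)}"

definition ae_eq_rel :: "'a measure \<Rightarrow> (('a \<Rightarrow> complex) \<times> ('a \<Rightarrow> complex)) set" where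
  "ae_eq_rel M = {(f, g). f \<in> sq_int M \<and> g \<in> sq_int M \<and> (AE x in M. f x = g x)}"

definition L2_space :: "'a measure \<Rightarrow> ('a \<Rightarrow> complex) set set" where
  "L2_space M = sq_int M // ae_eq_rel M"

definition L2_class :: "'a measure \<Rightarrow> ('a \<Rightarrow> complex) \<Rightarrow> ('a \<Rightarrow> complex) set" where
  "L2_class M f = ae_eq_rel M `` {f}"

definition L2_inner :: "'a measure \<Rightarrow> ('a \<Rightarrow> complex) set \<Rightarrow> ('a \<Rightarrow> complex) set \<Rightarrow> complex" where
  "L2_inner M F G = (LINT x|M. (SOME f. f \<in> F) x * cnj ((SOME g. g \<in> G) x))"

lemma equiv_ae_eq_rel: "equiv (sq_int M) (ae_eq_rel M)"
proof (rule equivI)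
  show "refl_on (sq_int M) (ae_eq_rel M)"
    by (auto simp: refl_on_def ae_eq_rel_def)
  show "ae_eq_rel M \<subseteq> sq_int M \<times> sq_int M"
    by (auto simp: ae_eq_rel_def)
  show "sym (ae_eq_rel M)"
    by (auto simp: sym_def ae_eq_rel_def eq_commute)
  show "trans (ae_eq_rel M)"
  proof (rule transI)
    fix f g h assume "(f, g) \<in> ae_eq_rel M" "(g, h) \<in> ae_eq_rel M"
    then have fh: "f \<in> sq_int M" "h \<in> sq_int M"
      and "AE x in M. f x = g x" "AE x in M. g x = h x"
      by (simp_all add: ae_eq_rel_def)
    from this(3,4) have "AE x in M. f x = h x" by eventually_elim simp
    with fh show "(f, h) \<in> ae_eq_rel M" by (simp add: ae_eq_rel_def)
  qed
qed

text \<open>The choice of representatives in \<^const>\<open>L2_inner\<close> is immaterial:\<close>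

lemma L2_inner_class:
  assumes f: "f \<in> sq_int M" and g: "g \<in> sq_int M"
  shows "L2_inner M (L2_class M f) (L2_class M g) = (LINT x|M. f x * cnj (g x))"
proof -
  have *: "(k, SOME k'. k' \<in> L2_class M k) \<in> ae_eq_rel M" if "k \<in> sq_int M" for k
  proof -
    have "k \<in> L2_class M k"
      using that by (simp add: L2_class_def ae_eq_rel_def)
    then have "(SOME k'. k' \<in> L2_class M k) \<in> L2_class M k"
      by (rule someI[where P = "\<lambda>k'. k' \<in> L2_class M k"])
    then show ?thesis by (simp add: L2_class_def)
  qed
  define f' where "f' = (SOME k. k \<in> L2_class M f)"
  define g' where "g' = (SOME k. k \<in> L2_class M g)"
  have f': "f' \<in> borel_measurable M" "AE x in M. f x = f' x"
    and g': "g' \<in> borel_measurable M" "AE x in M. g x = g' x"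
    using *[OF f] *[OF g] by (auto simp: f'_def g'_def ae_eq_rel_def sq_int_def)
  have [measurable]: "f \<in> borel_measurable M" "g \<in> borel_measurable M"
    "f' \<in> borel_measurable M" "g' \<in> borel_measurable M"
    using f g f' g' by (auto simp: sq_int_def)
  have [measurable]: "(\<lambda>x. cnj (k x)) \<in> borel_measurable M" if "k \<in> borel_measurable M" for k
    using that by (rule measurable_compose)
      (intro borel_measurable_continuous_onI continuous_intros)
  have "(LINT x|M. f' x * cnj (g' x)) = (LINT x|M. f x * cnj (g x))"
  proof (rule integral_cong_AE)
    show "AE x in M. f' x * cnj (g' x) = f x * cnj (g x)"
      using f'(2) g'(2) by eventually_elim simp
  qed measurable
  then show ?thesis by (simp add: L2_inner_def f'_def g'_def)
qed

definition L2_loc :: "ereal \<Rightarrow> (real \<Rightarrow> complex) set" where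
  "L2_loc L = {f. \<forall>c. 0 \<le> c \<longrightarrow> ereal c < L \<longrightarrow> f \<in> sq_int (lebesgue_on {0..c})}"


section \<open>Sobolev spaces on [0,L)\<close>

definition abs_cont_on :: "real \<Rightarrow> real \<Rightarrow> (real \<Rightarrow> complex) \<Rightarrow> bool" where
  "abs_cont_on a b f \<longleftrightarrow>
    (\<forall>\<epsilon>>0. \<exists>\<delta>>0. \<forall>D. D division_of \<Union>D \<and> \<Union>D \<subseteq> {a..b} \<and> (\<Sum>K\<in>D. Sup K - Inf K) < \<delta> \<longrightarrow>
      (\<Sum>K\<in>D. cmod (f (Sup K) - f (Inf K))) < \<epsilon>)"

text \<open>The derivative of a locally absolutely continuous function exists almost everywhere. Where it
  does not exist (in particular possibly at the endpoint 0, because of the extension by zero), the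
  value below is arbitrary but immaterial, since the derivative only occurs under Lebesgue
  integrals.\<close>

abbreviation D1 :: "(real \<Rightarrow> complex) \<Rightarrow> real \<Rightarrow> complex" where
  "D1 f \<equiv> \<lambda>x. vector_derivative f (at x)"

definition H1_loc :: "ereal \<Rightarrow> (real \<Rightarrow> complex) set" where
  "H1_loc L = {f \<in> funs_on (Ico L).
     (\<forall>c. 0 \<le> c \<longrightarrow> ereal c < L \<longrightarrow> abs_cont_on 0 c f) \<and> D1 f \<in> L2_loc L}"

definition H1_c :: "ereal \<Rightarrow> (real \<Rightarrow> complex) set" where
  "H1_c L = {f \<in> H1_loc L.
     f \<in> sq_int (lebesgue_on (Ico L)) \<and> D1 f \<in> sq_int (lebesgue_on (Ico L)) \<and>
     (\<exists>K. compact K \<and> K \<subseteq> Ico L \<and> f \<in> funs_on K)}"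

definition H1_norm :: "ereal \<Rightarrow> (real \<Rightarrow> complex) \<Rightarrow> real" where
  "H1_norm L f = sqrt ((LINT x|lebesgue_on (Ico L). (cmod (f x))\<^sup>2)
                     + (LINT x|lebesgue_on (Ico L). (cmod (D1 f x))\<^sup>2))"

text \<open>The topological dual of \<open>H1_c L\<close> with its inductive limit topology: a linear functional is
  continuous iff its restriction to the functions supported in K is bounded with respect to
  the \<open>H1\<close> norm, for every compact subset K of [0,L). Values of \<open>\<phi>\<close> outside of \<open>H1_c L\<close> carry
  no meaning.\<close>

definition Hm1_loc :: "ereal \<Rightarrow> ((real \<Rightarrow> complex) \<Rightarrow> complex) set" where
  "Hm1_loc L = {\<phi>.
     (\<forall>f\<in>H1_c L. \<forall>g\<in>H1_c L. \<phi> (\<lambda>x. f x + g x) = \<phi> f + \<phi> g) \<and>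
     (\<forall>a. \<forall>f\<in>H1_c L. \<phi> (\<lambda>x. a * f x) = a * \<phi> f) \<and>
     (\<forall>K. compact K \<and> K \<subseteq> Ico L \<longrightarrow>
        (\<exists>C. \<forall>f\<in>H1_c L \<inter> funs_on K. cmod (\<phi> f) \<le> C * H1_norm L f))}"

definition real_valued_distr :: "ereal \<Rightarrow> ((real \<Rightarrow> complex) \<Rightarrow> complex) \<Rightarrow> bool" where
  "real_valued_distr L \<phi> \<longleftrightarrow>
     (\<exists>q\<in>L2_loc L. (AE x in lebesgue_on (Ico L). q x \<in> \<real>) \<and>
        (\<forall>h\<in>H1_c L. \<phi> h = - (LINT x|lebesgue_on (Ico L). q x * D1 h x)))"

definition borel_measure_on :: "ereal \<Rightarrow> real measure \<Rightarrow> bool" where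
  "borel_measure_on L \<upsilon> \<longleftrightarrow> sets \<upsilon> = sets (restrict_space borel (Ico L)) \<and>
     (\<forall>K. compact K \<and> K \<subseteq> Ico L \<longrightarrow> emeasure \<upsilon> K < \<infinity>)"

definition H_prime :: "ereal \<Rightarrow> (real \<Rightarrow> complex) set" where
  "H_prime L = {f \<in> H1_loc L. D1 f \<in> sq_int (lebesgue_on (Ico L)) \<and>
     (L < \<infinity> \<longrightarrow> (f \<longlongrightarrow> 0) (at_left (real_of_ereal L)))}"

definition H_prime_star :: "ereal \<Rightarrow> (real \<Rightarrow> complex) set" where
  "H_prime_star L = {f \<in> H_prime L. f 0 = 0}"


section \<open>The Hilbert space and linear relations in it\<close>

type_synonym hvec = "(real \<Rightarrow> complex) \<times> (real \<Rightarrow> complex) set"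

definition H_space :: "ereal \<Rightarrow> real measure \<Rightarrow> hvec set" where
  "H_space L \<upsilon> = H_prime_star L \<times> L2_space \<upsilon>"

definition H_inner :: "ereal \<Rightarrow> real measure \<Rightarrow> hvec \<Rightarrow> hvec \<Rightarrow> complex" where
  "H_inner L \<upsilon> f g =
     (LINT x|lebesgue_on (Ico L). D1 (fst f) x * cnj (D1 (fst g) x)) + L2_inner \<upsilon> (snd f) (snd g)"

definition adjoint_rel :: "'v set \<Rightarrow> ('v \<Rightarrow> 'v \<Rightarrow> complex) \<Rightarrow> ('v \<times> 'v) set \<Rightarrow> ('v \<times> 'v) set" where
  "adjoint_rel H ip T = {(f, g) \<in> H \<times> H. \<forall>(u, v)\<in>T. ip g u = ip f v}"

definition self_adjoint_rel :: "'v set \<Rightarrow> ('v \<Rightarrow> 'v \<Rightarrow> complex) \<Rightarrow> ('v \<times> 'v) set \<Rightarrow> bool" where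
  "self_adjoint_rel H ip T \<longleftrightarrow> T = adjoint_rel H ip T"

text \<open>Here \<open>f2\<close> and \<open>g2\<close> are representatives of the second components; both equations are
  invariant under a change of representatives.\<close>

definition T_rel ::
  "ereal \<Rightarrow> ((real \<Rightarrow> complex) \<Rightarrow> complex) \<Rightarrow> real measure \<Rightarrow> (hvec \<times> hvec) set" where
  "T_rel L \<omega> \<upsilon> =
    {((f1, L2_class \<upsilon> f2), (g1, L2_class \<upsilon> g2)) | f1 f2 g1 g2.
       f1 \<in> H_prime_star L \<and> f2 \<in> sq_int \<upsilon> \<and> g1 \<in> H_prime_star L \<and> g2 \<in> sq_int \<upsilon> \<and>
       (\<exists>\<Delta>. \<forall>h\<in>H1_c L.
          \<Delta> * h 0 + (LINT x|lebesgue_on (Ico L). D1 f1 x * D1 h x)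
            = \<omega> (\<lambda>x. g1 x * h x) + (LINT x|\<upsilon>. g2 x * h x)) \<and>
       (AE x in \<upsilon>. f2 x = g1 x)}"

end

theory Submission
  imports Defs
begin

text \<open>The relation is symmetric by Green's formula: the equation for \<open>(f, g)\<close> is tested with
  \<open>\<phi>\<^sub>n cnj v\<^sub>1\<close> and the one for \<open>(u, v)\<close> with \<open>\<phi>\<^sub>n cnj g\<^sub>1\<close>. The \<open>\<omega>\<close>-terms cancel because \<open>\<omega>\<close> is
  real, and the terms with \<open>\<phi>\<^sub>n'\<close> disappear in the limit for piecewise linear cutoff functions \<open>\<phi>\<^sub>n\<close>,
  by the bounds \<open>\<bar>v\<^sub>1 x\<bar>\<^sup>2 \<le> x \<parallel>v\<^sub>1'\<parallel>\<^sup>2\<close> and, for finite \<open>L\<close>, \<open>\<bar>v\<^sub>1 x\<bar>\<^sup>2 \<le> (L - x) \<parallel>v\<^sub>1'\<parallel>\<^sup>2\<close>.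

  Conversely, for compactly supported \<open>v\<^sub>1\<close> and \<open>v\<^sub>2\<close> with \<open>v\<^sub>1 0 = 0\<close>, the equation
  \<open>-u'' = \<omega> v\<^sub>1 + \<upsilon> v\<^sub>2\<close> has an explicit solution \<open>u\<close>, whose weak form even holds for test functions
  without compact support. Pairing \<open>(f, g)\<close> in the adjoint with \<open>((u, v\<^sub>1), (v\<^sub>1, v\<^sub>2))\<close> therefore gives
  an identity in \<open>v\<^sub>1\<close> and \<open>v\<^sub>2\<close>: the choice \<open>v\<^sub>1 = 0\<close> yields \<open>f\<^sub>2 = g\<^sub>1\<close> almost everywhere, and
  \<open>v\<^sub>2 = 0\<close> yields the differential equation tested with functions vanishing at 0; the constant
  \<open>\<Delta>\<close> accounts for the remaining test functions.

  That absolutely continuous functions are differentiable almost everywhere and integrals of their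
  derivatives is obtained from the positive variation, the Radon-Nikodym theorem and the
  differentiation of Henstock-Kurzweil integrals by a Vitali covering argument.\<close>

section \<open>Lebesgue differentiation on an interval\<close>

text \<open>The obstacle is that the weak equation admits only test functions of compact support,
  whereas the first components of the Hilbert space need not have compact support. For symmetry,
  cutoff functions bridge the gap, and the terms with their derivatives stay under control because
  their transition intervals are long compared with \<open>|v1|^2\<close>. For the adjoint, the test
  function \<open>cnj g1\<close> is admissible because beyond the supports of \<open>v1\<close> and
  \<open>v2\<close> the solution \<open>u\<close> has a constant derivative: it is 0 if
  \<open>L\<close> is infinite, and if \<open>L\<close> is finite, constants are orthogonal to the
  derivatives of all functions in \<open>H_prime_star L\<close>. Since \<open>v1\<close> has to
  vanish at 0, the adjoint is tested only on the kernel of \<open>h \<mapsto> h 0\<close>, a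
  subspace of codimension one; on all of \<open>H1_c L\<close> the equation then holds up to a
  multiple of \<open>h 0\<close>, which is the origin of \<Delta>. The measure theory at the start
  connects the epsilon-delta form of absolute continuity in \<open>H1_loc\<close> with
  \<open>D1\<close>, a pointwise derivative whose values are arbitrary where no derivative
  exists.\<close>

lemma negligible_not_has_vector_derivative_indefinite_integral:
  fixes f :: "real \<Rightarrow> 'a::euclidean_space"
  assumes f: "f integrable_on {a..b}"
  shows "negligible {x \<in> {a<..<b}. \<not> ((\<lambda>t. integral {a..t} f) has_vector_derivative f x) (at x)}"
proof -
  define F where "F t = integral {a..t} f" for t
  \<comment> \<open>At a point of \<open>E e\<close>, the difference quotients of \<open>F\<close>
    miss \<open>f x\<close> by more than \<open>e\<close> on arbitrarily small scales. Failure of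
    differentiability at \<open>x\<close> with value \<open>f x\<close> means membership for some
    \<open>e > 0\<close>.\<close>
  define E where "E e = {x \<in> {a<..<b}. \<forall>d>0. \<exists>y. y \<noteq> x \<and> \<bar>y - x\<bar> < d \<and>
      e * \<bar>y - x\<bar> < norm (F y - F x - (y - x) *\<^sub>R f x)}" for e
  have neg: "negligible (E e)" if "e > 0" for e
  proof -
    have "\<exists>T. E e \<subseteq> T \<and> T \<in> lmeasurable \<and> measure lebesgue T \<le> \<eta>" if "\<eta> > 0" for \<eta>
    proof -
      \<comment> \<open>The Vitali covering lemma enlarges radii by the factor 5, so a selected ball
        of radius \<open>r\<close> contributes length \<open>10 * r\<close>. Henstock's lemma with
        this bound yields a total radius below \<eta>/10.\<close>
      have "e * \<eta> / 10 > 0" using \<open>e > 0\<close> \<open>\<eta> > 0\<close> by simp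
      moreover have "f integrable_on cbox a b" using f by simp
      ultimately obtain \<gamma> where "gauge \<gamma>"
        and \<gamma>: "\<And>p. \<lbrakk>p tagged_partial_division_of (cbox a b); \<gamma> fine p\<rbrakk> \<Longrightarrow>
             (\<Sum>(x,k)\<in>p. norm (measure lborel k *\<^sub>R f x - integral k f)) < e * \<eta> / 10"
        by (rule_tac Henstock_lemma) blast+
      have "\<exists>y. y \<noteq> x \<and> cball x \<bar>y - x\<bar> \<subseteq> {a<..<b} \<inter> \<gamma> x \<and>
          e * \<bar>y - x\<bar> < norm (F y - F x - (y - x) *\<^sub>R f x)" if "x \<in> E e" for x
      proof -
        have "open ({a<..<b} \<inter> \<gamma> x)" "x \<in> {a<..<b} \<inter> \<gamma> x"
          using \<open>gauge \<gamma>\<close> that by (auto simp: gauge_def E_def)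
        then obtain d where "d > 0" "ball x d \<subseteq> {a<..<b} \<inter> \<gamma> x"
          by (meson open_contains_ball)
        moreover from \<open>d > 0\<close> that obtain y where "y \<noteq> x" "\<bar>y - x\<bar> < d"
            "e * \<bar>y - x\<bar> < norm (F y - F x - (y - x) *\<^sub>R f x)"
          by (auto simp: E_def)
        moreover have "cball x \<bar>y - x\<bar> \<subseteq> ball x d"
          using \<open>\<bar>y - x\<bar> < d\<close> by auto
        ultimately show ?thesis by blast
      qed
      then obtain y where y: "\<And>x. x \<in> E e \<Longrightarrow> y x \<noteq> x"
          "\<And>x. x \<in> E e \<Longrightarrow> cball x \<bar>y x - x\<bar> \<subseteq> {a<..<b} \<inter> \<gamma> x"
          "\<And>x. x \<in> E e \<Longrightarrow> e * \<bar>y x - x\<bar> < norm (F (y x) - F x - (y x - x) *\<^sub>R f x)"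
        by metis
      define r where "r x = \<bar>y x - x\<bar>" for x
      \<comment> \<open>The interval between \<open>x\<close> and its bad point \<open>y x\<close>
        serves as a Henstock interval tagged by \<open>x\<close>. It lies in the Vitali ball around
        \<open>x\<close>, hence in the gauge set of \<open>x\<close>, and intervals from disjoint
        balls are disjoint.\<close>
      define I where "I x = {min x (y x)..max x (y x)}" for x
      have I_sub: "I x \<subseteq> cball x (r x)" for x
        by (auto simp: I_def r_def dist_real_def)
      have I_ab: "I x \<subseteq> {a<..<b}" if "x \<in> E e" for x
        using I_sub[of x] y(2)[OF that] by (auto simp: r_def)
      have r: "0 < r x \<and> r x \<le> b - a" if "x \<in> E e" for x
      proof -
        have "x \<in> I x" "y x \<in> I x" by (auto simp: I_def)
        then have "x \<in> {a<..<b}" "y x \<in> {a<..<b}" using I_ab[OF that] by blast+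
        then show ?thesis using y(1)[OF that] by (auto simp: r_def)
      qed
      have I_est: "e * r x < norm (measure lborel (I x) *\<^sub>R f x - integral (I x) f)" if "x \<in> E e" for x
      proof -
        have xy: "a < x" "x < b" "a < y x" "y x < b"
          using I_ab[OF that] by (auto simp: I_def subset_iff)
        have fi: "f integrable_on {a..t}" if "t < b" for t
          using f by (rule integrable_subinterval_real) (use that in auto)
        show ?thesis
        proof (cases "x < y x")
          case True
          have "F (y x) = F x + integral {x..y x} f"
            unfolding F_def using True xy fi[of "y x"]
            by (intro Henstock_Kurzweil_Integration.integral_combine[symmetric]) auto
          then show ?thesis
            using y(3)[OF that] True by (simp add: I_def r_def norm_minus_commute)
        next
          case False
          have "F x = F (y x) + integral {y x..x} f"
            unfolding F_def using False xy fi[of x]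
            by (intro Henstock_Kurzweil_Integration.integral_combine[symmetric]) auto
          then have "F (y x) - F x - (y x - x) *\<^sub>R f x = measure lborel (I x) *\<^sub>R f x - integral (I x) f"
            using False by (simp add: I_def algebra_simps)
          then show ?thesis
            using y(3)[OF that] by (simp add: r_def)
        qed
      qed
      have "E e \<subseteq> (\<Union>i\<in>E e. cball i (r i))"
      proof
        fix x assume "x \<in> E e"
        then show "x \<in> (\<Union>i\<in>E e. cball i (r i))"
          using r[of x] by (intro UN_I[of x]) auto
      qed
      from Vitali_covering_lemma_cballs[OF this r]
      obtain C where C: "countable C" "C \<subseteq> E e"
          "pairwise (\<lambda>i j. disjnt (cball i (r i)) (cball j (r j))) C"
          "E e \<subseteq> (\<Union>i\<in>C. cball i (5 * r i))"
        by blast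
      \<comment> \<open>Henstock's lemma speaks of finite partial divisions, so the estimate is made
        for finite subfamilies. Being uniform, it passes to the countable family
        \<open>C\<close>.\<close>
      have bound: "measure lebesgue (\<Union>i\<in>C'. cball i (5 * r i)) \<le> \<eta>" if "C' \<subseteq> C" "finite C'" for C'
      proof -
        have CE: "C' \<subseteq> E e" using that C by auto
        define p where "p = (\<lambda>x. (x, I x)) ` C'"
        have inj: "inj_on (\<lambda>x. (x, I x)) C'" by (auto simp: inj_on_def)
        have disj: "I x \<inter> I x' = {}" if "x \<in> C'" "x' \<in> C'" "x \<noteq> x'" for x x'
          using C(3) that \<open>C' \<subseteq> C\<close> I_sub[of x] I_sub[of x']
          unfolding pairwise_def disjnt_def by blast
        have "p tagged_partial_division_of cbox a b"
          unfolding tagged_partial_division_of_def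
        proof (intro conjI allI impI)
          show "finite p" using that by (simp add: p_def)
        next
          fix x K assume "(x, K) \<in> p"
          then have K: "K = I x" "x \<in> C'" by (auto simp: p_def)
          show "x \<in> K" by (auto simp: K I_def)
          show "K \<subseteq> cbox a b" using I_ab[of x] CE K by fastforce
          show "\<exists>a b. K = cbox a b" by (auto simp: K I_def)
        next
          fix x1 K1 x2 K2 assume "(x1, K1) \<in> p \<and> (x2, K2) \<in> p \<and> (x1, K1) \<noteq> (x2, K2)"
          then have "K1 \<inter> K2 = {}" using disj[of x1 x2] by (auto simp: p_def)
          then show "interior K1 \<inter> interior K2 = {}"
            using interior_subset by fastforce
        qed
        moreover have "\<gamma> fine p"
        proof (rule fineI)
          fix x K assume "(x, K) \<in> p"
          then show "K \<subseteq> \<gamma> x"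
            using I_sub[of x] y(2)[of x] CE by (auto simp: p_def r_def)
        qed
        ultimately have "(\<Sum>(x,k)\<in>p. norm (measure lborel k *\<^sub>R f x - integral k f)) < e * \<eta> / 10"
          by (rule \<gamma>)
        moreover have "(\<Sum>x\<in>C'. e * r x) \<le> (\<Sum>(x,k)\<in>p. norm (measure lborel k *\<^sub>R f x - integral k f))"
          unfolding p_def sum.reindex[OF inj] using I_est CE
          by (auto intro!: sum_mono intro: less_imp_le)
        ultimately have "e * (\<Sum>x\<in>C'. r x) < e * (\<eta> / 10)"
          by (simp add: sum_distrib_left)
        then have "(\<Sum>x\<in>C'. r x) < \<eta> / 10" using \<open>e > 0\<close> by simp
        moreover have "measure lebesgue (\<Union>i\<in>C'. cball i (5 * r i)) \<le> (\<Sum>i\<in>C'. measure lebesgue (cball i (5 * r i)))"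
          using that by (intro measure_UNION_le) auto
        moreover have "measure lebesgue (cball i (5 * r i)) = 10 * r i" if "i \<in> C'" for i
          using r[of i] CE that by (auto simp: cball_eq_atLeastAtMost)
        ultimately show ?thesis by (simp add: sum_distrib_left[symmetric])
      qed
      show ?thesis
      proof (intro exI conjI)
        show "(\<Union>i\<in>C. cball i (5 * r i)) \<in> lmeasurable"
          by (rule fmeasurable_UN_bound[OF C(1) _ bound]) auto
        show "measure lebesgue (\<Union>i\<in>C. cball i (5 * r i)) \<le> \<eta>"
          by (rule measure_UN_bound[OF C(1) _ bound]) auto
      qed fact
    qed
    then show ?thesis by (subst negligible_outer_le) blast
  qed
  have "{x \<in> {a<..<b}. \<not> (F has_vector_derivative f x) (at x)} \<subseteq> (\<Union>n. E (inverse (real (Suc n))))"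
  proof
    fix x assume "x \<in> {x \<in> {a<..<b}. \<not> (F has_vector_derivative f x) (at x)}"
    then have x: "x \<in> {a<..<b}" "\<not> (F has_vector_derivative f x) (at x)" by auto
    have "\<exists>e>0. x \<in> E e"
    proof (rule ccontr)
      assume *: "\<not> (\<exists>e>0. x \<in> E e)"
      have "\<exists>d>0. \<forall>y. norm (y - x) < d \<longrightarrow> norm (F y - F x - (y - x) *\<^sub>R f x) \<le> e * norm (y - x)"
        if "e > 0" for e
        proof -
        from * that have "x \<notin> E e" by blast
        then obtain d where d: "d > 0" "\<forall>y. y = x \<or> d \<le> \<bar>y - x\<bar> \<or>
            norm (F y - F x - (y - x) *\<^sub>R f x) \<le> e * \<bar>y - x\<bar>"
          using x(1) by (auto simp: E_def not_less)
        have "norm (F y - F x - (y - x) *\<^sub>R f x) \<le> e * \<bar>y - x\<bar>" if "\<bar>y - x\<bar> < d" for y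
          using d(2)[rule_format, of y] that by (cases "y = x") auto
        with \<open>d > 0\<close> show ?thesis by auto
      qed
      then have "(F has_vector_derivative f x) (at x)"
        unfolding has_vector_derivative_def has_derivative_at_alt
        by (auto intro: bounded_linear_scaleR_left)
      with x(2) show False by simp
    qed
    then obtain e where "e > 0" "x \<in> E e" by blast
    then obtain n where n: "inverse (real (Suc n)) < e"
      using reals_Archimedean by blast
    have "x \<in> E (inverse (real (Suc n)))"
      unfolding E_def
    proof (intro CollectI conjI allI impI)
      fix d :: real assume "d > 0"
      then obtain y where y: "y \<noteq> x" "\<bar>y - x\<bar> < d" "e * \<bar>y - x\<bar> < norm (F y - F x - (y - x) *\<^sub>R f x)"
        using \<open>x \<in> E e\<close> by (auto simp: E_def)
      have "inverse (real (Suc n)) * \<bar>y - x\<bar> \<le> e * \<bar>y - x\<bar>"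
        using n by (intro mult_right_mono) auto
      with y(3) have "inverse (real (Suc n)) * \<bar>y - x\<bar> < norm (F y - F x - (y - x) *\<^sub>R f x)"
        by (rule le_less_trans[rotated])
      with y(1,2) show "\<exists>y. y \<noteq> x \<and> \<bar>y - x\<bar> < d \<and>
          inverse (real (Suc n)) * \<bar>y - x\<bar> < norm (F y - F x - (y - x) *\<^sub>R f x)"
        by blast
    qed (use x in auto)
    then show "x \<in> (\<Union>n. E (inverse (real (Suc n))))" by blast
  qed
  moreover have "negligible (\<Union>n. E (inverse (real (Suc n))))"
    by (intro negligible_Union_nat neg) auto
  ultimately show ?thesis
    unfolding F_def by (rule negligible_subset[rotated])
qed

section \<open>Absolutely continuous functions have integrable densities\<close>

text \<open>Families of intervals are encoded by endpoint pairs rather than by divisions, so that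
  cutting at a point and merging are operations on pairs. Because the intervals are nondegenerate,
  families inside nonoverlapping intervals have no member in common, and sums over their union
  split.\<close>

definition disjoint_ivls :: "real \<Rightarrow> real \<Rightarrow> (real \<times> real) set \<Rightarrow> bool" where
  "disjoint_ivls a b D \<longleftrightarrow> finite D \<and> (\<forall>z\<in>D. a \<le> fst z \<and> fst z < snd z \<and> snd z \<le> b) \<and>
     (\<forall>z\<in>D. \<forall>z'\<in>D. z \<noteq> z' \<longrightarrow> snd z \<le> fst z' \<or> snd z' \<le> fst z)"

definition increments :: "(real \<Rightarrow> real) \<Rightarrow> (real \<times> real) set \<Rightarrow> real" where
  "increments u D = (\<Sum>z\<in>D. u (snd z) - u (fst z))"

lemma disjoint_ivlsI:
  assumes "finite D" "\<And>z. z \<in> D \<Longrightarrow> a \<le> fst z \<and> fst z < snd z \<and> snd z \<le> b"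
    "\<And>z z'. z \<in> D \<Longrightarrow> z' \<in> D \<Longrightarrow> z \<noteq> z' \<Longrightarrow> snd z \<le> fst z' \<or> snd z' \<le> fst z"
  shows "disjoint_ivls a b D"
  using assms unfolding disjoint_ivls_def by blast

lemma disjoint_ivlsD:
  assumes "disjoint_ivls a b D"
  shows "finite D" "z \<in> D \<Longrightarrow> a \<le> fst z \<and> fst z < snd z \<and> snd z \<le> b"
    "z \<in> D \<Longrightarrow> z' \<in> D \<Longrightarrow> z \<noteq> z' \<Longrightarrow> snd z \<le> fst z' \<or> snd z' \<le> fst z"
  using assms unfolding disjoint_ivls_def by blast+

lemma disjoint_ivls_mono:
  assumes "disjoint_ivls a b D" "a' \<le> a" "b \<le> b'"
  shows "disjoint_ivls a' b' D"
proof (rule disjoint_ivlsI)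
  show "a' \<le> fst z \<and> fst z < snd z \<and> snd z \<le> b'" if "z \<in> D" for z
    using disjoint_ivlsD(2)[OF assms(1) that] assms(2,3) by linarith
qed (use disjoint_ivlsD(1,3)[OF assms(1)] in blast)+

lemma disjoint_ivls_empty: "disjoint_ivls a b {}"
  by (simp add: disjoint_ivls_def)

lemma disjoint_ivls_eq_empty: "disjoint_ivls a b D \<Longrightarrow> b \<le> a \<Longrightarrow> D = {}"
  using disjoint_ivlsD(2)[of a b D] by force

text \<open>Bridge to the divisions in the definition of \<open>abs_cont_on\<close>: sending a pair
  to its closed interval is injective on nondegenerate pairs, so sums over pairs and sums over a
  division agree.\<close>

lemma abs_cont_on_disjoint_ivls:
  assumes "abs_cont_on a b f" "\<epsilon> > 0"
  obtains \<delta> where "\<delta> > 0"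
    "\<And>D. disjoint_ivls a b D \<Longrightarrow> increments (\<lambda>x. x) D < \<delta> \<Longrightarrow> (\<Sum>z\<in>D. cmod (f (snd z) - f (fst z))) < \<epsilon>"
proof -
  obtain \<delta> where "\<delta> > 0" and \<delta>: "\<forall>D. D division_of \<Union>D \<and> \<Union>D \<subseteq> {a..b} \<and>
      (\<Sum>K\<in>D. Sup K - Inf K) < \<delta> \<longrightarrow> (\<Sum>K\<in>D. cmod (f (Sup K) - f (Inf K))) < \<epsilon>"
    using assms(1)[unfolded abs_cont_on_def, THEN spec, THEN mp, OF assms(2)]
    by - (elim exE conjE, rule that)
  show thesis
  proof (rule that[OF \<open>\<delta> > 0\<close>])
    fix D assume D: "disjoint_ivls a b D" and len: "increments (\<lambda>x. x) D < \<delta>"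
    note D' = disjoint_ivlsD[OF D]
    define iv where "iv z = {fst z..snd z}" for z :: "real \<times> real"
    have inj: "inj_on iv D"
    proof (rule inj_onI)
      fix z z' assume "z \<in> D" "z' \<in> D" "iv z = iv z'"
      then show "z = z'"
        using D'(2)[of z] D'(2)[of z'] by (auto simp: iv_def Icc_eq_Icc prod_eq_iff)
    qed
    have SupInf: "Sup (iv z) = snd z" "Inf (iv z) = fst z" if "z \<in> D" for z
      using D'(2)[OF that] by (auto simp: iv_def)
    have "(\<Sum>K\<in>iv ` D. cmod (f (Sup K) - f (Inf K))) < \<epsilon>"
    proof (rule \<delta>[rule_format], intro conjI)
      show "iv ` D division_of \<Union> (iv ` D)"
        unfolding division_of_def
      proof (intro conjI ballI impI)
        fix K assume "K \<in> iv ` D"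
        then obtain z where z: "z \<in> D" "K = iv z" by blast
        show "K \<noteq> {}" using D'(2)[OF z(1)] by (auto simp: z iv_def)
        show "\<exists>a b. K = cbox a b" by (auto simp: z iv_def)
        show "K \<subseteq> \<Union> (iv ` D)" using z by blast
      next
        fix K1 K2 assume *: "K1 \<in> iv ` D" "K2 \<in> iv ` D" "K1 \<noteq> K2"
        then obtain z z' where K: "z \<in> D" "z' \<in> D" "K1 = iv z" "K2 = iv z'" "z \<noteq> z'"
          by blast
        then have "snd z \<le> fst z' \<or> snd z' \<le> fst z" using D'(3) by blast
        then show "interior K1 \<inter> interior K2 = {}" by (auto simp: K iv_def)
      qed (use D' in auto)
      show "\<Union> (iv ` D) \<subseteq> {a..b}"
      proof (rule Union_least)
        fix K assume "K \<in> iv ` D"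
        then obtain z where "z \<in> D" "K = iv z" by blast
        then show "K \<subseteq> {a..b}" using D'(2)[of z] by (auto simp: iv_def)
      qed
      show "(\<Sum>K\<in>iv ` D. Sup K - Inf K) < \<delta>"
        using len by (simp add: sum.reindex[OF inj] SupInf increments_def)
    qed
    then show "(\<Sum>z\<in>D. cmod (f (snd z) - f (fst z))) < \<epsilon>"
      by (simp add: sum.reindex[OF inj] SupInf)
  qed
qed

section \<open>Lengths and increments of interval families\<close>

lemma disjoint_ivls_length_le_measure:
  assumes D: "disjoint_ivls a b D" and T: "T \<in> lmeasurable" "\<And>z. z \<in> D \<Longrightarrow> {fst z<..<snd z} \<subseteq> T"
  shows "increments (\<lambda>x. x) D \<le> measure lebesgue T"
proof -
  note D' = disjoint_ivlsD[OF D]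
  have "increments (\<lambda>x. x) D = (\<Sum>z\<in>D. measure lebesgue {fst z<..<snd z})"
    unfolding increments_def
  proof (rule sum.cong)
    fix z assume "z \<in> D"
    then show "snd z - fst z = measure lebesgue {fst z<..<snd z}"
      using D'(2)[of z] by simp
  qed simp
  also have "\<dots> = measure lebesgue (\<Union>z\<in>D. {fst z<..<snd z})"
  proof (rule measure_finite_Union[symmetric])
    show "disjoint_family_on (\<lambda>z. {fst z<..<snd z}) D"
      unfolding disjoint_family_on_def
    proof (intro ballI impI)
      fix z z' assume "z \<in> D" "z' \<in> D" "z \<noteq> z'"
      then show "{fst z<..<snd z} \<inter> {fst z'<..<snd z'} = {}"
        using D'(3)[of z z'] by auto
    qed
    show "emeasure lebesgue {fst z<..<snd z} \<noteq> \<infinity>" if "z \<in> D" for z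
      using D'(2)[OF that] by simp
  qed (use D'(1) in auto)
  also have "\<dots> \<le> measure lebesgue T"
    using T D'(1) by (intro measure_mono_fmeasurable) auto
  finally show ?thesis .
qed

lemma disjoint_ivls_length_le:
  assumes D: "disjoint_ivls a b D" and "a \<le> b"
  shows "increments (\<lambda>x. x) D \<le> b - a"
proof -
  have "increments (\<lambda>x. x) D \<le> measure lebesgue {a..b}"
  proof (rule disjoint_ivls_length_le_measure[OF D])
    fix z assume "z \<in> D"
    then show "{fst z<..<snd z} \<subseteq> {a..b}" using disjoint_ivlsD(2)[OF D, of z] by auto
  qed simp
  with \<open>a \<le> b\<close> show ?thesis by simp
qed

text \<open>An interval with \<open>x\<close> in its interior is cut there, and its increment
  telescopes; all others lie on one side and are kept. This additivity underlies both the
  boundedness of increments and the near-optimal families for the positive variation.\<close>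

lemma disjoint_ivls_split:
  assumes D: "disjoint_ivls a b D"
  obtains D1 D2 where "disjoint_ivls a x D1" "disjoint_ivls x b D2"
    "increments u D = increments u D1 + increments u D2"
proof -
  note D' = disjoint_ivlsD[OF D]
  define A1 where "A1 = {z \<in> D. fst z < x}"
  define A2 where "A2 = {z \<in> D. x < snd z}"
  define cut1 where "cut1 z = (fst z, min (snd z) x)" for z :: "real \<times> real"
  define cut2 where "cut2 z = (max (fst z) x, snd z)" for z :: "real \<times> real"
  have cut1: "snd (cut1 z) \<le> fst (cut1 z') \<or> snd (cut1 z') \<le> fst (cut1 z)" "cut1 z \<noteq> cut1 z'"
    if "z \<in> A1" "z' \<in> A1" "z \<noteq> z'" for z z'
    using that D'(2)[of z] D'(2)[of z'] D'(3)[of z z'] by (auto simp: cut1_def A1_def)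
  have cut2: "snd (cut2 z) \<le> fst (cut2 z') \<or> snd (cut2 z') \<le> fst (cut2 z)" "cut2 z \<noteq> cut2 z'"
    if "z \<in> A2" "z' \<in> A2" "z \<noteq> z'" for z z'
    using that D'(2)[of z] D'(2)[of z'] D'(3)[of z z'] by (auto simp: cut2_def A2_def)
  have inj1: "inj_on cut1 A1" and inj2: "inj_on cut2 A2"
    using cut1(2) cut2(2) by (meson inj_onI)+
  have fin: "finite A1" "finite A2" using D'(1) by (auto simp: A1_def A2_def)
  have "disjoint_ivls a x (cut1 ` A1)"
  proof (rule disjoint_ivlsI)
    fix w assume "w \<in> cut1 ` A1"
    then obtain z where "z \<in> D" "fst z < x" "w = cut1 z" by (auto simp: A1_def)
    then show "a \<le> fst w \<and> fst w < snd w \<and> snd w \<le> x"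
      using D'(2)[of z] by (auto simp: cut1_def)
  qed (use fin cut1(1) in \<open>blast+\<close>)
  moreover have "disjoint_ivls x b (cut2 ` A2)"
  proof (rule disjoint_ivlsI)
    fix w assume "w \<in> cut2 ` A2"
    then obtain z where "z \<in> D" "x < snd z" "w = cut2 z" by (auto simp: A2_def)
    then show "x \<le> fst w \<and> fst w < snd w \<and> snd w \<le> b"
      using D'(2)[of z] by (auto simp: cut2_def)
  qed (use fin cut2(1) in \<open>blast+\<close>)
  moreover have "increments u D = increments u (cut1 ` A1) + increments u (cut2 ` A2)"
  proof -
    have "increments u (cut1 ` A1) = (\<Sum>z\<in>D. if fst z < x then u (min (snd z) x) - u (fst z) else 0)"
      unfolding increments_def sum.reindex[OF inj1]
      using D'(1) by (simp add: A1_def sum.inter_filter cut1_def)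
    moreover have "increments u (cut2 ` A2) = (\<Sum>z\<in>D. if x < snd z then u (snd z) - u (max (fst z) x) else 0)"
      unfolding increments_def sum.reindex[OF inj2]
      using D'(1) by (simp add: A2_def sum.inter_filter cut2_def)
    moreover have "increments u D = (\<Sum>z\<in>D. (if fst z < x then u (min (snd z) x) - u (fst z) else 0)
        + (if x < snd z then u (snd z) - u (max (fst z) x) else 0))"
      unfolding increments_def
    proof (rule sum.cong)
      fix z assume "z \<in> D"
      then show "u (snd z) - u (fst z) = (if fst z < x then u (min (snd z) x) - u (fst z) else 0)
        + (if x < snd z then u (snd z) - u (max (fst z) x) else 0)"
        using D'(2)[of z] by (auto simp: min_def max_def)
    qed simp
    ultimately show ?thesis by (simp add: sum.distrib)
  qed
  ultimately show thesis by (rule that)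
qed

lemma abs_cont_increments_small:
  assumes u: "abs_cont_on a b (\<lambda>x. complex_of_real (u x))" and "\<epsilon> > 0"
  obtains \<delta> where "\<delta> > 0"
    "\<And>D. disjoint_ivls a b D \<Longrightarrow> increments (\<lambda>x. x) D < \<delta> \<Longrightarrow> \<bar>increments u D\<bar> < \<epsilon>"
proof -
  obtain \<delta> where \<delta>: "\<delta> > 0"
    "\<And>D. disjoint_ivls a b D \<Longrightarrow> increments (\<lambda>x. x) D < \<delta> \<Longrightarrow>
      (\<Sum>z\<in>D. cmod (complex_of_real (u (snd z)) - complex_of_real (u (fst z)))) < \<epsilon>"
    using abs_cont_on_disjoint_ivls[OF assms] by blast
  show thesis
  proof (rule that[OF \<delta>(1)])
    fix D assume D: "disjoint_ivls a b D" "increments (\<lambda>x. x) D < \<delta>"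
    have "\<bar>increments u D\<bar> \<le> (\<Sum>z\<in>D. cmod (complex_of_real (u (snd z)) - complex_of_real (u (fst z))))"
      unfolding increments_def of_real_diff[symmetric] norm_of_real by (rule sum_abs)
    with \<delta>(2)[OF D] show "\<bar>increments u D\<bar> < \<epsilon>" by simp
  qed
qed

text \<open>Let \<delta> belong to the tolerance 1. An interval of length at most \<delta>/2
  contributes less than 1 to the increments, so \<open>n\<close> such pieces contribute at most
  \<open>n\<close>; the induction splits off the rightmost piece.\<close>

lemma abs_cont_increments_bounded:
  assumes u: "abs_cont_on a b (\<lambda>x. complex_of_real (u x))"
  obtains B where "\<And>D. disjoint_ivls a b D \<Longrightarrow> increments u D \<le> B"
proof -
  obtain \<delta> where \<delta>: "\<delta> > 0"
    "\<And>D. disjoint_ivls a b D \<Longrightarrow> increments (\<lambda>x. x) D < \<delta> \<Longrightarrow> \<bar>increments u D\<bar> < 1"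
    using abs_cont_increments_small[OF u zero_less_one] by blast
  have step: "increments u D \<le> real n" if "y \<le> b" "y \<le> a + real n * (\<delta> / 2)" "disjoint_ivls a y D" for n y D
    using that
  proof (induction n arbitrary: y D)
    case 0
    then have "D = {}" using disjoint_ivls_eq_empty by simp
    then show ?case by (simp add: increments_def)
  next
    case (Suc n)
    show ?case
    proof (cases "a \<le> y")
      case False
      then have "D = {}" using disjoint_ivls_eq_empty[OF Suc(4)] by simp
      then show ?thesis by (simp add: increments_def)
    next
      case True
      \<comment> \<open>Stepping back by \<delta>/2 keeps the last piece strictly shorter than
        \<delta>; the maximum with \<open>a\<close> stops the cut at the left endpoint.\<close>
      define x where "x = max a (y - \<delta> / 2)"
      obtain D1 D2 where D12: "disjoint_ivls a x D1" "disjoint_ivls x y D2"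
          "increments u D = increments u D1 + increments u D2"
        using disjoint_ivls_split[OF Suc(4)] by blast
      have "increments u D1 \<le> real n"
        using Suc(2,3) D12(1) \<delta>(1) True by (intro Suc.IH[of x]) (auto simp: x_def algebra_simps add_divide_distrib)
      moreover have "\<bar>increments u D2\<bar> < 1"
      proof (rule \<delta>(2))
        show "disjoint_ivls a b D2"
          using D12(2) Suc(2) by (rule_tac disjoint_ivls_mono) (auto simp: x_def)
        have "increments (\<lambda>x. x) D2 \<le> y - x"
          using True \<delta>(1) by (intro disjoint_ivls_length_le[OF D12(2)]) (auto simp: x_def)
        also have "\<dots> < \<delta>" using \<delta>(1) by (auto simp: x_def)
        finally show "increments (\<lambda>x. x) D2 < \<delta>" .
      qed
      ultimately show ?thesis using D12(3) by simp
    qed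
  qed
  obtain n where "(b - a) / (\<delta> / 2) < real n" using reals_Archimedean2 by blast
  then have "b \<le> a + real n * (\<delta> / 2)" using \<delta>(1) by (simp add: field_simps)
  from step[OF order_refl this] show thesis by (rule that)
qed

text \<open>The supremum of signed increments over families in \<open>[a, x]\<close> is the positive
  variation, because a family may omit the intervals on which \<open>u\<close> decreases. Adjoining
  the interval from \<open>x\<close> to \<open>y\<close> to a family shows that \<open>P - u\<close>
  increases. For the epsilon-delta property, every interval of \<open>D\<close> is replaced by a
  nearly optimal family inside it: the merged family is no longer than \<open>D\<close>, so absolute
  continuity of \<open>u\<close> applies to it.\<close>

lemma abs_cont_positive_variation:
  assumes u: "abs_cont_on a b (\<lambda>x. complex_of_real (u x))" and "a \<le> b"
  obtains P where "mono_on {a..b} P" "mono_on {a..b} (\<lambda>x. P x - u x)"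
    "\<And>\<epsilon>. \<epsilon> > 0 \<Longrightarrow> \<exists>\<delta>>0. \<forall>D. disjoint_ivls a b D \<and> increments (\<lambda>x. x) D < \<delta> \<longrightarrow> increments P D < \<epsilon>"
proof -
  obtain B where B: "\<And>D. disjoint_ivls a b D \<Longrightarrow> increments u D \<le> B"
    using abs_cont_increments_bounded[OF u] by blast
  define P where "P x = (SUP D\<in>{D. disjoint_ivls a x D}. increments u D)" for x
  have P_upper: "increments u D \<le> P x" if "disjoint_ivls a x D" "x \<le> b" for x D
    unfolding P_def
  proof (rule cSUP_upper)
    show "bdd_above (increments u ` {D. disjoint_ivls a x D})"
      using B disjoint_ivls_mono[OF _ order_refl that(2)] by (auto intro!: bdd_aboveI2[of _ _ B])
  qed (use that in simp)
  have P_least: "P x \<le> M" if "\<And>D. disjoint_ivls a x D \<Longrightarrow> increments u D \<le> M" for x M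
    unfolding P_def using that disjoint_ivls_empty by (intro cSUP_least) auto
  have P_mono: "P x \<le> P y" if "x \<le> y" "y \<le> b" for x y
    by (rule P_least) (use disjoint_ivls_mono[OF _ order_refl that(1)] P_upper that in blast)
  have P_diff: "P x + (u y - u x) \<le> P y" if "a \<le> x" "x \<le> y" "y \<le> b" for x y
  proof (cases "x = y")
    case False
    with that have "x < y" by simp
    have "P x \<le> P y - (u y - u x)"
    proof (rule P_least)
      fix D assume D: "disjoint_ivls a x D"
      note D' = disjoint_ivlsD[OF D]
      have "(x, y) \<notin> D" using D'(2)[of "(x, y)"] \<open>x < y\<close> by auto
      then have "increments u (insert (x, y) D) = increments u D + (u y - u x)"
        using D'(1) by (simp add: increments_def)
      moreover have "disjoint_ivls a y (insert (x, y) D)"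
      proof (rule disjoint_ivlsI)
        show "a \<le> fst z \<and> fst z < snd z \<and> snd z \<le> y" if "z \<in> insert (x, y) D" for z
          using that D'(2)[of z] \<open>a \<le> x\<close> \<open>x < y\<close> by auto
        show "snd z \<le> fst z' \<or> snd z' \<le> fst z"
          if "z \<in> insert (x, y) D" "z' \<in> insert (x, y) D" "z \<noteq> z'" for z z'
          using that D'(2)[of z] D'(2)[of z'] D'(3)[of z z'] by auto
      qed (use D' in simp)
      ultimately show "increments u D \<le> P y - (u y - u x)"
        using P_upper[of y "insert (x, y) D"] that by simp
    qed
    then show ?thesis by simp
  qed simp
  \<comment> \<open>If every family between \<open>p\<close> and \<open>q\<close> fell short of
    \<open>P q - P p\<close> by \<eta>, splitting an arbitrary family at \<open>p\<close> would give
    the absurd bound \<open>P q \<le> P q - \<eta>\<close>.\<close>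
  have P_near: "\<exists>E. disjoint_ivls p q E \<and> P q - P p < increments u E + \<eta>"
    if "p \<le> q" "q \<le> b" "\<eta> > 0" for p q \<eta>
  proof (rule ccontr)
    assume *: "\<not> ?thesis"
    have "P q \<le> P q - \<eta>"
    proof (rule P_least)
      fix D assume "disjoint_ivls a q D"
      then obtain D1 D2 where D: "disjoint_ivls a p D1" "disjoint_ivls p q D2"
          "increments u D = increments u D1 + increments u D2"
        using disjoint_ivls_split by blast
      have "increments u D1 \<le> P p" using P_upper[OF D(1)] that by simp
      moreover have "increments u D2 \<le> P q - P p - \<eta>" using * D(2) by force
      ultimately show "increments u D \<le> P q - \<eta>" using D(3) by simp
    qed
    with \<open>\<eta> > 0\<close> show False by simp
  qed
  show thesis
  proof (rule that)
    show "mono_on {a..b} P" using P_mono by (auto intro: mono_onI)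
    show "mono_on {a..b} (\<lambda>x. P x - u x)"
    proof (rule mono_onI)
      fix x y assume "x \<in> {a..b}" "y \<in> {a..b}" "x \<le> y"
      then show "P x - u x \<le> P y - u y" using P_diff[of x y] by simp
    qed
  next
    fix \<epsilon> :: real assume "\<epsilon> > 0"
    then have "\<epsilon> / 2 > 0" by simp
    from abs_cont_increments_small[OF u this] obtain \<delta> where \<delta>: "\<delta> > 0"
      "\<And>D. disjoint_ivls a b D \<Longrightarrow> increments (\<lambda>x. x) D < \<delta> \<Longrightarrow> \<bar>increments u D\<bar> < \<epsilon> / 2"
      by blast
    have "increments P D < \<epsilon>" if D: "disjoint_ivls a b D" and len: "increments (\<lambda>x. x) D < \<delta>" for D
    proof -
      note D' = disjoint_ivlsD[OF D]
      \<comment> \<open>One error \<eta> arises for each interval of \<open>D\<close>; together they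
        amount to at most \<epsilon>/2. The \<open>+ 1\<close> covers the empty family.\<close>
      define \<eta> where "\<eta> = \<epsilon> / (2 * real (card D + 1))"
      have "\<eta> > 0" using \<open>\<epsilon> > 0\<close> by (simp add: \<eta>_def)
      have "\<exists>E. disjoint_ivls (fst z) (snd z) E \<and> P (snd z) - P (fst z) < increments u E + \<eta>" if "z \<in> D" for z
        using P_near[of "fst z" "snd z" \<eta>] D'(2)[OF that] \<open>\<eta> > 0\<close> by simp
      then obtain E where E: "\<And>z. z \<in> D \<Longrightarrow> disjoint_ivls (fst z) (snd z) (E z)"
          "\<And>z. z \<in> D \<Longrightarrow> P (snd z) - P (fst z) < increments u (E z) + \<eta>"
        by metis
      have Ez: "fst z \<le> fst w \<and> fst w < snd w \<and> snd w \<le> snd z" if "z \<in> D" "w \<in> E z" for z w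
        using disjoint_ivlsD(2)[OF E(1)[OF that(1)] that(2)] .
      have sep: "snd w \<le> fst w' \<or> snd w' \<le> fst w" if "z \<in> D" "w \<in> E z" "z' \<in> D" "w' \<in> E z'" "z \<noteq> z'" for z z' w w'
        using Ez[of z w] Ez[of z' w'] D'(3)[of z z'] that by fastforce
      have E_disj: "E z \<inter> E z' = {}" if "z \<in> D" "z' \<in> D" "z \<noteq> z'" for z z'
        using sep[of z _ z'] Ez[of z] that by fastforce
      have inc_UN: "increments v (\<Union>z\<in>D. E z) = (\<Sum>z\<in>D. increments v (E z))" for v
        unfolding increments_def
        using D'(1) disjoint_ivlsD(1)[OF E(1)] E_disj by (intro sum.UNION_disjoint) blast+
      have UN: "disjoint_ivls a b (\<Union>z\<in>D. E z)"
      proof (rule disjoint_ivlsI)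
        show "finite (\<Union>z\<in>D. E z)" using D'(1) disjoint_ivlsD(1)[OF E(1)] by blast
        show "a \<le> fst w \<and> fst w < snd w \<and> snd w \<le> b" if "w \<in> (\<Union>z\<in>D. E z)" for w
        proof -
          from that obtain z where "z \<in> D" "w \<in> E z" by blast
          with Ez[of z w] D'(2)[of z] show ?thesis by simp
        qed
        show "snd w \<le> fst w' \<or> snd w' \<le> fst w"
          if w: "w \<in> (\<Union>z\<in>D. E z)" "w' \<in> (\<Union>z\<in>D. E z)" "w \<noteq> w'" for w w'
        proof -
          from w obtain z z' where z: "z \<in> D" "w \<in> E z" "z' \<in> D" "w' \<in> E z'" by blast
          show ?thesis
          proof (cases "z = z'")
            case True
            then show ?thesis using z w(3) disjoint_ivlsD(3)[OF E(1)[OF z(1)]] by blast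
          next
            case False
            then show ?thesis using sep z by blast
          qed
        qed
      qed
      have "increments (\<lambda>x. x) (\<Union>z\<in>D. E z) \<le> increments (\<lambda>x. x) D"
        unfolding inc_UN unfolding increments_def[of _ D]
      proof (rule sum_mono)
        fix z assume "z \<in> D"
        then show "increments (\<lambda>x. x) (E z) \<le> snd z - fst z"
          using disjoint_ivls_length_le[OF E(1)] D'(2)[of z] by simp
      qed
      then have "(\<Sum>z\<in>D. increments u (E z)) < \<epsilon> / 2"
        using \<delta>(2)[OF UN] len by (simp add: inc_UN)
      moreover have "increments P D \<le> (\<Sum>z\<in>D. increments u (E z) + \<eta>)"
        unfolding increments_def[of P] using E(2) by (intro sum_mono) (simp add: less_imp_le)
      moreover have "real (card D) * \<eta> \<le> \<epsilon> / 2"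
        using \<open>\<epsilon> > 0\<close> by (simp add: \<eta>_def field_simps)
      ultimately show ?thesis by (simp add: sum.distrib)
    qed
    with \<delta>(1) show "\<exists>\<delta>>0. \<forall>D. disjoint_ivls a b D \<and> increments (\<lambda>x. x) D < \<delta> \<longrightarrow> increments P D < \<epsilon>"
      by blast
  qed
qed

text \<open>The density is the Radon-Nikodym derivative of the Stieltjes measure of
  \<open>P\<close>. That measure is absolutely continuous because a Lebesgue null set is covered by
  nonoverlapping intervals of arbitrarily small total length, and the Stieltjes measure of these
  intervals is exactly the sum of increments controlled by \<open>ac\<close>.\<close>

lemma density_of_abs_cont_mono:
  fixes P :: "real \<Rightarrow> real"
  assumes "a \<le> b" and mono: "mono_on {a..b} P"
    and ac: "\<And>\<epsilon>. \<epsilon> > 0 \<Longrightarrow> \<exists>\<delta>>0. \<forall>D. disjoint_ivls a b D \<and> increments (\<lambda>x. x) D < \<delta> \<longrightarrow> increments P D < \<epsilon>"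
  obtains w where "integrable lborel w" "\<And>x. x \<in> {a..b} \<Longrightarrow> (LINT t:{a..x}|lborel. w t) = P x - P a"
proof -
  \<comment> \<open>Clamping the argument to \<open>[a, b]\<close> extends \<open>P\<close> to a
    monotone continuous function on the whole line, as the Stieltjes measure requires.\<close>
  define G where "G x = P (max a (min b x))" for x
  have G_eq: "G x = P x" if "x \<in> {a..b}" for x
    using that by (simp add: G_def)
  have G_mono: "G x \<le> G y" if "x \<le> y" for x y
    unfolding G_def using \<open>a \<le> b\<close> that by (intro mono_onD[OF mono]) auto
  have G_cont: "continuous_on UNIV G"
    unfolding continuous_on_iff
  proof (intro ballI allI impI)
    fix x \<epsilon> :: real assume "\<epsilon> > 0"
    then obtain \<delta> where "\<delta> > 0"
      and \<delta>: "\<forall>D. disjoint_ivls a b D \<and> increments (\<lambda>x. x) D < \<delta> \<longrightarrow> increments P D < \<epsilon>"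
      using ac by blast
    have *: "G q - G p < \<epsilon>" if "p \<le> q" "q - p < \<delta>" for p q
    proof (cases "max a (min b p) = max a (min b q)")
      case True
      with \<open>\<epsilon> > 0\<close> show ?thesis by (simp add: G_def)
    next
      case False
      let ?D = "{(max a (min b p), max a (min b q))}"
      have "disjoint_ivls a b ?D"
        using False that \<open>a \<le> b\<close> by (intro disjoint_ivlsI) auto
      moreover have "increments (\<lambda>x. x) ?D < \<delta>"
        using that \<open>\<delta> > 0\<close> by (auto simp: increments_def)
      ultimately have "increments P ?D < \<epsilon>" using \<delta> by blast
      then show ?thesis by (simp add: increments_def G_def)
    qed
    have "\<bar>G y - G x\<bar> < \<epsilon>" if "\<bar>y - x\<bar> < \<delta>" for y
    proof (cases "x \<le> y")
      case True
      then show ?thesis using *[of x y] G_mono[of x y] that by auto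
    next
      case False
      then show ?thesis using *[of y x] G_mono[of y x] that by auto
    qed
    then show "\<exists>d>0. \<forall>x'\<in>UNIV. dist x' x < d \<longrightarrow> dist (G x') (G x) < \<epsilon>"
      using \<open>\<delta> > 0\<close> by (auto simp: dist_real_def)
  qed
  define M where "M = interval_measure G"
  have sets_M [measurable_cong, simp]: "sets M = sets borel" by (simp add: M_def)
  have space_M [simp]: "space M = UNIV" by (simp add: M_def)
  have M_Icc: "emeasure M {p..q} = ennreal (G q - G p)" if "p \<le> q" for p q
    unfolding M_def using that G_mono G_cont by (rule emeasure_interval_measure_Icc)
  \<comment> \<open>Restriction to \<open>{a..b}\<close> leaves only null sets inside the interval
    to be considered, where \<open>ac\<close> is available.\<close>
  define N where "N = density M (indicator {a..b})"
  have N: "emeasure N A = emeasure M (A \<inter> {a..b})" if "A \<in> sets borel" for A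
  proof -
    have "(\<lambda>x. indicator {a..b} x * indicator A x :: ennreal) = indicator (A \<inter> {a..b})"
      by (auto simp: fun_eq_iff indicator_def)
    then show ?thesis
      unfolding N_def using that by (simp add: emeasure_density nn_integral_indicator)
  qed
  have "absolutely_continuous lborel N"
    unfolding absolutely_continuous_def
  proof
    fix A :: "real set" assume A: "A \<in> null_sets lborel"
    define S where "S = A \<inter> {a..b}"
    have [measurable]: "A \<in> sets borel" "S \<in> sets borel" using A by (auto simp: S_def null_sets_def)
    have "S \<in> null_sets lborel"
      using A by (auto simp: S_def intro: null_set_Int2)
    then have "negligible S"
      by (simp add: negligible_iff_null_sets null_sets_completionI)
    \<comment> \<open>The degenerate case \<open>a = b\<close> is separate because the covering
      intervals are guaranteed to have interior only when the open interval is nonempty. The summand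
      0 fits the form of \<open>ennreal_le_epsilon\<close>.\<close>
    have "emeasure M S \<le> 0 + ennreal \<epsilon>" if "\<epsilon> > 0" for \<epsilon>
    proof (cases "a = b")
      case True
      have "emeasure M S \<le> emeasure M {a..b}"
        by (rule emeasure_mono) (auto simp: S_def)
      then show ?thesis using True M_Icc[of b b] by simp
    next
      case False
      with \<open>a \<le> b\<close> have "a < b" by simp
      obtain \<delta> where "\<delta> > 0"
        and \<delta>: "\<forall>D. disjoint_ivls a b D \<and> increments (\<lambda>x. x) D < \<delta> \<longrightarrow> increments P D < \<epsilon>"
        using ac[OF \<open>\<epsilon> > 0\<close>] by blast
      have "S \<subseteq> cbox a b" "\<delta> / 2 > 0" using \<open>\<delta> > 0\<close> by (auto simp: S_def)
      from measurable_outer_intervals_bounded[OF negligible_imp_measurable[OF \<open>negligible S\<close>] this]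
      obtain \<D> where \<D>: "countable \<D>" "\<And>K. K \<in> \<D> \<Longrightarrow> K \<subseteq> cbox a b \<and> K \<noteq> {} \<and> (\<exists>c d. K = cbox c d)"
        "pairwise (\<lambda>A B. interior A \<inter> interior B = {}) \<D>"
        "\<And>K. \<lbrakk>K \<in> \<D>; box a b \<noteq> {}\<rbrakk> \<Longrightarrow> interior K \<noteq> {}"
        "S \<subseteq> \<Union>\<D>" "\<Union>\<D> \<in> lmeasurable" "measure lebesgue (\<Union>\<D>) \<le> measure lebesgue S + \<delta> / 2"
        by metis
      have D_len: "measure lebesgue (\<Union>\<D>) < \<delta>"
        using \<D>(7) negligible_imp_measure0[OF \<open>negligible S\<close>] \<open>\<delta> > 0\<close> by simp
      have K: "\<exists>c d. K = {c..d} \<and> a \<le> c \<and> c < d \<and> d \<le> b \<and> Inf K = c \<and> Sup K = d" if "K \<in> \<D>" for K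
      proof -
        obtain c d where cd: "K = {c..d}" using \<D>(2)[of K] \<open>K \<in> \<D>\<close> by auto
        have "box a b \<noteq> {}" using \<open>a < b\<close> by simp
        then have "interior K \<noteq> {}" using \<D>(4)[OF that] by simp
        then have "c < d" by (auto simp: cd)
        with cd \<D>(2)[OF that] show ?thesis by auto
      qed
      \<comment> \<open>\<open>ac\<close> concerns finite families, whereas the cover is countable;
        a bound for all finite subfamilies carries over to the union.\<close>
      have fin: "measure M (\<Union>K\<in>\<D>'. K) \<le> \<epsilon>" if "\<D>' \<subseteq> \<D>" "finite \<D>'" for \<D>'
      proof -
        define iv where "iv K = (Inf K, Sup K)" for K :: "real set"
        have inj: "inj_on iv \<D>'"
        proof (rule inj_onI)
          fix A B assume AB: "A \<in> \<D>'" "B \<in> \<D>'" "iv A = iv B"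
          obtain c d where "A = {c..d}" "Inf A = c" "Sup A = d"
            using K[of A] AB(1,2) \<open>\<D>' \<subseteq> \<D>\<close> by blast
          moreover obtain c' d' where "B = {c'..d'}" "Inf B = c'" "Sup B = d'"
            using K[of B] AB(1,2) \<open>\<D>' \<subseteq> \<D>\<close> by blast
          ultimately show "A = B" using AB(3) by (simp add: iv_def)
        qed
        have D: "disjoint_ivls a b (iv ` \<D>')"
        proof (rule disjoint_ivlsI)
          fix z assume "z \<in> iv ` \<D>'"
          then obtain A where "A \<in> \<D>" "z = iv A" using \<open>\<D>' \<subseteq> \<D>\<close> by blast
          then show "a \<le> fst z \<and> fst z < snd z \<and> snd z \<le> b"
            using K[of A] by (auto simp: iv_def)
        next
          fix z z' assume "z \<in> iv ` \<D>'" "z' \<in> iv ` \<D>'" "z \<noteq> z'"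
          then obtain A B where AB: "A \<in> \<D>" "B \<in> \<D>" "z = iv A" "z' = iv B" "A \<noteq> B"
            using \<open>\<D>' \<subseteq> \<D>\<close> by blast
          obtain c d where A: "A = {c..d}" "c < d" "Inf A = c" "Sup A = d"
            using K[OF AB(1)] by blast
          obtain c' d' where B: "B = {c'..d'}" "c' < d'" "Inf B = c'" "Sup B = d'"
            using K[OF AB(2)] by blast
          have "interior A \<inter> interior B = {}" using \<D>(3) AB by (auto simp: pairwise_def)
          then have disj: "{c<..<d} \<inter> {c'<..<d'} = {}" by (simp add: A(1) B(1))
          have "d \<le> c' \<or> d' \<le> c"
          proof (rule ccontr)
            assume "\<not> ?thesis"
            then have "max c c' < min d d'" using A(2) B(2) by auto
            then obtain t where "max c c' < t" "t < min d d'"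
              using dense by blast
            then have "t \<in> {c<..<d} \<inter> {c'<..<d'}" by simp
            with disj show False by blast
          qed
          then show "snd z \<le> fst z' \<or> snd z' \<le> fst z"
            by (simp add: AB(3,4) iv_def A(3,4) B(3,4))
        qed (use that in simp)
        have "increments (\<lambda>x. x) (iv ` \<D>') \<le> measure lebesgue (\<Union>\<D>)"
        proof (rule disjoint_ivls_length_le_measure[OF D \<D>(6)])
          fix z assume "z \<in> iv ` \<D>'"
          then obtain A where A: "A \<in> \<D>" "z = iv A" using \<open>\<D>' \<subseteq> \<D>\<close> by blast
          then obtain c d where "A = {c..d}" "Inf A = c" "Sup A = d" using K by blast
          then have "{fst z<..<snd z} \<subseteq> A" by (auto simp: A(2) iv_def)
          with A(1) show "{fst z<..<snd z} \<subseteq> \<Union>\<D>" by blast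
        qed
        then have "increments P (iv ` \<D>') < \<epsilon>"
          using \<delta> D D_len by simp
        moreover have "increments P (iv ` \<D>') = (\<Sum>K\<in>\<D>'. measure M K)"
          unfolding increments_def sum.reindex[OF inj]
        proof (rule sum.cong)
          fix A assume "A \<in> \<D>'"
          then have "A \<in> \<D>" using that by blast
          then obtain c d where A: "A = {c..d}" "a \<le> c" "c < d" "d \<le> b" "Inf A = c" "Sup A = d"
            using K by blast
          have "emeasure M A = ennreal (P d - P c)"
            using M_Icc[of c d] A(2-4) by (simp add: G_eq A(1))
          moreover have "P d - P c \<ge> 0"
            using mono_onD[OF mono, of c d] A(2-4) by simp
          ultimately show "((\<lambda>z. P (snd z) - P (fst z)) \<circ> iv) A = measure M A"
            by (simp add: measure_def iv_def A(5,6))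
        qed simp
        moreover have "measure M (\<Union>K\<in>\<D>'. K) \<le> (\<Sum>K\<in>\<D>'. measure M K)"
        proof (rule measure_UNION_le)
          fix A assume "A \<in> \<D>'"
          then obtain c d where "A = {c..d}" using K[of A] \<open>\<D>' \<subseteq> \<D>\<close> by blast
          then show "A \<in> sets M" by simp
        qed fact
        ultimately show ?thesis by simp
      qed
      have fm: "K \<in> fmeasurable M" if "K \<in> \<D>" for K
      proof -
        obtain c d where "K = {c..d}" "c < d" using K[of K] \<open>K \<in> \<D>\<close> by blast
        then show ?thesis using M_Icc[of c d] by (simp add: fmeasurable_def)
      qed
      have "(\<Union>K\<in>\<D>. K) \<in> fmeasurable M" "measure M (\<Union>K\<in>\<D>. K) \<le> \<epsilon>"
        using fmeasurable_UN_bound[OF \<D>(1) fm fin] measure_UN_bound[OF \<D>(1) fm fin] by auto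
      then have "emeasure M (\<Union>\<D>) \<le> ennreal \<epsilon>" "\<Union>\<D> \<in> sets M"
        by (auto simp: emeasure_eq_measure2 fmeasurableD ennreal_leI)
      then show ?thesis
        using emeasure_mono[OF \<D>(5), of M] by simp
    qed
    then have "emeasure M S = 0"
      using ennreal_le_epsilon[of 0 "emeasure M S"] by simp
    then show "A \<in> null_sets N"
      using N[of A] by (auto simp: null_sets_def S_def N_def)
  qed
  moreover have "sets N = sets lborel" by (simp add: N_def)
  ultimately obtain f where f [measurable]: "f \<in> borel_measurable lborel" and "density lborel f = N"
    using sigma_finite_measure.Radon_Nikodym[OF sigma_finite_lborel] by blast
  have f_int: "(\<integral>\<^sup>+t. f t * indicator {a..x} t \<partial>lborel) = ennreal (P x - P a)" if "x \<in> {a..b}" for x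
  proof -
    have "(\<integral>\<^sup>+t. f t * indicator {a..x} t \<partial>lborel) = emeasure N {a..x}"
      unfolding \<open>density lborel f = N\<close>[symmetric] by (subst emeasure_density) auto
    also have "\<dots> = emeasure M {a..x}"
      using that by (subst N) (auto intro!: arg_cong[of _ _ "emeasure M"])
    finally show ?thesis using that by (simp add: M_Icc G_eq)
  qed
  \<comment> \<open>The Radon-Nikodym density takes values in \<open>ennreal\<close>. Its integral
    over \<open>[a, b]\<close> is finite, so it is infinite at most on a null set and
    \<open>enn2real\<close> loses nothing under the integral.\<close>
  define h where "h t = f t * indicator {a..b} t" for t
  have [measurable]: "h \<in> borel_measurable lborel" unfolding h_def by measurable
  have "(\<integral>\<^sup>+t. h t \<partial>lborel) \<noteq> \<infinity>"
    unfolding h_def using f_int[of b] \<open>a \<le> b\<close> by simp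
  then have h_fin: "AE t in lborel. h t \<noteq> \<infinity>"
    by (intro nn_integral_PInf_AE) auto
  define w where "w t = enn2real (h t)" for t
  have [measurable]: "w \<in> borel_measurable lborel" unfolding w_def by measurable
  have w_eq: "(\<integral>\<^sup>+t. ennreal (indicator {a..x} t * w t) \<partial>lborel) = ennreal (P x - P a)" if "x \<in> {a..b}" for x
  proof -
    have "(\<integral>\<^sup>+t. ennreal (indicator {a..x} t * w t) \<partial>lborel) = (\<integral>\<^sup>+t. f t * indicator {a..x} t \<partial>lborel)"
      using h_fin that by (intro nn_integral_cong_AE)
        (auto elim!: eventually_mono simp: w_def h_def indicator_def ennreal_enn2real_if top.not_eq_extremum)
    with f_int[OF that] show ?thesis by simp
  qed
  show thesis
  proof (rule that)
    have "(\<integral>\<^sup>+t. ennreal (w t) \<partial>lborel) = (\<integral>\<^sup>+t. ennreal (indicator {a..b} t * w t) \<partial>lborel)"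
      by (intro nn_integral_cong) (auto simp: w_def h_def indicator_def)
    moreover have "w t \<ge> 0" for t by (simp add: w_def)
    ultimately show "integrable lborel w" using w_eq[of b] \<open>a \<le> b\<close>
      by (intro integrableI_nonneg) simp_all
    fix x assume x: "x \<in> {a..b}"
    have "P a \<le> P x" using mono_onD[OF mono, of a x] x by simp
    have "(LINT t:{a..x}|lborel. w t) = enn2real (\<integral>\<^sup>+t. ennreal (indicator {a..x} t * w t) \<partial>lborel)"
      unfolding set_lebesgue_integral_def
      by (subst integral_eq_nn_integral) (auto simp: w_def)
    also have "\<dots> = P x - P a" using \<open>P a \<le> P x\<close> by (simp add: w_eq[OF x])
    finally show "(LINT t:{a..x}|lborel. w t) = P x - P a" .
  qed
qed

text \<open>A single comparison principle for real and imaginary parts, conjugates, products, linear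
  combinations and cutoff functions. Taking the same function twice with \<open>B = 0\<close> gives
  comparison with one function.\<close>

lemma abs_cont_on_dominated:
  assumes f1: "abs_cont_on a b f1" and f2: "abs_cont_on a b f2"
    and le: "\<And>x y. x \<in> {a..b} \<Longrightarrow> y \<in> {a..b} \<Longrightarrow>
      cmod (g x - g y) \<le> A * cmod (f1 x - f1 y) + B * cmod (f2 x - f2 y)"
  shows "abs_cont_on a b g"
  unfolding abs_cont_on_def
proof (intro allI impI)
  fix \<epsilon> :: real assume "\<epsilon> > 0"
  \<comment> \<open>The \<open>+ 1\<close> makes \<open>C\<close> positive and turns the final
    estimate into a strict one.\<close>
  define C where "C = \<bar>A\<bar> + \<bar>B\<bar> + 1"
  have "C > 0" by (simp add: C_def)
  then have "\<epsilon> / C > 0" using \<open>\<epsilon> > 0\<close> by simp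
  obtain \<delta>1 where \<delta>1: "\<delta>1 > 0" "\<forall>D. D division_of \<Union>D \<and> \<Union>D \<subseteq> {a..b} \<and>
      (\<Sum>K\<in>D. Sup K - Inf K) < \<delta>1 \<longrightarrow> (\<Sum>K\<in>D. cmod (f1 (Sup K) - f1 (Inf K))) < \<epsilon> / C"
    using f1[unfolded abs_cont_on_def, THEN spec, THEN mp, OF \<open>\<epsilon> / C > 0\<close>] by - (elim exE conjE, rule that)
  obtain \<delta>2 where \<delta>2: "\<delta>2 > 0" "\<forall>D. D division_of \<Union>D \<and> \<Union>D \<subseteq> {a..b} \<and>
      (\<Sum>K\<in>D. Sup K - Inf K) < \<delta>2 \<longrightarrow> (\<Sum>K\<in>D. cmod (f2 (Sup K) - f2 (Inf K))) < \<epsilon> / C"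
    using f2[unfolded abs_cont_on_def, THEN spec, THEN mp, OF \<open>\<epsilon> / C > 0\<close>] by - (elim exE conjE, rule that)
  show "\<exists>\<delta>>0. \<forall>D. D division_of \<Union>D \<and> \<Union>D \<subseteq> {a..b} \<and>
      (\<Sum>K\<in>D. Sup K - Inf K) < \<delta> \<longrightarrow> (\<Sum>K\<in>D. cmod (g (Sup K) - g (Inf K))) < \<epsilon>"
  proof (intro exI[of _ "min \<delta>1 \<delta>2"] conjI allI impI)
    fix D assume D: "D division_of \<Union>D \<and> \<Union>D \<subseteq> {a..b} \<and> (\<Sum>K\<in>D. Sup K - Inf K) < min \<delta>1 \<delta>2"
    define S1 where "S1 = (\<Sum>K\<in>D. cmod (f1 (Sup K) - f1 (Inf K)))"
    define S2 where "S2 = (\<Sum>K\<in>D. cmod (f2 (Sup K) - f2 (Inf K)))"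
    have S: "S1 < \<epsilon> / C" "S2 < \<epsilon> / C" "S1 \<ge> 0" "S2 \<ge> 0"
      using D \<delta>1(2) \<delta>2(2) by (auto simp: S1_def S2_def sum_nonneg)
    have "(\<Sum>K\<in>D. cmod (g (Sup K) - g (Inf K))) \<le>
        (\<Sum>K\<in>D. A * cmod (f1 (Sup K) - f1 (Inf K)) + B * cmod (f2 (Sup K) - f2 (Inf K)))"
    proof (rule sum_mono)
      fix K assume K: "K \<in> D"
      obtain p q where pq: "K = {p..q}" using division_ofD(4)[of D "\<Union>D" K] D K by auto
      have "K \<noteq> {}" "K \<subseteq> {a..b}" using division_ofD(3)[of D "\<Union>D" K] D K by auto
      then have "Sup K \<in> {a..b}" "Inf K \<in> {a..b}" by (auto simp: pq)
      then show "cmod (g (Sup K) - g (Inf K)) \<le>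
          A * cmod (f1 (Sup K) - f1 (Inf K)) + B * cmod (f2 (Sup K) - f2 (Inf K))"
        by (rule le)
    qed
    also have "\<dots> = A * S1 + B * S2" by (simp add: S1_def S2_def sum.distrib sum_distrib_left)
    also have "\<dots> \<le> \<bar>A\<bar> * (\<epsilon> / C) + \<bar>B\<bar> * (\<epsilon> / C)"
      using S by (intro add_mono mult_mono) auto
    also have "\<dots> < \<epsilon>"
    proof -
      have "(\<bar>A\<bar> + \<bar>B\<bar>) * \<epsilon> < C * \<epsilon>" using \<open>\<epsilon> > 0\<close> by (intro mult_strict_right_mono) (auto simp: C_def)
      then show ?thesis using \<open>C > 0\<close> by (simp add: field_simps)
    qed
    finally show "(\<Sum>K\<in>D. cmod (g (Sup K) - g (Inf K))) < \<epsilon>" .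
  qed (use \<delta>1(1) \<delta>2(1) in simp)
qed

lemma abs_cont_on_Re:
  assumes f: "abs_cont_on a b f"
  shows "abs_cont_on a b (\<lambda>x. complex_of_real (Re (f x)))"
  by (rule abs_cont_on_dominated[OF f f, of _ 1 0])
     (use abs_Re_le_cmod[of "f _ - f _"] in \<open>simp flip: of_real_diff\<close>)

lemma abs_cont_on_Im:
  assumes f: "abs_cont_on a b f"
  shows "abs_cont_on a b (\<lambda>x. complex_of_real (Im (f x)))"
  by (rule abs_cont_on_dominated[OF f f, of _ 1 0])
     (use abs_Im_le_cmod[of "f _ - f _"] in \<open>simp flip: of_real_diff\<close>)

text \<open>By writing \<open>u = P - (P - u)\<close>, the claim reduces to two monotone functions.
  The second inherits the epsilon-delta property as a difference, with \<epsilon>/2 for each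
  term.\<close>

lemma abs_cont_real_density:
  assumes u: "abs_cont_on a b (\<lambda>x. complex_of_real (u x))" and "a \<le> b"
  obtains w where "integrable lborel w" "\<And>x. x \<in> {a..b} \<Longrightarrow> (LINT t:{a..x}|lborel. w t) = u x - u a"
proof -
  obtain P where P: "mono_on {a..b} P" "mono_on {a..b} (\<lambda>x. P x - u x)"
    and acP: "\<And>\<epsilon>. \<epsilon> > 0 \<Longrightarrow> \<exists>\<delta>>0. \<forall>D. disjoint_ivls a b D \<and> increments (\<lambda>x. x) D < \<delta> \<longrightarrow> increments P D < \<epsilon>"
    using abs_cont_positive_variation[OF assms] by blast
  have acN: "\<exists>\<delta>>0. \<forall>D. disjoint_ivls a b D \<and> increments (\<lambda>x. x) D < \<delta> \<longrightarrow> increments (\<lambda>x. P x - u x) D < \<epsilon>"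
    if "\<epsilon> > 0" for \<epsilon> :: real
  proof -
    have "\<epsilon> / 2 > 0" using that by simp
    from acP[OF this] obtain \<delta>1 where \<delta>1: "\<delta>1 > 0"
      "\<forall>D. disjoint_ivls a b D \<and> increments (\<lambda>x. x) D < \<delta>1 \<longrightarrow> increments P D < \<epsilon> / 2" by blast
    from abs_cont_increments_small[OF u \<open>\<epsilon> / 2 > 0\<close>] obtain \<delta>2 where \<delta>2: "\<delta>2 > 0"
      "\<And>D. disjoint_ivls a b D \<Longrightarrow> increments (\<lambda>x. x) D < \<delta>2 \<Longrightarrow> \<bar>increments u D\<bar> < \<epsilon> / 2" by blast
    have "increments (\<lambda>x. P x - u x) D < \<epsilon>" if "disjoint_ivls a b D" "increments (\<lambda>x. x) D < min \<delta>1 \<delta>2" for D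
    proof -
      have "increments (\<lambda>x. P x - u x) D = increments P D - increments u D"
        by (simp add: increments_def sum_subtractf)
      moreover have "increments P D < \<epsilon> / 2" "\<bar>increments u D\<bar> < \<epsilon> / 2"
        using \<delta>1(2) \<delta>2(2) that by auto
      ultimately show ?thesis by linarith
    qed
    then show ?thesis using \<delta>1(1) \<delta>2(1) by (intro exI[of _ "min \<delta>1 \<delta>2"]) auto
  qed
  obtain w1 where w1: "integrable lborel w1" "\<And>x. x \<in> {a..b} \<Longrightarrow> (LINT t:{a..x}|lborel. w1 t) = P x - P a"
    using density_of_abs_cont_mono[OF \<open>a \<le> b\<close> P(1) acP] by blast
  obtain w2 where w2: "integrable lborel w2"
      "\<And>x. x \<in> {a..b} \<Longrightarrow> (LINT t:{a..x}|lborel. w2 t) = (P x - u x) - (P a - u a)"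
    using density_of_abs_cont_mono[OF \<open>a \<le> b\<close> P(2) acN] by blast
  show thesis
  proof (rule that)
    show "integrable lborel (\<lambda>t. w1 t - w2 t)" using w1(1) w2(1) by simp
    fix x assume x: "x \<in> {a..b}"
    have "set_integrable lborel {a..x} w1" "set_integrable lborel {a..x} w2"
      unfolding set_integrable_def using w1(1) w2(1) by (intro integrable_mult_indicator; simp)+
    then show "(LINT t:{a..x}|lborel. w1 t - w2 t) = u x - u a"
      by (simp add: w1(2)[OF x] w2(2)[OF x])
  qed
qed

lemma abs_cont_density:
  assumes f: "abs_cont_on a b f" and "a \<le> b"
  obtains w where "integrable lborel w" "\<And>x. x \<in> {a..b} \<Longrightarrow> f x = f a + (LINT t:{a..x}|lborel. w t)"
proof -
  obtain w1 where w1: "integrable lborel w1"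
      "\<And>x. x \<in> {a..b} \<Longrightarrow> (LINT t:{a..x}|lborel. w1 t) = Re (f x) - Re (f a)"
    using abs_cont_real_density[OF abs_cont_on_Re[OF f] \<open>a \<le> b\<close>] by blast
  obtain w2 where w2: "integrable lborel w2"
      "\<And>x. x \<in> {a..b} \<Longrightarrow> (LINT t:{a..x}|lborel. w2 t) = Im (f x) - Im (f a)"
    using abs_cont_real_density[OF abs_cont_on_Im[OF f] \<open>a \<le> b\<close>] by blast
  show thesis
  proof (rule that)
    show int: "integrable lborel (\<lambda>t. Complex (w1 t) (w2 t))"
      using w1(1) w2(1) by (simp add: complex_eq_cancel_iff2 Complex_eq)
    fix x assume x: "x \<in> {a..b}"
    have int': "integrable lborel (\<lambda>t. indicator {a..x} t *\<^sub>R Complex (w1 t) (w2 t))"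
      using int by (intro integrable_mult_indicator) auto
    have "Re (LINT t:{a..x}|lborel. Complex (w1 t) (w2 t)) = (LINT t:{a..x}|lborel. w1 t)"
      "Im (LINT t:{a..x}|lborel. Complex (w1 t) (w2 t)) = (LINT t:{a..x}|lborel. w2 t)"
      unfolding set_lebesgue_integral_def using int'
      by (simp_all flip: integral_Re integral_Im)
    then show "f x = f a + (LINT t:{a..x}|lborel. Complex (w1 t) (w2 t))"
      by (simp add: complex_eq_iff w1(2)[OF x] w2(2)[OF x])
  qed
qed

section \<open>The fundamental theorem of calculus for absolutely continuous functions\<close>

text \<open>Completeness of Lebesgue measure. It is the source of measurability for
  \<open>D1 f\<close>, which is known only up to a null set.\<close>

lemma borel_measurable_cong_AE_lebesgue_on:
  fixes f g :: "real \<Rightarrow> 'a::euclidean_space"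
  assumes S: "S \<in> sets lebesgue" and f: "f \<in> borel_measurable (lebesgue_on S)"
    and eq: "AE x in lebesgue_on S. f x = g x"
  shows "g \<in> borel_measurable (lebesgue_on S)"
proof -
  let ?f = "\<lambda>x. if x \<in> S then f x else 0" and ?g = "\<lambda>x. if x \<in> S then g x else 0"
  have f': "?f \<in> borel_measurable lebesgue"
    using f S by (rule borel_measurable_if_I)
  have eq': "AE x in lebesgue. ?f x = ?g x"
    using eq S by (simp add: AE_restrict_space_iff)
  have "?g \<in> borel_measurable lebesgue"
  proof (rule measurableI)
    fix A :: "'a set" assume A: "A \<in> sets borel"
    show "?g -` A \<inter> space lebesgue \<in> sets lebesgue"
    proof (rule completion.in_sets_AE)
      show "AE x in lebesgue. x \<in> ?f -` A \<inter> space lebesgue \<longleftrightarrow> x \<in> ?g -` A \<inter> space lebesgue"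
        using eq' by eventually_elim simp
    qed (use measurable_sets[OF f' A] in auto)
  qed auto
  then show ?thesis by (rule borel_measurable_if_D)
qed

lemma sq_int_cong_AE_lebesgue_on:
  fixes f g :: "real \<Rightarrow> complex"
  assumes S: "S \<in> sets lebesgue" and f: "f \<in> sq_int (lebesgue_on S)"
    and eq: "AE x in lebesgue_on S. f x = g x"
  shows "g \<in> sq_int (lebesgue_on S)"
proof -
  have [measurable]: "f \<in> borel_measurable (lebesgue_on S)" using f by (simp add: sq_int_def)
  have [measurable]: "g \<in> borel_measurable (lebesgue_on S)"
    by (rule borel_measurable_cong_AE_lebesgue_on[OF S _ eq]) simp
  have "integrable (lebesgue_on S) (\<lambda>x. (cmod (g x))\<^sup>2) \<longleftrightarrow> integrable (lebesgue_on S) (\<lambda>x. (cmod (f x))\<^sup>2)"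
    by (rule integrable_cong_AE) (use eq in \<open>auto elim!: eventually_mono\<close>)
  with f show ?thesis by (simp add: sq_int_def)
qed

lemma AE_has_vector_derivative_indefinite_integral:
  fixes w :: "real \<Rightarrow> complex"
  assumes w: "integrable (lebesgue_on {a..b}) w"
    and F: "\<And>x. x \<in> {a..b} \<Longrightarrow> F x = c + (LINT t|lebesgue_on {a..x}. w t)"
  shows "AE x in lebesgue_on {a..b}. (F has_vector_derivative w x) (at x)"
proof -
  define B where "B = {x \<in> {a<..<b}. \<not> ((\<lambda>t. integral {a..t} w) has_vector_derivative w x) (at x)}"
  have hk: "w integrable_on {a..b}" using w by (rule integrable_on_lebesgue_on) simp
  have F': "F x = c + integral {a..x} w" if "x \<in> {a..b}" for x
  proof -
    have "integrable (lebesgue_on {a..x}) w"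
      by (rule Equivalence_Lebesgue_Henstock_Integration.integrable_subinterval[OF w]) (use that in auto)
    then show ?thesis using F[OF that] by (simp add: lebesgue_integral_eq_integral)
  qed
  \<comment> \<open>The endpoints are discarded too: \<open>F\<close> is prescribed only on
    \<open>[a, b]\<close>, so a two-sided derivative cannot be expected there.\<close>
  have "negligible (B \<union> {a, b})"
    using negligible_not_has_vector_derivative_indefinite_integral[OF hk] by (simp add: B_def)
  then have "AE x in lebesgue. x \<notin> B \<union> {a, b}"
    unfolding negligible_iff_null_sets by (rule AE_not_in)
  then have "AE x in lebesgue. x \<in> {a..b} \<longrightarrow> (F has_vector_derivative w x) (at x)"
  proof eventually_elim
    case (elim x)
    show ?case
    proof
      assume "x \<in> {a..b}"
      with elim have x: "x \<in> {a<..<b}" "((\<lambda>t. integral {a..t} w) has_vector_derivative w x) (at x)"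
        by (auto simp: B_def)
      have "((\<lambda>t. c + integral {a..t} w) has_vector_derivative w x) (at x)"
        using has_vector_derivative_add[OF has_vector_derivative_const x(2)] by simp
      then show "(F has_vector_derivative w x) (at x)"
        by (rule has_vector_derivative_transform_within_open[of _ _ _ "{a<..<b}"])
           (use x(1) F' in auto)
    qed
  qed
  then show ?thesis by (simp add: AE_restrict_space_iff)
qed

text \<open>A Borel version of the derivative is recorded besides \<open>D1 f\<close>, because the
  Fubini argument in \<open>integral_mult_indefinite_integral\<close> takes place on a product with
  \<open>lborel\<close>, where measurability with respect to the completion would not be
  enough.\<close>

lemma abs_cont_on_borel_derivative:
  assumes f: "abs_cont_on a b f" and "a \<le> b"
  obtains w where "integrable lborel w"
    "AE x in lebesgue_on {a..b}. (f has_vector_derivative w x) (at x)"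
    "\<And>x. x \<in> {a..b} \<Longrightarrow> f x = f a + (LINT t:{a..x}|lborel. w t)"
proof -
  obtain w where w: "integrable lborel w" "\<And>x. x \<in> {a..b} \<Longrightarrow> f x = f a + (LINT t:{a..x}|lborel. w t)"
    using abs_cont_density[OF assms] by blast
  have [measurable]: "w \<in> borel_measurable lborel" using w(1) by auto
  have "integrable lebesgue w" using w(1) by (simp add: integrable_completion)
  from integrable_mult_indicator[OF _ this, of "{a..b}"]
  have int: "integrable (lebesgue_on {a..b}) w" by (simp add: integrable_restrict_space)
  have FTC: "f x = f a + (LINT t|lebesgue_on {a..x}. w t)" if "x \<in> {a..b}" for x
    using w(2)[OF that]
    by (simp add: integral_restrict_space set_lebesgue_integral_def integral_completion)
  show thesis
    by (rule that[OF w(1) AE_has_vector_derivative_indefinite_integral[OF int FTC] w(2)])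
qed

lemma abs_cont_on_AE_density:
  assumes f: "abs_cont_on a b f" and "a \<le> b"
  shows "integrable (lebesgue_on {a..b}) (D1 f)"
    and "AE x in lebesgue_on {a..b}. (f has_vector_derivative D1 f x) (at x)"
    and "\<And>x. x \<in> {a..b} \<Longrightarrow> f x = f a + (LINT t|lebesgue_on {a..x}. D1 f t)"
proof -
  obtain w where w: "integrable lborel w"
      "AE x in lebesgue_on {a..b}. (f has_vector_derivative w x) (at x)"
      "\<And>x. x \<in> {a..b} \<Longrightarrow> f x = f a + (LINT t:{a..x}|lborel. w t)"
    using abs_cont_on_borel_derivative[OF assms] by blast
  have [measurable]: "w \<in> borel_measurable lborel" using w(1) by auto
  have wl: "integrable lebesgue w" using w(1) by (simp add: integrable_completion)
  have w_on: "integrable (lebesgue_on S) w" if "S \<in> sets lebesgue" for S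
    using that integrable_mult_indicator[OF that wl] by (simp add: integrable_restrict_space)
  have eq: "AE x in lebesgue_on {a..b}. w x = D1 f x"
    using w(2) by eventually_elim (simp add: vector_derivative_at)
  show "AE x in lebesgue_on {a..b}. (f has_vector_derivative D1 f x) (at x)"
    using w(2) eq by eventually_elim simp
  have meas: "D1 f \<in> borel_measurable (lebesgue_on {a..b})"
    using w_on[of "{a..b}"] by (intro borel_measurable_cong_AE_lebesgue_on[OF _ _ eq]) auto
  show "integrable (lebesgue_on {a..b}) (D1 f)"
    using integrable_cong_AE_imp[OF w_on[of "{a..b}"] meas] eq by (simp add: eq_commute)
  fix x assume x: "x \<in> {a..b}"
  have eq': "AE t in lebesgue_on {a..x}. w t = D1 f t"
    using eq x by (auto simp: AE_restrict_space_iff elim!: eventually_mono)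
  have "(LINT t|lebesgue_on {a..x}. w t) = (LINT t|lebesgue_on {a..x}. D1 f t)"
    using w_on[of "{a..x}"] eq'
    by (intro integral_cong_AE borel_measurable_cong_AE_lebesgue_on[OF _ _ eq']) auto
  with w(3)[OF x] show "f x = f a + (LINT t|lebesgue_on {a..x}. D1 f t)"
    by (simp add: integral_restrict_space set_lebesgue_integral_def integral_completion)
qed

text \<open>For an integrand in \<open>L\<^sup>2\<close>, the bound \<open>2 \<bar>w\<bar> \<le> t \<bar>w\<bar>\<^sup>2 + 1/t\<close> with small \<open>t\<close> replaces the absolute
  continuity of the integral.\<close>

lemma abs_cont_on_indefinite_integral:
  assumes w: "w \<in> sq_int (lebesgue_on {a..b})" "integrable (lebesgue_on {a..b}) w"
    and F: "\<And>x. x \<in> {a..b} \<Longrightarrow> F x = c + (LINT t|lebesgue_on {a..x}. w t)"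
  shows "abs_cont_on a b F"
  unfolding abs_cont_on_def
proof (intro allI impI)
  fix \<epsilon> :: real assume "\<epsilon> > 0"
  have w2: "integrable (lebesgue_on {a..b}) (\<lambda>x. (cmod (w x))\<^sup>2)" using w by (simp add: sq_int_def)
  have hk: "w integrable_on {a..b}" "(\<lambda>x. (cmod (w x))\<^sup>2) integrable_on {a..b}"
    using w(2) w2 by (auto intro: integrable_on_lebesgue_on)
  have w2': "(\<lambda>x. (cmod (w x))\<^sup>2) absolutely_integrable_on {a..b}"
    using hk(2) by (intro nonnegative_absolutely_integrable_1) auto
  define N where "N = integral {a..b} (\<lambda>x. (cmod (w x))\<^sup>2)"
  have "N \<ge> 0" unfolding N_def by (rule integral_nonneg[OF hk(2)]) simp
  \<comment> \<open>This value gives \<open>t * N < \<epsilon>\<close> for the quadratic term, and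
    families of total length below \<open>\<epsilon> * t\<close> make the term with
    \<open>1 / (2 * t)\<close> at most \<epsilon>/2. The \<open>+ 1\<close> excludes division by
    zero.\<close>
  define t where "t = \<epsilon> / (N + 1)"
  have "t > 0" using \<open>\<epsilon> > 0\<close> \<open>N \<ge> 0\<close> by (simp add: t_def)
  have tN: "t * N < \<epsilon>" using \<open>\<epsilon> > 0\<close> \<open>N \<ge> 0\<close> by (simp add: t_def field_simps)
  have F_diff: "F q - F p = integral {p..q} w" if "a \<le> p" "p \<le> q" "q \<le> b" for p q
  proof -
    have "F x = c + integral {a..x} w" if "x \<in> {a..b}" for x
    proof -
      have "integrable (lebesgue_on {a..x}) w"
        by (rule Equivalence_Lebesgue_Henstock_Integration.integrable_subinterval[OF w(2)]) (use that in auto)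
      then show ?thesis using F[OF that] by (simp add: lebesgue_integral_eq_integral)
    qed
    moreover have "integral {a..p} w + integral {p..q} w = integral {a..q} w"
      using that integrable_subinterval_real[OF hk(1)]
      by (intro Henstock_Kurzweil_Integration.integral_combine) auto
    ultimately show ?thesis using that by (simp add: algebra_simps)
  qed
  show "\<exists>\<delta>>0. \<forall>D. D division_of \<Union>D \<and> \<Union>D \<subseteq> {a..b} \<and> (\<Sum>K\<in>D. Sup K - Inf K) < \<delta> \<longrightarrow>
      (\<Sum>K\<in>D. cmod (F (Sup K) - F (Inf K))) < \<epsilon>"
  proof (intro exI[of _ "\<epsilon> * t"] conjI allI impI)
    show "0 < \<epsilon> * t" using \<open>\<epsilon> > 0\<close> \<open>t > 0\<close> by simp
    fix D assume D: "D division_of \<Union>D \<and> \<Union>D \<subseteq> {a..b} \<and> (\<Sum>K\<in>D. Sup K - Inf K) < \<epsilon> * t"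
    have summand: "cmod (F (Sup K) - F (Inf K)) \<le>
        t / 2 * integral K (\<lambda>x. (cmod (w x))\<^sup>2) + (Sup K - Inf K) / (2 * t)" if "K \<in> D" for K
    proof -
      obtain p q where K: "K = {p..q}" using division_ofD(4)[of D "\<Union>D" K] D \<open>K \<in> D\<close> by auto
      have "K \<noteq> {}" "K \<subseteq> {a..b}" using division_ofD(3)[of D "\<Union>D" K] D that by auto
      then have pq: "a \<le> p" "p \<le> q" "q \<le> b" by (auto simp: K)
      have hkK: "w integrable_on {p..q}" "(\<lambda>x. (cmod (w x))\<^sup>2) integrable_on {p..q}"
        using hk pq by (auto intro: integrable_subinterval_real)
      have ptw: "cmod (w x) \<le> t / 2 * (cmod (w x))\<^sup>2 + 1 / (2 * t)" for x
      proof -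
        have "0 \<le> (t * cmod (w x) - 1)\<^sup>2" by simp
        then have "2 * (t * cmod (w x)) \<le> t\<^sup>2 * (cmod (w x))\<^sup>2 + 1"
          by (simp add: power2_diff power_mult_distrib)
        then have "2 * (t * cmod (w x)) / (2 * t) \<le> (t\<^sup>2 * (cmod (w x))\<^sup>2 + 1) / (2 * t)"
          using \<open>t > 0\<close> by (intro divide_right_mono) auto
        then show ?thesis using \<open>t > 0\<close> by (simp add: add_divide_distrib power2_eq_square)
      qed
      have "norm (integral {p..q} w) \<le> integral {p..q} (\<lambda>x. t / 2 * (cmod (w x))\<^sup>2 + 1 / (2 * t))"
        using hkK ptw
        by (intro integral_norm_bound_integral integrable_add integrable_on_mult_right integrable_const_ivl) auto
      also have "\<dots> = t / 2 * integral {p..q} (\<lambda>x. (cmod (w x))\<^sup>2) + (q - p) * (1 / (2 * t))"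
        using hkK pq
        by (subst Henstock_Kurzweil_Integration.integral_add)
           (auto intro!: integrable_on_mult_right integrable_const_ivl)
      finally show ?thesis using F_diff[OF pq] pq by (simp add: K)
    qed
    have "\<Union>D \<in> sets lebesgue"
    proof (rule sets.finite_Union)
      show "finite D" using D division_of_finite by blast
      show "D \<subseteq> sets lebesgue"
      proof
        fix K assume "K \<in> D"
        then obtain p q where "K = cbox p q" using D division_ofD(4)[of D "\<Union>D" K] by blast
        then show "K \<in> sets lebesgue" by simp
      qed
    qed
    then have "(\<lambda>x. (cmod (w x))\<^sup>2) absolutely_integrable_on \<Union>D"
      using set_integrable_subset[OF w2'] D by blast
    then have sub: "(\<lambda>x. (cmod (w x))\<^sup>2) integrable_on \<Union>D"
      by (rule set_lebesgue_integral_eq_integral(1))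
    have "(\<Sum>K\<in>D. integral K (\<lambda>x. (cmod (w x))\<^sup>2)) = integral (\<Union>D) (\<lambda>x. (cmod (w x))\<^sup>2)"
      using D by (intro integral_combine_division_topdown[OF sub, symmetric]) blast
    also have "\<dots> \<le> N"
      unfolding N_def using D by (intro integral_subset_le sub hk(2)) auto
    finally have sumN: "(\<Sum>K\<in>D. integral K (\<lambda>x. (cmod (w x))\<^sup>2)) \<le> N" .
    have "(\<Sum>K\<in>D. cmod (F (Sup K) - F (Inf K))) \<le>
        (\<Sum>K\<in>D. t / 2 * integral K (\<lambda>x. (cmod (w x))\<^sup>2) + (Sup K - Inf K) / (2 * t))"
      by (intro sum_mono summand)
    also have "\<dots> = t / 2 * (\<Sum>K\<in>D. integral K (\<lambda>x. (cmod (w x))\<^sup>2)) + (\<Sum>K\<in>D. Sup K - Inf K) / (2 * t)"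
      by (simp add: sum.distrib sum_distrib_left sum_divide_distrib)
    also have "\<dots> \<le> t / 2 * N + (\<Sum>K\<in>D. Sup K - Inf K) / (2 * t)"
      using sumN \<open>t > 0\<close> by (intro add_right_mono mult_left_mono) auto
    also have "\<dots> < \<epsilon> / 2 + \<epsilon> / 2"
    proof (rule add_less_le_mono)
      show "t / 2 * N < \<epsilon> / 2" using tN by simp
      show "(\<Sum>K\<in>D. Sup K - Inf K) / (2 * t) \<le> \<epsilon> / 2"
        using D \<open>t > 0\<close> by (simp add: field_simps)
    qed
    finally show "(\<Sum>K\<in>D. cmod (F (Sup K) - F (Inf K))) < \<epsilon>" by simp
  qed
qed

section \<open>Square integrable functions\<close>

lemma sq_intD: "f \<in> sq_int M \<Longrightarrow> f \<in> borel_measurable M"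
  "f \<in> sq_int M \<Longrightarrow> integrable M (\<lambda>x. (cmod (f x))\<^sup>2)"
  by (auto simp: sq_int_def)

lemma borel_measurable_cnj [measurable]:
  "f \<in> borel_measurable M \<Longrightarrow> (\<lambda>x. cnj (f x)) \<in> borel_measurable M"
  by (rule measurable_compose[where N = borel and g = cnj])
     (auto intro!: borel_measurable_continuous_onI continuous_intros)

lemma sq_int_cnj: "f \<in> sq_int M \<Longrightarrow> (\<lambda>x. cnj (f x)) \<in> sq_int M"
  by (auto simp: sq_int_def intro: borel_measurable_cnj)

lemma sq_int_bounded_mult:
  assumes f: "f \<in> sq_int M" and g: "g \<in> borel_measurable M" "\<And>x. x \<in> space M \<Longrightarrow> cmod (g x) \<le> B"
  shows "(\<lambda>x. g x * f x) \<in> sq_int M"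
proof -
  note [measurable] = g(1) sq_intD(1)[OF f]
  have "integrable M (\<lambda>x. (cmod (g x * f x))\<^sup>2)"
  proof (rule Bochner_Integration.integrable_bound)
    show "integrable M (\<lambda>x. B\<^sup>2 * (cmod (f x))\<^sup>2)" using sq_intD(2)[OF f] by simp
    show "AE x in M. norm ((cmod (g x * f x))\<^sup>2) \<le> norm (B\<^sup>2 * (cmod (f x))\<^sup>2)"
      using g(2) by (intro AE_I2) (auto simp: norm_mult power_mult_distrib intro!: mult_right_mono power_mono)
  qed measurable
  then show ?thesis unfolding sq_int_def by simp
qed

lemma sq_int_cmult: "f \<in> sq_int M \<Longrightarrow> (\<lambda>x. c * f x) \<in> sq_int M"
  by (rule sq_int_bounded_mult[where B = "cmod c"]) auto

lemma sq_int_add: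
  assumes f: "f \<in> sq_int M" and g: "g \<in> sq_int M"
  shows "(\<lambda>x. f x + g x) \<in> sq_int M"
proof -
  note [measurable] = sq_intD(1)[OF f] sq_intD(1)[OF g]
  have "integrable M (\<lambda>x. (cmod (f x + g x))\<^sup>2)"
  proof (rule Bochner_Integration.integrable_bound)
    show "integrable M (\<lambda>x. 2 * (cmod (f x))\<^sup>2 + 2 * (cmod (g x))\<^sup>2)"
      using sq_intD(2)[OF f] sq_intD(2)[OF g] by simp
    have "(cmod (f x + g x))\<^sup>2 \<le> 2 * (cmod (f x))\<^sup>2 + 2 * (cmod (g x))\<^sup>2" for x
    proof -
      have "(cmod (f x + g x))\<^sup>2 \<le> (cmod (f x) + cmod (g x))\<^sup>2"
        by (intro power_mono norm_triangle_ineq) simp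
      also have "\<dots> \<le> 2 * (cmod (f x))\<^sup>2 + 2 * (cmod (g x))\<^sup>2"
        using zero_le_power2[of "cmod (f x) - cmod (g x)"] by (simp add: power2_sum power2_diff)
      finally show ?thesis .
    qed
    then show "AE x in M. norm ((cmod (f x + g x))\<^sup>2) \<le> norm (2 * (cmod (f x))\<^sup>2 + 2 * (cmod (g x))\<^sup>2)"
      by (intro AE_I2) auto
  qed measurable
  then show ?thesis unfolding sq_int_def by simp
qed

lemma integrable_mult_sq_int:
  assumes f: "f \<in> sq_int M" and g: "g \<in> sq_int M"
  shows "integrable M (\<lambda>x. f x * g x)"
proof (rule Bochner_Integration.integrable_bound)
  note [measurable] = sq_intD(1)[OF f] sq_intD(1)[OF g]
  show "(\<lambda>x. f x * g x) \<in> borel_measurable M" by measurable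
  show "integrable M (\<lambda>x. (cmod (f x))\<^sup>2 + (cmod (g x))\<^sup>2)"
    using sq_intD(2)[OF f] sq_intD(2)[OF g] by simp
  have "cmod (f x * g x) \<le> (cmod (f x))\<^sup>2 + (cmod (g x))\<^sup>2" for x
  proof -
    have "2 * (cmod (f x) * cmod (g x)) \<le> (cmod (f x))\<^sup>2 + (cmod (g x))\<^sup>2"
      using zero_le_power2[of "cmod (f x) - cmod (g x)"] by (simp add: power2_diff)
    moreover have "0 \<le> cmod (f x) * cmod (g x)" by simp
    ultimately show ?thesis unfolding norm_mult by linarith
  qed
  then show "AE x in M. norm (f x * g x) \<le> norm ((cmod (f x))\<^sup>2 + (cmod (g x))\<^sup>2)"
    by (intro AE_I2) auto
qed

lemma Cauchy_Schwarz_sq_int: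
  assumes f: "f \<in> sq_int M" and g: "g \<in> sq_int M"
  shows "(cmod (LINT x|M. f x * g x))\<^sup>2 \<le> (LINT x|M. (cmod (f x))\<^sup>2) * (LINT x|M. (cmod (g x))\<^sup>2)"
proof -
  note [measurable] = sq_intD(1)[OF f] sq_intD(1)[OF g]
  have int: "integrable M (\<lambda>x. cmod (f x) * cmod (g x))"
    using integrable_norm[OF integrable_mult_sq_int[OF f g]] by (simp add: norm_mult)
  define I where "I = (LINT x|M. cmod (f x) * cmod (g x))"
  have "I \<ge> 0" unfolding I_def by (rule integral_nonneg_AE) auto
  have "(\<integral>\<^sup>+x. ennreal (cmod (f x)) * ennreal (cmod (g x)) \<partial>M) = ennreal I"
    unfolding I_def by (subst nn_integral_eq_integral[OF int, symmetric]) (auto simp: ennreal_mult)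
  moreover have "(\<integral>\<^sup>+x. (ennreal (cmod (h x)))\<^sup>2 \<partial>M) = ennreal (LINT x|M. (cmod (h x))\<^sup>2)"
    if "h \<in> sq_int M" for h
    using nn_integral_eq_integral[OF sq_intD(2)[OF that]] by (simp add: ennreal_power)
  ultimately have "(ennreal I)\<^sup>2 \<le> ennreal (LINT x|M. (cmod (f x))\<^sup>2) * ennreal (LINT x|M. (cmod (g x))\<^sup>2)"
    using Cauchy_Schwarz_nn_integral[of "\<lambda>x. ennreal (cmod (f x))" M "\<lambda>x. ennreal (cmod (g x))"] f g by simp
  then have "I\<^sup>2 \<le> (LINT x|M. (cmod (f x))\<^sup>2) * (LINT x|M. (cmod (g x))\<^sup>2)"
    using \<open>I \<ge> 0\<close> by (simp add: ennreal_power ennreal_mult[symmetric])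
  moreover have "cmod (LINT x|M. f x * g x) \<le> I"
    unfolding I_def using integral_norm_bound[of M "\<lambda>x. f x * g x"] by (simp add: norm_mult)
  then have "(cmod (LINT x|M. f x * g x))\<^sup>2 \<le> I\<^sup>2" by (intro power_mono) auto
  ultimately show ?thesis by linarith
qed

lemma integrable_lebesgue_on_subset:
  fixes f :: "real \<Rightarrow> 'a::euclidean_space"
  assumes f: "integrable (lebesgue_on T) f" and "S \<subseteq> T" "S \<in> sets lebesgue" "T \<in> sets lebesgue"
  shows "integrable (lebesgue_on S) f"
proof -
  have "integrable lebesgue (\<lambda>x. indicator T x *\<^sub>R f x)"
    using assms by (simp add: integrable_restrict_space)
  from integrable_mult_indicator[OF \<open>S \<in> sets lebesgue\<close> this]
  have "integrable lebesgue (\<lambda>x. indicator S x *\<^sub>R (indicator T x *\<^sub>R f x))" .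
  moreover have "(\<lambda>x. indicator S x *\<^sub>R (indicator T x *\<^sub>R f x)) = (\<lambda>x. indicator S x *\<^sub>R f x)"
    using \<open>S \<subseteq> T\<close> by (auto simp: indicator_def fun_eq_iff)
  ultimately have "integrable lebesgue (\<lambda>x. indicator S x *\<^sub>R f x)" by metis
  with assms show ?thesis by (simp add: integrable_restrict_space)
qed

lemma sq_int_lebesgue_on_subset:
  assumes f: "f \<in> sq_int (lebesgue_on T)" and "S \<subseteq> T" "S \<in> sets lebesgue" "T \<in> sets lebesgue"
  shows "f \<in> sq_int (lebesgue_on (S :: real set))"
  using assms integrable_lebesgue_on_subset[OF sq_intD(2)[OF f]]
  by (auto simp: sq_int_def intro: measurable_restrict_mono)

lemma sq_int_lebesgue_on_extend:
  assumes f: "f \<in> sq_int (lebesgue_on S)" and "S \<subseteq> T" "S \<in> sets lebesgue" "T \<in> sets lebesgue"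
    and zero: "AE x in lebesgue_on T. x \<notin> S \<longrightarrow> f x = 0"
  shows "f \<in> sq_int (lebesgue_on (T :: real set))"
proof (rule sq_int_cong_AE_lebesgue_on)
  let ?f = "\<lambda>x. if x \<in> S then f x else 0"
  have "?f \<in> borel_measurable (lebesgue_on T)"
    using sq_intD(1)[OF f] assms(2-4) by (simp add: borel_measurable_if_lebesgue_on)
  moreover have "integrable (lebesgue_on T) (\<lambda>x. (cmod (?f x))\<^sup>2)"
  proof -
    have "integrable lebesgue (\<lambda>x. indicator S x *\<^sub>R (cmod (f x))\<^sup>2)"
      using sq_intD(2)[OF f] assms(3) by (simp add: integrable_restrict_space)
    moreover have "(\<lambda>x. indicator T x *\<^sub>R (cmod (?f x))\<^sup>2) = (\<lambda>x. indicator S x *\<^sub>R (cmod (f x))\<^sup>2)"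
      using \<open>S \<subseteq> T\<close> by (auto simp: indicator_def fun_eq_iff)
    ultimately have "integrable lebesgue (\<lambda>x. indicator T x *\<^sub>R (cmod (?f x))\<^sup>2)" by metis
    with assms(4) show ?thesis using integrable_restrict_space[of T lebesgue "\<lambda>x. (cmod (?f x))\<^sup>2"] by simp
  qed
  ultimately show "?f \<in> sq_int (lebesgue_on T)" by (simp add: sq_int_def)
  show "AE x in lebesgue_on T. ?f x = f x"
    using zero by eventually_elim auto
qed (use assms in auto)

lemma integral_lebesgue_on_shrink:
  fixes f :: "real \<Rightarrow> 'a::euclidean_space"
  assumes "S \<subseteq> T" "S \<in> sets lebesgue" "T \<in> sets lebesgue" "\<And>x. x \<in> T \<Longrightarrow> x \<notin> S \<Longrightarrow> f x = 0"
  shows "(LINT x|lebesgue_on T. f x) = (LINT x|lebesgue_on S. f x)"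
proof -
  have "(\<lambda>x. indicator T x *\<^sub>R f x) = (\<lambda>x. indicator S x *\<^sub>R f x)"
    using assms by (auto simp: indicator_def fun_eq_iff)
  then show ?thesis using assms by (simp add: integral_restrict_space)
qed

lemma integrable_sq_int_Icc:
  assumes "w \<in> sq_int (lebesgue_on {a..b::real})"
  shows "integrable (lebesgue_on {a..b}) w"
proof -
  have "(\<lambda>x. 1) \<in> sq_int (lebesgue_on {a..b})"
    by (simp add: sq_int_def finite_measure.integrable_const finite_measure_lebesgue_on)
  from integrable_mult_sq_int[OF this assms] show ?thesis by simp
qed

lemma abs_cont_on_of_real: "abs_cont_on a b complex_of_real"
  unfolding abs_cont_on_def
proof (intro allI impI exI conjI)
  fix \<epsilon> :: real and D assume "\<epsilon> > 0" and D: "D division_of \<Union>D \<and> \<Union>D \<subseteq> {a..b} \<and> (\<Sum>K\<in>D. Sup K - Inf K) < \<epsilon>"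
  have "cmod (complex_of_real (Sup K) - complex_of_real (Inf K)) = Sup K - Inf K" if K: "K \<in> D" for K
  proof -
    obtain p q where "K = {p..q}" using division_ofD(4)[of D "\<Union>D" K] D K by auto
    moreover have "K \<noteq> {}" using division_ofD(3)[of D "\<Union>D" K] D K by auto
    ultimately have "Inf K \<le> Sup K" by auto
    then show ?thesis by (simp flip: of_real_diff)
  qed
  then show "(\<Sum>K\<in>D. cmod (complex_of_real (Sup K) - complex_of_real (Inf K))) < \<epsilon>" using D by simp
qed simp

lemma abs_cont_on_imp_continuous_on:
  assumes f: "abs_cont_on a b f"
  shows "continuous_on {a..b} f"
  unfolding continuous_on_iff
proof (intro ballI allI impI)
  fix x \<epsilon> assume x: "x \<in> {a..b}" and "\<epsilon> > (0::real)"
  obtain \<delta> where \<delta>: "\<delta> > 0"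
    "\<And>D. disjoint_ivls a b D \<Longrightarrow> increments (\<lambda>x. x) D < \<delta> \<Longrightarrow> (\<Sum>z\<in>D. cmod (f (snd z) - f (fst z))) < \<epsilon>"
    using abs_cont_on_disjoint_ivls[OF f \<open>\<epsilon> > 0\<close>] by blast
  have *: "cmod (f q - f p) < \<epsilon>" if "a \<le> p" "p < q" "q \<le> b" "q - p < \<delta>" for p q
    using \<delta>(2)[of "{(p, q)}"] that by (simp add: disjoint_ivls_def increments_def)
  have "dist (f y) (f x) < \<epsilon>" if y: "y \<in> {a..b}" "dist y x < \<delta>" for y
  proof (cases y x rule: linorder_cases)
    case less
    then have "dist (f x) (f y) < \<epsilon>" using *[of y x] x y by (simp add: dist_norm)
    then show ?thesis by (simp add: dist_commute)
  next
    case equal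
    with \<open>\<epsilon> > 0\<close> show ?thesis by simp
  next
    case greater
    with * x y show ?thesis by (simp add: dist_norm)
  qed
  with \<delta>(1) show "\<exists>d>0. \<forall>x'\<in>{a..b}. dist x' x < d \<longrightarrow> dist (f x') (f x) < \<epsilon>" by blast
qed

section \<open>Sobolev functions\<close>

lemma Ico_sets [simp]: "Ico L \<in> sets borel" "Ico L \<in> sets lebesgue"
proof -
  show "Ico L \<in> sets borel"
  proof (cases L)
    case (real r)
    then have "Ico L = {0..<r}" by (auto simp: Ico_def)
    then show ?thesis by simp
  next
    case PInf
    then have "Ico L = {0..}" by (auto simp: Ico_def)
    then show ?thesis by simp
  next
    case MInf
    then have "Ico L = {}" by (auto simp: Ico_def)
    then show ?thesis by simp
  qed
  then show "Ico L \<in> sets lebesgue" by simp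
qed

lemma Icc_subset_Ico: "c \<in> Ico L \<Longrightarrow> {0..c} \<subseteq> Ico L"
  by (auto simp: Ico_def) (metis ereal_less_eq(3) le_less_trans)

lemma Ico_downward: "c \<in> Ico L \<Longrightarrow> 0 \<le> x \<Longrightarrow> x \<le> c \<Longrightarrow> x \<in> Ico L"
  using Icc_subset_Ico by force

lemma zero_in_Ico: "0 < L \<Longrightarrow> 0 \<in> Ico L"
  by (simp add: Ico_def zero_ereal_def)

lemma Ico_greater:
  assumes "x \<in> Ico L"
  obtains c where "x < c" "c \<in> Ico L"
proof -
  have "ereal x < L" using assms by (simp add: Ico_def)
  then obtain c where "ereal x < ereal c" "ereal c < L" using ereal_dense2 by blast
  with assms show thesis by (intro that[of c]) (auto simp: Ico_def)
qed

text \<open>These are the transition intervals of the cutoff functions. Their length is comparable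
  with \<open>b n\<close> for infinite \<open>L\<close> and with the distance from
  \<open>a n\<close> to \<open>L\<close> for finite \<open>L\<close>, which are the two quantities
  bounding \<open>|v|^2\<close> on \<open>[a n, b n]\<close> for \<open>v\<close> in
  \<open>H_prime_star L\<close>.\<close>

lemma Ico_exhaust:
  assumes "0 < L"
  obtains a b :: "nat \<Rightarrow> real" where
    "\<And>n. 0 < a n" "\<And>n. a n < b n" "\<And>n. b n \<in> Ico L"
    "\<And>x. x \<in> Ico L \<Longrightarrow> \<exists>N. \<forall>n\<ge>N. x \<le> a n"
    "\<And>n. L = \<infinity> \<Longrightarrow> b n \<le> 2 * (b n - a n)"
    "\<And>n. L < \<infinity> \<Longrightarrow> real_of_ereal L - a n \<le> 2 * (b n - a n)"
proof (cases L)
  case (real l)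
  then have "l > 0" using assms by simp
  \<comment> \<open>The denominator \<open>n + 3\<close> ensures \<open>3 * e n \<le> l\<close>, so
    the left ends \<open>l - 2 * e n\<close> are positive from \<open>n = 0\<close> on.\<close>
  define e where "e n = l / (real n + 3)" for n
  have e: "0 < e n" "3 * e n \<le> l" for n
    using \<open>l > 0\<close> by (auto simp: e_def field_simps)
  show thesis
  proof (rule that[of "\<lambda>n. l - 2 * e n" "\<lambda>n. l - e n"])
    fix n
    show "0 < l - 2 * e n" using e[of n] by simp
    show "l - 2 * e n < l - e n" using e[of n] by simp
    show "l - e n \<in> Ico L" using e[of n] by (simp add: Ico_def real)
    show "L = \<infinity> \<Longrightarrow> l - e n \<le> 2 * (l - e n - (l - 2 * e n))" by (simp add: real)
    show "real_of_ereal L - (l - 2 * e n) \<le> 2 * (l - e n - (l - 2 * e n))" by (simp add: real)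
  next
    fix x assume "x \<in> Ico L"
    then have "x < l" by (simp add: Ico_def real)
    then obtain N where N: "2 * l / (l - x) < real N" using reals_Archimedean2 by blast
    have "x \<le> l - 2 * e n" if "n \<ge> N" for n
    proof -
      have "2 * l / (l - x) \<le> real n + 3" using N that by linarith
      then have "2 * l \<le> (real n + 3) * (l - x)" using \<open>x < l\<close> by (simp add: field_simps)
      then have "2 * l / (real n + 3) \<le> l - x" by (simp add: field_simps)
      then show ?thesis by (simp add: e_def)
    qed
    then show "\<exists>N. \<forall>n\<ge>N. x \<le> l - 2 * e n" by blast
  qed
next
  case PInf
  show thesis
  proof (rule that[of "\<lambda>n. real n + 1" "\<lambda>n. 2 * real n + 2"])
    fix x :: real
    obtain N where "x < real N" using reals_Archimedean2 by blast
    then show "\<exists>N. \<forall>n\<ge>N. x \<le> real n + 1"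
      by (intro exI[of _ N]) auto
  qed (auto simp: Ico_def PInf)
qed (use assms in auto)

lemma AE_lebesgue_on_Ico:
  assumes "0 < L" "\<And>c. c \<in> Ico L \<Longrightarrow> AE x in lebesgue_on {0..c}. P x"
  shows "AE x in lebesgue_on (Ico L). P x"
proof -
  obtain a b :: "nat \<Rightarrow> real" where ab: "\<And>n. 0 < a n" "\<And>n. a n < b n" "\<And>n. b n \<in> Ico L"
    "\<And>x. x \<in> Ico L \<Longrightarrow> \<exists>N. \<forall>n\<ge>N. x \<le> a n"
    using Ico_exhaust[OF assms(1)] by metis
  have "AE x in lebesgue. \<forall>n. x \<in> {0..b n} \<longrightarrow> P x"
    using assms(2)[OF ab(3)] by (subst AE_all_countable) (simp add: AE_restrict_space_iff)
  then have "AE x in lebesgue. x \<in> Ico L \<longrightarrow> P x"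
  proof eventually_elim
    case (elim x)
    show ?case
    proof
      assume x: "x \<in> Ico L"
      then obtain N where "x \<le> a N" using ab(4) by blast
      with x ab(2)[of N] have "x \<in> {0..b N}" by (simp add: Ico_def)
      with elim show "P x" by blast
    qed
  qed
  then show ?thesis by (simp add: AE_restrict_space_iff)
qed

lemma AE_lebesgue_on_subset:
  assumes "AE x in lebesgue_on T. P x" "S \<subseteq> T" "S \<in> sets lebesgue" "T \<in> sets lebesgue"
  shows "AE x in lebesgue_on S. P x"
  using assms by (auto simp: AE_restrict_space_iff elim!: eventually_mono)

lemma L2_locD: "f \<in> L2_loc L \<Longrightarrow> c \<in> Ico L \<Longrightarrow> f \<in> sq_int (lebesgue_on {0..c})"
  by (auto simp: L2_loc_def Ico_def)

lemma L2_locI: "(\<And>c. c \<in> Ico L \<Longrightarrow> f \<in> sq_int (lebesgue_on {0..c})) \<Longrightarrow> f \<in> L2_loc L"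
  by (auto simp: L2_loc_def Ico_def)

lemma L2_loc_cong_AE:
  assumes "f \<in> L2_loc L" "AE x in lebesgue_on (Ico L). f x = g x"
  shows "g \<in> L2_loc L"
proof (rule L2_locI)
  fix c assume c: "c \<in> Ico L"
  have "AE x in lebesgue_on {0..c}. f x = g x"
    using AE_lebesgue_on_subset[OF assms(2) Icc_subset_Ico[OF c]] by simp
  then show "g \<in> sq_int (lebesgue_on {0..c})"
    by (rule sq_int_cong_AE_lebesgue_on[rotated 2]) (use L2_locD[OF assms(1) c] in auto)
qed

lemma L2_loc_of_sq_int: "f \<in> sq_int (lebesgue_on (Ico L)) \<Longrightarrow> f \<in> L2_loc L"
  by (rule L2_locI, rule sq_int_lebesgue_on_subset[of _ "Ico L"]) (simp_all add: Icc_subset_Ico del: atLeastatMost_subset_iff)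

section \<open>Local Sobolev functions: derivatives, continuity and algebra\<close>

lemma H1_locD:
  assumes "f \<in> H1_loc L"
  shows "x \<notin> Ico L \<Longrightarrow> f x = 0" "c \<in> Ico L \<Longrightarrow> abs_cont_on 0 c f" "D1 f \<in> L2_loc L"
  using assms by (auto simp: H1_loc_def funs_on_def Ico_def)

lemma H1_loc_FTC:
  assumes "f \<in> H1_loc L" "x \<in> Ico L"
  shows "f x = f 0 + (LINT t|lebesgue_on {0..x}. D1 f t)"
  using abs_cont_on_AE_density(3)[OF H1_locD(2)[OF assms], of x] assms(2) by (simp add: Ico_def)

lemma H1_loc_AE_deriv:
  assumes "0 < L" "f \<in> H1_loc L"
  shows "AE x in lebesgue_on (Ico L). (f has_vector_derivative D1 f x) (at x)"
proof (rule AE_lebesgue_on_Ico[OF assms(1)])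
  fix c assume "c \<in> Ico L"
  then show "AE x in lebesgue_on {0..c}. (f has_vector_derivative D1 f x) (at x)"
    using abs_cont_on_AE_density(2)[OF H1_locD(2)[OF assms(2)], of c] by (simp add: Ico_def)
qed

lemma H1_locI_AE_deriv:
  assumes L: "0 < L" and zero: "\<And>x. x \<notin> Ico L \<Longrightarrow> f x = 0"
    and ac: "\<And>c. c \<in> Ico L \<Longrightarrow> abs_cont_on 0 c f"
    and der: "AE x in lebesgue_on (Ico L). (f has_vector_derivative w x) (at x)"
    and w: "w \<in> L2_loc L"
  shows "f \<in> H1_loc L" "AE x in lebesgue_on (Ico L). D1 f x = w x"
proof -
  show eq: "AE x in lebesgue_on (Ico L). D1 f x = w x"
    using der by eventually_elim (rule vector_derivative_at)
  then have "D1 f \<in> L2_loc L"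
    by (intro L2_loc_cong_AE[OF w]) (simp add: eq_commute)
  with zero ac show "f \<in> H1_loc L"
    by (auto simp: H1_loc_def funs_on_def Ico_def)
qed

lemma H1_locI_integral:
  assumes L: "0 < L" and zero: "\<And>x. x \<notin> Ico L \<Longrightarrow> f x = 0" and w: "w \<in> L2_loc L"
    and f: "\<And>x. x \<in> Ico L \<Longrightarrow> f x = c + (LINT t|lebesgue_on {0..x}. w t)"
  shows "f \<in> H1_loc L" "AE x in lebesgue_on (Ico L). D1 f x = w x"
proof -
  have int: "integrable (lebesgue_on {0..c}) w" if "c \<in> Ico L" for c
    using L2_locD[OF w that] by (rule integrable_sq_int_Icc)
  have f': "f x = c + (LINT t|lebesgue_on {0..x}. w t)" if "d \<in> Ico L" "x \<in> {0..d}" for d x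
    using f[of x] Icc_subset_Ico[OF that(1)] that(2) by blast
  have ac: "abs_cont_on 0 d f" if "d \<in> Ico L" for d
    by (rule abs_cont_on_indefinite_integral[OF L2_locD[OF w that] int[OF that] f'[OF that]])
  have der: "AE x in lebesgue_on (Ico L). (f has_vector_derivative w x) (at x)"
  proof (rule AE_lebesgue_on_Ico[OF L])
    fix d assume d: "d \<in> Ico L"
    show "AE x in lebesgue_on {0..d}. (f has_vector_derivative w x) (at x)"
      by (rule AE_has_vector_derivative_indefinite_integral[OF int[OF d] f'[OF d]])
  qed
  show "f \<in> H1_loc L" "AE x in lebesgue_on (Ico L). D1 f x = w x"
    by (rule H1_locI_AE_deriv[OF L zero ac der w]; assumption)+
qed

lemma H1_loc_bounded:
  assumes "f \<in> H1_loc L" "c \<in> Ico L"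
  obtains B where "B \<ge> 0" "\<And>x. x \<in> {0..c} \<Longrightarrow> cmod (f x) \<le> B"
proof -
  have "continuous_on {0..c} f" by (rule abs_cont_on_imp_continuous_on[OF H1_locD(2)[OF assms]])
  then have "bounded (f ` {0..c})"
    by (intro compact_imp_bounded compact_continuous_image) auto
  then obtain B where "\<forall>y\<in>f ` {0..c}. cmod y \<le> B" unfolding bounded_iff by blast
  then show thesis by (intro that[of "max 0 B"]) (auto simp: le_max_iff_disj)
qed

lemma H1_loc_continuous_on:
  assumes "f \<in> H1_loc L"
  shows "continuous_on (Ico L) f"
  unfolding continuous_on_iff
proof (intro ballI allI impI)
  fix x \<epsilon> assume x: "x \<in> Ico L" and "\<epsilon> > (0::real)"
  obtain c where c: "x < c" "c \<in> Ico L" using Ico_greater[OF x] .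
  have x': "x \<in> {0..c}" using x c by (simp add: Ico_def)
  have "continuous_on {0..c} f" by (rule abs_cont_on_imp_continuous_on[OF H1_locD(2)[OF assms c(2)]])
  with x' \<open>\<epsilon> > 0\<close> obtain d where d: "d > 0" "\<And>y. y \<in> {0..c} \<Longrightarrow> dist y x < d \<Longrightarrow> dist (f y) (f x) < \<epsilon>"
    unfolding continuous_on_iff by blast
  have "dist (f y) (f x) < \<epsilon>" if "y \<in> Ico L" "dist y x < min d (c - x)" for y
    using that by (intro d(2)) (auto simp: Ico_def dist_real_def)
  then show "\<exists>d>0. \<forall>x'\<in>Ico L. dist x' x < d \<longrightarrow> dist (f x') (f x) < \<epsilon>"
    using d(1) c(1) by (intro exI[of _ "min d (c - x)"]) auto
qed

text \<open>Borel rather than Lebesgue measurability is recorded because these functions are also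
  integrated against the Borel measure \<upsilon>. The extension by zero makes a function continuous
  on \<open>[0, L)\<close> Borel on the line.\<close>

lemma H1_loc_borel_measurable:
  assumes "f \<in> H1_loc L"
  shows "f \<in> borel_measurable borel"
proof -
  have "(\<lambda>x. indicator (Ico L) x *\<^sub>R f x) \<in> borel_measurable borel"
    by (rule borel_measurable_continuous_on_indicator[OF _ H1_loc_continuous_on[OF assms]]) simp
  moreover have "(\<lambda>x. indicator (Ico L) x *\<^sub>R f x) = f"
    using H1_locD(1)[OF assms] by (auto simp: indicator_def fun_eq_iff)
  ultimately show ?thesis by simp
qed

lemma H1_loc_mult_L2_loc:
  assumes f: "f \<in> H1_loc L" and w: "w \<in> L2_loc L"
  shows "(\<lambda>x. f x * w x) \<in> L2_loc L"
proof (rule L2_locI)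
  fix c assume c: "c \<in> Ico L"
  obtain B where "\<And>x. x \<in> {0..c} \<Longrightarrow> cmod (f x) \<le> B" using H1_loc_bounded[OF f c] by blast
  moreover have "f \<in> borel_measurable (lebesgue_on {0..c})"
    using H1_loc_borel_measurable[OF f]
    by (intro measurable_restrict_space1 measurable_completion) simp
  ultimately show "(\<lambda>x. f x * w x) \<in> sq_int (lebesgue_on {0..c})"
    by (intro sq_int_bounded_mult[OF L2_locD[OF w c], where B = B]) auto
qed

lemma L2_loc_add: "f \<in> L2_loc L \<Longrightarrow> g \<in> L2_loc L \<Longrightarrow> (\<lambda>x. f x + g x) \<in> L2_loc L"
  by (intro L2_locI sq_int_add) (auto intro: L2_locD)

lemma L2_loc_cmult: "f \<in> L2_loc L \<Longrightarrow> (\<lambda>x. a * f x) \<in> L2_loc L"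
  by (intro L2_locI sq_int_cmult) (auto intro: L2_locD)

lemma L2_loc_cnj: "f \<in> L2_loc L \<Longrightarrow> (\<lambda>x. cnj (f x)) \<in> L2_loc L"
  by (intro L2_locI sq_int_cnj) (auto intro: L2_locD)

lemma H1_loc_mult:
  assumes L: "0 < L" and f: "f \<in> H1_loc L" and g: "g \<in> H1_loc L"
  shows "(\<lambda>x. f x * g x) \<in> H1_loc L"
    and "AE x in lebesgue_on (Ico L). D1 (\<lambda>x. f x * g x) x = f x * D1 g x + g x * D1 f x"
proof -
  have ac: "abs_cont_on 0 c (\<lambda>x. f x * g x)" if c: "c \<in> Ico L" for c
  proof -
    obtain A where A: "\<And>x. x \<in> {0..c} \<Longrightarrow> cmod (f x) \<le> A" using H1_loc_bounded[OF f c] by blast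
    obtain B where B: "\<And>x. x \<in> {0..c} \<Longrightarrow> cmod (g x) \<le> B" using H1_loc_bounded[OF g c] by blast
    show ?thesis
    proof (rule abs_cont_on_dominated[OF H1_locD(2)[OF f c] H1_locD(2)[OF g c]])
      fix x y assume xy: "x \<in> {0..c}" "y \<in> {0..c}"
      have "f x * g x - f y * g y = g y * (f x - f y) + f x * (g x - g y)" by (simp add: algebra_simps)
      then have "cmod (f x * g x - f y * g y) \<le> cmod (g y * (f x - f y)) + cmod (f x * (g x - g y))"
        by (metis norm_triangle_ineq)
      also have "\<dots> \<le> B * cmod (f x - f y) + A * cmod (g x - g y)"
        unfolding norm_mult using A B xy by (intro add_mono mult_right_mono) auto
      finally show "cmod (f x * g x - f y * g y) \<le> B * cmod (f x - f y) + A * cmod (g x - g y)" .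
    qed
  qed
  have der: "AE x in lebesgue_on (Ico L). ((\<lambda>x. f x * g x) has_vector_derivative
      (f x * D1 g x + g x * D1 f x)) (at x)"
    using H1_loc_AE_deriv[OF L f] H1_loc_AE_deriv[OF L g]
  proof eventually_elim
    case (elim x)
    show ?case using has_vector_derivative_mult[OF elim] by (simp add: mult.commute)
  qed
  have w: "(\<lambda>x. f x * D1 g x + g x * D1 f x) \<in> L2_loc L"
    by (intro L2_loc_add H1_loc_mult_L2_loc f g H1_locD(3))
  show "(\<lambda>x. f x * g x) \<in> H1_loc L"
    "AE x in lebesgue_on (Ico L). D1 (\<lambda>x. f x * g x) x = f x * D1 g x + g x * D1 f x"
    by (rule H1_locI_AE_deriv[OF L _ ac der w]; use H1_locD(1)[OF f] in simp)+
qed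

lemma H1_loc_lincomb:
  assumes L: "0 < L" and f: "f \<in> H1_loc L" and g: "g \<in> H1_loc L"
  shows "(\<lambda>x. f x + a * g x) \<in> H1_loc L"
    and "AE x in lebesgue_on (Ico L). D1 (\<lambda>x. f x + a * g x) x = D1 f x + a * D1 g x"
proof -
  have ac: "abs_cont_on 0 c (\<lambda>x. f x + a * g x)" if c: "c \<in> Ico L" for c
  proof (rule abs_cont_on_dominated[OF H1_locD(2)[OF f c] H1_locD(2)[OF g c]])
    fix x y
    have "f x + a * g x - (f y + a * g y) = (f x - f y) + a * (g x - g y)" by (simp add: algebra_simps)
    then have "cmod (f x + a * g x - (f y + a * g y)) \<le> cmod (f x - f y) + cmod (a * (g x - g y))"
      by (metis norm_triangle_ineq)
    then show "cmod (f x + a * g x - (f y + a * g y)) \<le> 1 * cmod (f x - f y) + cmod a * cmod (g x - g y)"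
      by (simp add: norm_mult)
  qed
  have der: "AE x in lebesgue_on (Ico L). ((\<lambda>x. f x + a * g x) has_vector_derivative (D1 f x + a * D1 g x)) (at x)"
    using H1_loc_AE_deriv[OF L f] H1_loc_AE_deriv[OF L g]
    by eventually_elim (intro derivative_intros has_vector_derivative_mult_right)
  have w: "(\<lambda>x. D1 f x + a * D1 g x) \<in> L2_loc L"
    by (intro L2_loc_add L2_loc_cmult f g H1_locD(3))
  show "(\<lambda>x. f x + a * g x) \<in> H1_loc L"
    "AE x in lebesgue_on (Ico L). D1 (\<lambda>x. f x + a * g x) x = D1 f x + a * D1 g x"
    by (rule H1_locI_AE_deriv[OF L _ ac der w]; use H1_locD(1)[OF f] H1_locD(1)[OF g] in simp)+
qed

lemma H1_loc_cnj:
  assumes L: "0 < L" and f: "f \<in> H1_loc L"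
  shows "(\<lambda>x. cnj (f x)) \<in> H1_loc L"
    and "AE x in lebesgue_on (Ico L). D1 (\<lambda>x. cnj (f x)) x = cnj (D1 f x)"
proof -
  have ac: "abs_cont_on 0 c (\<lambda>x. cnj (f x))" if c: "c \<in> Ico L" for c
    by (rule abs_cont_on_dominated[OF H1_locD(2)[OF f c] H1_locD(2)[OF f c], of _ 1 0])
       (simp flip: complex_cnj_diff)
  have der: "AE x in lebesgue_on (Ico L). ((\<lambda>x. cnj (f x)) has_vector_derivative cnj (D1 f x)) (at x)"
    using H1_loc_AE_deriv[OF L f]
    by eventually_elim (rule bounded_linear.has_vector_derivative[OF bounded_linear_cnj])
  have w: "(\<lambda>x. cnj (D1 f x)) \<in> L2_loc L" by (intro L2_loc_cnj H1_locD(3) f)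
  show "(\<lambda>x. cnj (f x)) \<in> H1_loc L"
    "AE x in lebesgue_on (Ico L). D1 (\<lambda>x. cnj (f x)) x = cnj (D1 f x)"
    by (rule H1_locI_AE_deriv[OF L _ ac der w]; use H1_locD(1)[OF f] in simp)+
qed

section \<open>Compactly supported functions, the space \<open>H'\<^sub>*\<close> and cutoff functions\<close>

lemma D1_eq_0_beyond:
  assumes "\<And>x. b < x \<Longrightarrow> f x = 0" "b < x"
  shows "D1 f x = 0"
proof -
  have "((\<lambda>x. 0) has_vector_derivative 0) (at x)" by (rule has_vector_derivative_const)
  then have "(f has_vector_derivative 0) (at x)"
    by (rule has_vector_derivative_transform_within_open[of _ _ _ "{b<..}"]) (use assms in auto)
  then show ?thesis by (rule vector_derivative_at)
qed

text \<open>Functions in \<open>H1_loc L\<close> already vanish at negative arguments, so compact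
  support in \<open>[0, L)\<close> amounts to vanishing beyond some \<open>b\<close> in
  \<open>[0, L)\<close>. This is the form in which it is used from here on, with
  \<open>H1_cD\<close> as the converse.\<close>

lemma H1_cI:
  assumes f: "f \<in> H1_loc L" and b: "b \<in> Ico L" and zero: "\<And>x. b < x \<Longrightarrow> f x = 0"
  shows "f \<in> H1_c L"
proof -
  note sub = Icc_subset_Ico[OF b]
  have ext: "g \<in> sq_int (lebesgue_on (Ico L))"
    if "g \<in> sq_int (lebesgue_on {0..b})" "\<And>x. b < x \<Longrightarrow> g x = 0" for g
    using that(1) sub
    by (rule sq_int_lebesgue_on_extend) (use that(2) in \<open>auto simp: Ico_def not_le intro!: AE_I2\<close>)
  obtain B where B: "\<And>x. x \<in> {0..b} \<Longrightarrow> cmod (f x) \<le> B" using H1_loc_bounded[OF f b] by blast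
  have [measurable]: "f \<in> borel_measurable (lebesgue_on {0..b})"
    using H1_loc_borel_measurable[OF f] by (intro measurable_restrict_space1 measurable_completion) simp
  have one: "(\<lambda>x. 1) \<in> sq_int (lebesgue_on {0..b})"
    by (simp add: sq_int_def finite_measure.integrable_const finite_measure_lebesgue_on)
  have "(\<lambda>x. f x * 1) \<in> sq_int (lebesgue_on {0..b})"
    using B by (intro sq_int_bounded_mult[OF one, where B = B]) auto
  then have "f \<in> sq_int (lebesgue_on (Ico L))" by (intro ext zero) auto
  moreover have "D1 f \<in> sq_int (lebesgue_on (Ico L))"
    using D1_eq_0_beyond[of b f, OF zero] by (intro ext L2_locD[OF H1_locD(3)[OF f] b]) auto
  moreover have "f \<in> funs_on {0..b}"
    using zero H1_locD(1)[OF f] by (auto simp: funs_on_def Ico_def not_le)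
  ultimately show ?thesis
    unfolding H1_c_def using f sub by blast
qed

lemma H1_cD:
  assumes "0 < L" "f \<in> H1_c L"
  obtains b where "f \<in> H1_loc L" "b \<in> Ico L" "\<And>x. b < x \<Longrightarrow> f x = 0"
proof -
  from assms(2) obtain K where K: "compact K" "K \<subseteq> Ico L" "f \<in> funs_on K" and f: "f \<in> H1_loc L"
    by (auto simp: H1_c_def)
  show thesis
  proof (cases "K = {}")
    case True
    with K(3) show ?thesis by (intro that[OF f zero_in_Ico[OF assms(1)]]) (auto simp: funs_on_def)
  next
    case False
    obtain b where b: "b \<in> K" "\<And>x. x \<in> K \<Longrightarrow> x \<le> b" using compact_attains_sup[OF K(1) False] by blast
    show ?thesis
    proof (rule that[OF f])
      show "b \<in> Ico L" using b K by blast
      show "f x = 0" if "b < x" for x using b(2)[of x] that K(3) by (auto simp: funs_on_def)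
    qed
  qed
qed

lemma H1_c_subset: "f \<in> H1_c L \<Longrightarrow> f \<in> H1_loc L" "f \<in> H1_c L \<Longrightarrow> D1 f \<in> sq_int (lebesgue_on (Ico L))"
  by (auto simp: H1_c_def)

lemma H1_c_mult:
  assumes L: "0 < L" and f: "f \<in> H1_loc L" and g: "g \<in> H1_c L"
  shows "(\<lambda>x. f x * g x) \<in> H1_c L"
proof -
  obtain b where b: "g \<in> H1_loc L" "b \<in> Ico L" "\<And>x. b < x \<Longrightarrow> g x = 0" using H1_cD[OF L g] by blast
  show ?thesis by (rule H1_cI[OF H1_loc_mult(1)[OF L f b(1)] b(2)]) (simp add: b(3))
qed

lemma H1_c_cnj:
  assumes L: "0 < L" and g: "g \<in> H1_c L"
  shows "(\<lambda>x. cnj (g x)) \<in> H1_c L"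
proof -
  obtain b where b: "g \<in> H1_loc L" "b \<in> Ico L" "\<And>x. b < x \<Longrightarrow> g x = 0" using H1_cD[OF L g] by blast
  show ?thesis by (rule H1_cI[OF H1_loc_cnj(1)[OF L b(1)] b(2)]) (simp add: b(3))
qed

lemma H1_c_lincomb:
  assumes L: "0 < L" and f: "f \<in> H1_c L" and g: "g \<in> H1_c L"
  shows "(\<lambda>x. f x + a * g x) \<in> H1_c L"
proof -
  obtain b where b: "f \<in> H1_loc L" "b \<in> Ico L" "\<And>x. b < x \<Longrightarrow> f x = 0" using H1_cD[OF L f] by blast
  obtain c where c: "g \<in> H1_loc L" "c \<in> Ico L" "\<And>x. c < x \<Longrightarrow> g x = 0" using H1_cD[OF L g] by blast
  have "max b c \<in> Ico L" using b(2) c(2) by (auto simp: max_def)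
  then show ?thesis by (rule H1_cI[OF H1_loc_lincomb(1)[OF L b(1) c(1)]]) (simp add: b(3) c(3))
qed

section \<open>The space \<open>H_prime_star\<close> and its pointwise bounds\<close>

lemma H_prime_starD:
  assumes "v \<in> H_prime_star L"
  shows "v \<in> H1_loc L" "v 0 = 0" "D1 v \<in> sq_int (lebesgue_on (Ico L))"
    "L < \<infinity> \<Longrightarrow> (v \<longlongrightarrow> 0) (at_left (real_of_ereal L))"
  using assms by (auto simp: H_prime_star_def H_prime_def)

lemma H_prime_star_cnj:
  assumes L: "0 < L" and v: "v \<in> H_prime_star L"
  shows "(\<lambda>x. cnj (v x)) \<in> H_prime_star L"
proof -
  note v' = H_prime_starD[OF v]
  have "D1 (\<lambda>x. cnj (v x)) \<in> sq_int (lebesgue_on (Ico L))"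
    by (rule sq_int_cong_AE_lebesgue_on[OF _ sq_int_cnj[OF v'(3)]])
       (use H1_loc_cnj(2)[OF L v'(1)] in \<open>auto simp: eq_commute\<close>)
  moreover have "((\<lambda>x. cnj (v x)) \<longlongrightarrow> 0) (at_left (real_of_ereal L))" if "L < \<infinity>"
    using tendsto_cnj[OF v'(4)[OF that]] by simp
  ultimately show ?thesis
    using H1_loc_cnj(1)[OF L v'(1)] v'(2) by (simp add: H_prime_star_def H_prime_def)
qed

lemma H1_c_imp_H_prime_star:
  assumes L: "0 < L" and h: "h \<in> H1_c L" and "h 0 = 0"
  shows "h \<in> H_prime_star L"
proof -
  obtain b where b: "h \<in> H1_loc L" "b \<in> Ico L" "\<And>x. b < x \<Longrightarrow> h x = 0" using H1_cD[OF L h] by blast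
  have "(h \<longlongrightarrow> 0) (at_left (real_of_ereal L))" if "L < \<infinity>"
  proof -
    obtain l where l: "L = ereal l" using L \<open>L < \<infinity>\<close> by (cases L) auto
    have "b < l" using b(2) by (simp add: Ico_def l)
    then have "eventually (\<lambda>x. h x = 0) (at_left l)"
      unfolding eventually_at_left_field using b(3) by blast
    then show ?thesis by (simp add: l tendsto_eventually)
  qed
  then show ?thesis using b(1) H1_c_subset(2)[OF h] \<open>h 0 = 0\<close> by (simp add: H_prime_star_def H_prime_def)
qed

text \<open>Cauchy-Schwarz for the product of the constant 1 with \<open>D1 v\<close> on
  \<open>[x, y]\<close>. Setting \<open>x = 0\<close> gives the growth bound at infinity; letting
  \<open>y\<close> tend to a finite \<open>L\<close> gives the decay bound at the right
  endpoint.\<close>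

lemma H1_loc_diff_le:
  assumes v: "v \<in> H1_loc L" "D1 v \<in> sq_int (lebesgue_on (Ico L))"
    and xy: "0 \<le> x" "x \<le> y" "y \<in> Ico L"
  shows "(cmod (v y - v x))\<^sup>2 \<le> (y - x) * (LINT t|lebesgue_on (Ico L). (cmod (D1 v t))\<^sup>2)"
proof -
  note sub = Icc_subset_Ico[OF xy(3)]
  have sub': "{x..y} \<subseteq> Ico L" using sub xy(1) by auto
  have x: "x \<in> Ico L" using Ico_downward xy by blast
  have int: "integrable (lebesgue_on {0..y}) (D1 v)"
    by (rule integrable_sq_int_Icc[OF L2_locD[OF H1_locD(3)[OF v(1)] xy(3)]])
  have "v y - v x = (LINT t|lebesgue_on {x..y}. D1 v t)"
    using H1_loc_FTC[OF v(1) xy(3)] H1_loc_FTC[OF v(1) x]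
      Equivalence_Measurable_On_Borel.integral_combine[OF int xy(1,2)] by simp
  moreover have sq: "D1 v \<in> sq_int (lebesgue_on {x..y})"
    using sq_int_lebesgue_on_subset[OF v(2) sub'] by simp
  have "(\<lambda>x. 1) \<in> sq_int (lebesgue_on {x..y})"
    by (simp add: sq_int_def finite_measure.integrable_const finite_measure_lebesgue_on)
  from Cauchy_Schwarz_sq_int[OF this sq]
  have "(cmod (LINT t|lebesgue_on {x..y}. D1 v t))\<^sup>2 \<le> (y - x) * (LINT t|lebesgue_on {x..y}. (cmod (D1 v t))\<^sup>2)"
    using xy(2) by (simp add: measure_restrict_space)
  moreover have "(LINT t|lebesgue_on {x..y}. (cmod (D1 v t))\<^sup>2) \<le> (LINT t|lebesgue_on (Ico L). (cmod (D1 v t))\<^sup>2)"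
    using sq_intD(2)[OF v(2)] sub' by (intro integral_mono_lebesgue_on_AE) auto
  then have "(y - x) * (LINT t|lebesgue_on {x..y}. (cmod (D1 v t))\<^sup>2)
      \<le> (y - x) * (LINT t|lebesgue_on (Ico L). (cmod (D1 v t))\<^sup>2)"
    using xy(2) by (intro mult_left_mono) auto
  ultimately show ?thesis by simp
qed

lemma H_prime_star_bound:
  assumes "v \<in> H_prime_star L" "x \<in> Ico L"
  shows "(cmod (v x))\<^sup>2 \<le> x * (LINT t|lebesgue_on (Ico L). (cmod (D1 v t))\<^sup>2)"
  using H1_loc_diff_le[OF H_prime_starD(1,3)[OF assms(1)], of 0 x] H_prime_starD(2)[OF assms(1)] assms(2)
  by (simp add: Ico_def)

lemma H_prime_star_bound_right:
  assumes v: "v \<in> H_prime_star L" and x: "x \<in> Ico L" and "L < \<infinity>"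
  shows "(cmod (v x))\<^sup>2 \<le> (real_of_ereal L - x) * (LINT t|lebesgue_on (Ico L). (cmod (D1 v t))\<^sup>2)"
    (is "_ \<le> _ * ?N")
proof -
  obtain l where l: "L = ereal l" using x \<open>L < \<infinity>\<close> by (cases L) (auto simp: Ico_def)
  have "x < l" "0 \<le> x" using x by (auto simp: Ico_def l)
  have "?N \<ge> 0" by (rule integral_nonneg_AE) simp
  have "((\<lambda>y. (cmod (v y - v x))\<^sup>2) \<longlongrightarrow> (cmod (0 - v x))\<^sup>2) (at_left l)"
    using H_prime_starD(4)[OF v \<open>L < \<infinity>\<close>] by (intro tendsto_intros) (simp add: l)
  moreover have "eventually (\<lambda>y. (cmod (v y - v x))\<^sup>2 \<le> (l - x) * ?N) (at_left l)"
    unfolding eventually_at_left_field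
  proof (intro exI[of _ x] conjI allI impI \<open>x < l\<close>)
    fix y assume "x < y" "y < l"
    then have "(cmod (v y - v x))\<^sup>2 \<le> (y - x) * ?N"
      using \<open>0 \<le> x\<close> by (intro H1_loc_diff_le[OF H_prime_starD(1,3)[OF v]]) (auto simp: Ico_def l)
    also have "\<dots> \<le> (l - x) * ?N" using \<open>?N \<ge> 0\<close> \<open>y < l\<close> by (intro mult_right_mono) auto
    finally show "(cmod (v y - v x))\<^sup>2 \<le> (l - x) * ?N" .
  qed
  ultimately have "(cmod (0 - v x))\<^sup>2 \<le> (l - x) * ?N"
    by (intro tendsto_upperbound) auto
  then show ?thesis by (simp add: l)
qed

text \<open>The value is 1 up to \<open>a\<close>, 0 from \<open>b\<close> on, and affine in
  between. It is set to zero at negative arguments because members of \<open>H1_loc L\<close> are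
  extended by zero.\<close>

definition cutoff :: "real \<Rightarrow> real \<Rightarrow> real \<Rightarrow> complex" where
  "cutoff a b x = (if x < 0 then 0 else of_real (max 0 (min 1 ((b - x) / (b - a)))))"

lemma cutoff_eq:
  assumes "a < b"
  shows "0 \<le> x \<Longrightarrow> x \<le> a \<Longrightarrow> cutoff a b x = 1" "b \<le> x \<Longrightarrow> cutoff a b x = 0"
    "cmod (cutoff a b x) \<le> 1"
  using assms by (auto simp: cutoff_def min_def max_def field_simps)

lemma cutoff_H1_c:
  assumes L: "0 < L" and ab: "0 < a" "a < b" "b \<in> Ico L"
  shows "cutoff a b \<in> H1_c L"
    and "AE x in lebesgue_on (Ico L). D1 (cutoff a b) x = (if a \<le> x \<and> x \<le> b then - 1 / of_real (b - a) else 0)"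
proof -
  have zero: "cutoff a b x = 0" if "x \<notin> Ico L" for x
  proof (cases "x < 0")
    case False
    then have "b \<le> x" using that Ico_downward[OF ab(3), of x] by fastforce
    then show ?thesis by (rule cutoff_eq(2)[OF ab(2)])
  qed (simp add: cutoff_def)
  have ac: "abs_cont_on 0 c (cutoff a b)" for c
  proof (rule abs_cont_on_dominated[OF abs_cont_on_of_real abs_cont_on_of_real, of _ _ _ "1 / (b - a)" 0])
    fix x y assume "x \<in> {0..c}" "y \<in> {0..c}"
    then have "cutoff a b x - cutoff a b y = of_real (max 0 (min 1 ((b - x) / (b - a))) - max 0 (min 1 ((b - y) / (b - a))))"
      by (simp add: cutoff_def)
    then have "cmod (cutoff a b x - cutoff a b y) = \<bar>max 0 (min 1 ((b - x) / (b - a))) - max 0 (min 1 ((b - y) / (b - a)))\<bar>"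
      by (simp only: norm_of_real)
    also have "\<dots> \<le> \<bar>(b - x) / (b - a) - (b - y) / (b - a)\<bar>" by (auto simp: max_def min_def)
    also have "\<dots> = 1 / (b - a) * \<bar>x - y\<bar>"
      using ab by (simp add: diff_divide_distrib[symmetric] abs_minus_commute)
    also have "\<bar>x - y\<bar> = cmod (complex_of_real x - complex_of_real y)"
      by (simp flip: of_real_diff)
    finally show "cmod (cutoff a b x - cutoff a b y) \<le> 1 / (b - a) * cmod (complex_of_real x - complex_of_real y)
        + 0 * cmod (complex_of_real x - complex_of_real y)" by simp
  qed
  let ?w = "\<lambda>x. if a \<le> x \<and> x \<le> b then - 1 / complex_of_real (b - a) else 0"
  \<comment> \<open>The exceptional points are the jump at 0 caused by the extension by zero and the
    two corners.\<close>
  have "AE x in lebesgue. x \<notin> {0, a, b}"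
    by (rule AE_not_in) (simp flip: negligible_iff_null_sets)
  then have "AE x in lebesgue. x \<in> Ico L \<longrightarrow> (cutoff a b has_vector_derivative ?w x) (at x)"
  proof eventually_elim
    case (elim x)
    show ?case
    proof
      assume "x \<in> Ico L"
      with elim have x: "0 < x" "x \<noteq> a" "x \<noteq> b" by (auto simp: Ico_def)
      consider "x < a" | "a < x" "x < b" | "b < x" using x by linarith
      then show "(cutoff a b has_vector_derivative ?w x) (at x)"
      proof cases
        case 1
        have "((\<lambda>x. 1) has_vector_derivative 0) (at x)" by (rule has_vector_derivative_const)
        then have "(cutoff a b has_vector_derivative 0) (at x)"
          by (rule has_vector_derivative_transform_within_open[of _ _ _ "{0<..<a}"])
             (use x 1 cutoff_eq(1)[OF ab(2)] in auto)
        then show ?thesis using 1 by simp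
      next
        case 2
        have "((\<lambda>x. (of_real b - of_real x) / of_real (b - a)) has_vector_derivative (0 - 1) / complex_of_real (b - a)) (at x)"
          by (intro has_vector_derivative_divide has_vector_derivative_diff has_vector_derivative_const
                has_vector_derivative_of_real derivative_eq_intros) auto
        then have "(cutoff a b has_vector_derivative (0 - 1) / complex_of_real (b - a)) (at x)"
          by (rule has_vector_derivative_transform_within_open[of _ _ _ "{a<..<b}"])
             (use 2 ab in \<open>auto simp: cutoff_def min_def max_def field_simps\<close>)
        then show ?thesis using 2 by simp
      next
        case 3
        have "((\<lambda>x. 0) has_vector_derivative 0) (at x)" by (rule has_vector_derivative_const)
        then have "(cutoff a b has_vector_derivative 0) (at x)"
          by (rule has_vector_derivative_transform_within_open[of _ _ _ "{b<..}"])
             (use 3 cutoff_eq(2)[OF ab(2)] in auto)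
        then show ?thesis using 3 by simp
      qed
    qed
  qed
  then have der: "AE x in lebesgue_on (Ico L). (cutoff a b has_vector_derivative ?w x) (at x)"
    by (simp add: AE_restrict_space_iff)
  have w: "?w \<in> L2_loc L"
  proof (rule L2_locI)
    fix c assume "c \<in> Ico L"
    have one: "(\<lambda>x. 1) \<in> sq_int (lebesgue_on {0..c})"
      by (simp add: sq_int_def finite_measure.integrable_const finite_measure_lebesgue_on)
    have "?w \<in> borel_measurable borel" by measurable
    then have "?w \<in> borel_measurable (lebesgue_on {0..c})"
      by (intro measurable_restrict_space1 measurable_completion) simp
    then have "(\<lambda>x. ?w x * 1) \<in> sq_int (lebesgue_on {0..c})"
      by (rule sq_int_bounded_mult[OF one, where B = "cmod (1 / complex_of_real (b - a))"]) (auto simp: norm_divide)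
    then show "?w \<in> sq_int (lebesgue_on {0..c})" by simp
  qed
  note H = H1_locI_AE_deriv[OF L zero ac der w]
  show "cutoff a b \<in> H1_c L"
  proof (rule H1_cI[OF H(1) ab(3)])
    show "cutoff a b x = 0" if "b < x" for x
      using cutoff_eq(2)[OF ab(2), of x] that by simp
  qed
  show "AE x in lebesgue_on (Ico L). D1 (cutoff a b) x = ?w x" by (rule H(2))
qed

section \<open>Limits along the cutoff sequence\<close>

lemma cutoff_seq_integral_tendsto:
  fixes a b :: "nat \<Rightarrow> real"
  assumes ab: "\<And>n. a n < b n" "\<And>x. x \<in> Ico L \<Longrightarrow> \<exists>N. \<forall>n\<ge>N. x \<le> a n"
    and M: "space M \<subseteq> Ico L" "\<And>n. cutoff (a n) (b n) \<in> borel_measurable M"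
    and k: "integrable M k"
  shows "(\<lambda>n. LINT x|M. cutoff (a n) (b n) x * k x) \<longlonglongrightarrow> (LINT x|M. k x)"
proof (rule integral_dominated_convergence)
  have [measurable]: "k \<in> borel_measurable M" using k by auto
  note [measurable] = M(2)
  show "k \<in> borel_measurable M" by measurable
  show "(\<lambda>x. cutoff (a n) (b n) x * k x) \<in> borel_measurable M" for n by measurable
  show "integrable M (\<lambda>x. norm (k x))" using k by simp
  show "AE x in M. norm (cutoff (a n) (b n) x * k x) \<le> norm (k x)" for n
    using cutoff_eq(3)[OF ab(1)] by (intro AE_I2) (auto simp: norm_mult intro: mult_left_le_one_le)
  show "AE x in M. (\<lambda>n. cutoff (a n) (b n) x * k x) \<longlonglongrightarrow> k x"
  proof (rule AE_I2)
    fix x assume "x \<in> space M"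
    then have x: "x \<in> Ico L" using M(1) by blast
    then obtain N where "\<And>n. n \<ge> N \<Longrightarrow> x \<le> a n" using ab(2) by blast
    then have "\<And>n. n \<ge> N \<Longrightarrow> cutoff (a n) (b n) x = 1"
      using cutoff_eq(1)[OF ab(1)] x by (simp add: Ico_def)
    then have "eventually (\<lambda>n. cutoff (a n) (b n) x * k x = k x) sequentially"
      unfolding eventually_sequentially by auto
    then show "(\<lambda>n. cutoff (a n) (b n) x * k x) \<longlonglongrightarrow> k x"
      by (rule tendsto_eventually)
  qed
qed

text \<open>Every point of \<open>[0, L)\<close> eventually leaves the tails, so dominated
  convergence applies. This makes the commutator term small in the cutoff limit.\<close>

lemma tail_integral_tendsto_0:
  fixes a :: "nat \<Rightarrow> real" and k :: "real \<Rightarrow> real"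
  assumes a: "\<And>x. x \<in> Ico L \<Longrightarrow> \<exists>N. \<forall>n\<ge>N. x \<le> a n"
    and k: "integrable (lebesgue_on (Ico L)) k"
  shows "(\<lambda>n. LINT x|lebesgue_on (Ico L). indicator {a n<..} x * k x) \<longlonglongrightarrow> 0"
proof -
  let ?M = "lebesgue_on (Ico L)"
  have [measurable]: "k \<in> borel_measurable ?M" using k by auto
  have [measurable]: "indicator {a n<..} \<in> borel_measurable ?M" for n :: nat
    by (intro measurable_restrict_space1 measurable_completion) simp
  have "(\<lambda>n. LINT x|?M. indicator {a n<..} x * k x) \<longlonglongrightarrow> (LINT x|?M. 0)"
  proof (rule integral_dominated_convergence)
    show "(\<lambda>x. indicator {a n<..} x * k x) \<in> borel_measurable ?M" for n by measurable
    show "integrable ?M (\<lambda>x. norm (k x))" using k by simp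
    show "AE x in ?M. norm (indicator {a n<..} x * k x) \<le> norm (k x)" for n
      by (intro AE_I2) (auto simp: indicator_def)
    show "AE x in ?M. (\<lambda>n. indicator {a n<..} x * k x) \<longlonglongrightarrow> 0"
    proof (rule AE_I2)
      fix x assume "x \<in> space ?M"
      then obtain N where "\<And>n. n \<ge> N \<Longrightarrow> x \<le> a n" using a by auto
      then have "eventually (\<lambda>n. indicator {a n<..} x * k x = 0) sequentially"
        unfolding eventually_sequentially by (auto simp: indicator_def intro!: exI[of _ N])
          (metis linorder_not_less)
      then show "(\<lambda>n. indicator {a n<..} x * k x) \<longlonglongrightarrow> 0"
        by (rule tendsto_eventually)
    qed
  qed simp
  then show ?thesis by simp
qed

text \<open>The commutator term \<open>\<integral> f' v \<phi>\<^sub>n'\<close> vanishes in the limit because \<open>\<bar>v\<bar>\<^sup>2 = O(b\<^sub>n - a\<^sub>n)\<close> on the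
  interval \<open>[a\<^sub>n, b\<^sub>n]\<close> where the cutoff function has slope \<open>-1/(b\<^sub>n - a\<^sub>n)\<close>.\<close>

lemma cutoff_seq_form_tendsto:
  assumes L: "0 < L" and ab: "\<And>n. 0 < a n" "\<And>n. a n < b n" "\<And>n. b n \<in> Ico L"
    "\<And>x. x \<in> Ico L \<Longrightarrow> \<exists>N. \<forall>n\<ge>N. x \<le> a n"
    "\<And>n. L = \<infinity> \<Longrightarrow> b n \<le> 2 * (b n - a n)"
    "\<And>n. L < \<infinity> \<Longrightarrow> real_of_ereal L - a n \<le> 2 * (b n - a n)"
    and f: "f \<in> sq_int (lebesgue_on (Ico L))" and v: "v \<in> H_prime_star L"
  shows "(\<lambda>n. LINT x|lebesgue_on (Ico L). f x * D1 (\<lambda>x. v x * cutoff (a n) (b n) x) x)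
    \<longlonglongrightarrow> (LINT x|lebesgue_on (Ico L). f x * D1 v x)"
proof -
  let ?M = "lebesgue_on (Ico L)"
  define \<phi> where "\<phi> n = cutoff (a n) (b n)" for n
  define \<phi>' where "\<phi>' n x = (if a n \<le> x \<and> x \<le> b n then - 1 / complex_of_real (b n - a n) else 0)" for n x
  define N where "N = (LINT t|?M. (cmod (D1 v t))\<^sup>2)"
  note v' = H_prime_starD[OF v]
  note [measurable] = sq_intD(1)[OF f] sq_intD(1)[OF v'(3)]
  have borel_M: "g \<in> borel_measurable ?M" if "g \<in> borel_measurable borel" for g :: "real \<Rightarrow> complex"
    using that by (intro measurable_restrict_space1 measurable_completion) simp
  have \<phi>_loc: "\<phi> n \<in> H1_loc L" for n
    unfolding \<phi>_def using cutoff_H1_c(1)[OF L ab(1-3)] by (rule H1_c_subset)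
  have [measurable]: "\<phi> n \<in> borel_measurable ?M" for n
    by (rule borel_M[OF H1_loc_borel_measurable[OF \<phi>_loc]])
  have [measurable]: "v \<in> borel_measurable ?M"
    by (rule borel_M[OF H1_loc_borel_measurable[OF v'(1)]])
  have [measurable]: "\<phi>' n \<in> borel_measurable ?M" for n
    unfolding \<phi>'_def by (rule borel_M) measurable
  have v_bound: "(cmod (v x))\<^sup>2 \<le> 2 * (b n - a n) * N" if "a n \<le> x" "x \<le> b n" for x n
  proof -
    have x: "x \<in> Ico L" using Ico_downward[OF ab(3)] that ab(1)[of n] by force
    have "N \<ge> 0" unfolding N_def by (rule integral_nonneg_AE) simp
    show ?thesis
    proof (cases "L = \<infinity>")
      case True
      have "(cmod (v x))\<^sup>2 \<le> x * N" unfolding N_def by (rule H_prime_star_bound[OF v x])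
      also have "\<dots> \<le> 2 * (b n - a n) * N"
        using that ab(5)[OF True, of n] \<open>N \<ge> 0\<close> by (intro mult_right_mono) auto
      finally show ?thesis .
    next
      case False
      then have fin: "L < \<infinity>" by (simp add: less_top[symmetric])
      have "(cmod (v x))\<^sup>2 \<le> (real_of_ereal L - x) * N"
        unfolding N_def by (rule H_prime_star_bound_right[OF v x fin])
      also have "\<dots> \<le> 2 * (b n - a n) * N"
        using that ab(6)[OF fin, of n] \<open>N \<ge> 0\<close> by (intro mult_right_mono) auto
      finally show ?thesis .
    qed
  qed
  have v\<phi>'_bound: "(cmod (v x * \<phi>' n x))\<^sup>2 \<le> indicator {a n..b n} x * (2 * N / (b n - a n))" for x n
  proof (cases "a n \<le> x \<and> x \<le> b n")
    case True
    have "(cmod (v x * \<phi>' n x))\<^sup>2 = (cmod (v x))\<^sup>2 / (b n - a n)\<^sup>2"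
      using True by (simp add: \<phi>'_def norm_divide power_divide norm_mult power_mult_distrib flip: of_real_diff)
    also have "\<dots> \<le> 2 * (b n - a n) * N / (b n - a n)\<^sup>2"
      using v_bound True by (intro divide_right_mono) auto
    also have "\<dots> = 2 * N / (b n - a n)"
    proof -
      have *: "2 * d * N / d\<^sup>2 = 2 * N / d" if "d \<noteq> 0" for d
        using that by (simp add: power2_eq_square)
      show ?thesis by (rule *) (use ab(2)[of n] in simp)
    qed
    finally show ?thesis using True by simp
  qed (auto simp: \<phi>'_def)
  have ind_int: "integrable ?M (\<lambda>x. indicator {a n..b n} x * c)"
    "(LINT x|?M. indicator {a n..b n} x * c) = (b n - a n) * c" for n and c :: real
  proof -
    have "{a n..b n} \<subseteq> Ico L" using Icc_subset_Ico[OF ab(3)[of n]] ab(1)[of n] by auto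
    then have "{a n..b n} \<inter> Ico L = {a n..b n}" by blast
    moreover have "{a n..b n} \<in> sets ?M"
      using \<open>{a n..b n} \<subseteq> Ico L\<close> by (simp add: sets_restrict_space_iff)
    moreover have "emeasure ?M {a n..b n} = ennreal (b n - a n)"
      using \<open>{a n..b n} \<subseteq> Ico L\<close> ab(2)[of n] by (subst emeasure_restrict_space) auto
    ultimately show "integrable ?M (\<lambda>x. indicator {a n..b n} x * c)"
      "(LINT x|?M. indicator {a n..b n} x * c) = (b n - a n) * c"
      using ab(2)[of n] by (auto simp: measure_def)
  qed
  have v\<phi>': "(\<lambda>x. v x * \<phi>' n x) \<in> sq_int ?M" "(LINT x|?M. (cmod (v x * \<phi>' n x))\<^sup>2) \<le> 2 * N" for n
  proof -
    have "integrable ?M (\<lambda>x. (cmod (v x * \<phi>' n x))\<^sup>2)"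
      by (rule Bochner_Integration.integrable_bound[OF ind_int(1)[of n "2 * N / (b n - a n)"]])
         (measurable, rule AE_I2, use order_trans[OF v\<phi>'_bound abs_ge_self] in \<open>simp only: real_norm_def abs_power2\<close>)
    then show "(\<lambda>x. v x * \<phi>' n x) \<in> sq_int ?M" by (simp add: sq_int_def)
    have "(LINT x|?M. (cmod (v x * \<phi>' n x))\<^sup>2) \<le> (LINT x|?M. indicator {a n..b n} x * (2 * N / (b n - a n)))"
      using ind_int(1) \<open>integrable ?M (\<lambda>x. (cmod (v x * \<phi>' n x))\<^sup>2)\<close> v\<phi>'_bound
      by (intro integral_mono) auto
    then show "(LINT x|?M. (cmod (v x * \<phi>' n x))\<^sup>2) \<le> 2 * N"
      using ab(2)[of n] unfolding ind_int(2) by simp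
  qed
  have fD: "integrable ?M (\<lambda>x. f x * D1 v x)" by (rule integrable_mult_sq_int[OF f v'(3)])
  have lim1: "(\<lambda>n. LINT x|?M. \<phi> n x * (f x * D1 v x)) \<longlonglongrightarrow> (LINT x|?M. f x * D1 v x)"
    unfolding \<phi>_def
    by (rule cutoff_seq_integral_tendsto[of a b L, OF ab(2,4) _ _ fD]) (auto simp flip: \<phi>_def)
  have lim2: "(\<lambda>n. LINT x|?M. f x * (v x * \<phi>' n x)) \<longlonglongrightarrow> 0"
  proof -
    have f2: "integrable ?M (\<lambda>x. (cmod (f x))\<^sup>2)" by (rule sq_intD(2)[OF f])
    define t where "t n = (LINT x|?M. indicator {a n<..} x * (cmod (f x))\<^sup>2)" for n
    \<comment> \<open>The factor \<open>v x * \<phi>' n x\<close> is merely bounded in square mean,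
      by \<open>2 * N\<close>. Smallness comes from \<open>f\<close>, since only its restriction to
      the tail beyond \<open>a n\<close> meets the support of \<open>\<phi>' n\<close>; the single
      point \<open>a n\<close> is a null set.\<close>
    have "(cmod (LINT x|?M. f x * (v x * \<phi>' n x)))\<^sup>2 \<le> t n * (2 * N)" for n
    proof -
      have "(\<lambda>x. complex_of_real (indicator {a n<..} x)) \<in> borel_measurable ?M" by (rule borel_M) measurable
      then have 1: "(\<lambda>x. of_real (indicator {a n<..} x) * f x) \<in> sq_int ?M"
        by (rule sq_int_bounded_mult[OF f, where B = 1]) (auto simp: indicator_def)
      have "(LINT x|?M. f x * (v x * \<phi>' n x)) = (LINT x|?M. (of_real (indicator {a n<..} x) * f x) * (v x * \<phi>' n x))"
      proof (rule integral_cong_AE)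
        show "(\<lambda>x. f x * (v x * \<phi>' n x)) \<in> borel_measurable ?M" by measurable
        show "(\<lambda>x. (of_real (indicator {a n<..} x) * f x) * (v x * \<phi>' n x)) \<in> borel_measurable ?M"
          using sq_intD(1)[OF 1] by measurable
        have "AE x in lebesgue. x \<notin> {a n}" by (rule AE_not_in) (simp flip: negligible_iff_null_sets)
        then have "AE x in ?M. x \<noteq> a n" by (auto simp: AE_restrict_space_iff elim!: eventually_mono)
        then show "AE x in ?M. f x * (v x * \<phi>' n x) = (of_real (indicator {a n<..} x) * f x) * (v x * \<phi>' n x)"
          by eventually_elim (auto simp: \<phi>'_def indicator_def)
      qed
      then have "(cmod (LINT x|?M. f x * (v x * \<phi>' n x)))\<^sup>2
          \<le> (LINT x|?M. (cmod (of_real (indicator {a n<..} x) * f x))\<^sup>2) * (LINT x|?M. (cmod (v x * \<phi>' n x))\<^sup>2)"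
        using Cauchy_Schwarz_sq_int[OF 1 v\<phi>'(1)] by simp
      also have "(LINT x|?M. (cmod (of_real (indicator {a n<..} x) * f x))\<^sup>2) = t n"
        unfolding t_def by (intro Bochner_Integration.integral_cong) (auto simp: indicator_def)
      also have "t n * (LINT x|?M. (cmod (v x * \<phi>' n x))\<^sup>2) \<le> t n * (2 * N)"
        unfolding t_def by (intro mult_left_mono v\<phi>'(2) integral_nonneg_AE) auto
      finally show ?thesis .
    qed
    moreover have "(\<lambda>n. t n * (2 * N)) \<longlonglongrightarrow> 0"
      using tendsto_mult_left_zero[OF tail_integral_tendsto_0[OF ab(4) f2]] by (simp add: t_def)
    ultimately have "(\<lambda>n. (cmod (LINT x|?M. f x * (v x * \<phi>' n x)))\<^sup>2) \<longlonglongrightarrow> 0"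
      by (rule_tac tendsto_sandwich[OF _ _ tendsto_const]) auto
    then have "(\<lambda>n. sqrt ((cmod (LINT x|?M. f x * (v x * \<phi>' n x)))\<^sup>2)) \<longlonglongrightarrow> sqrt 0"
      by (rule tendsto_real_sqrt)
    then show ?thesis by (simp add: tendsto_norm_zero_iff)
  qed
  have "(LINT x|?M. f x * D1 (\<lambda>x. v x * \<phi> n x) x) =
      (LINT x|?M. \<phi> n x * (f x * D1 v x)) + (LINT x|?M. f x * (v x * \<phi>' n x))" for n
  proof -
    have "AE x in ?M. D1 (\<lambda>x. v x * \<phi> n x) x = v x * \<phi>' n x + \<phi> n x * D1 v x"
      using H1_loc_mult(2)[OF L v'(1) \<phi>_loc[of n]] cutoff_H1_c(2)[OF L ab(1-3)[of n]]
      by eventually_elim (simp add: \<phi>_def \<phi>'_def)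
    then have eq: "AE x in ?M. f x * D1 (\<lambda>x. v x * \<phi> n x) x = \<phi> n x * (f x * D1 v x) + f x * (v x * \<phi>' n x)"
      by eventually_elim (simp add: algebra_simps)
    have int1: "integrable ?M (\<lambda>x. \<phi> n x * (f x * D1 v x))"
      using fD by (rule Bochner_Integration.integrable_bound)
        (use cutoff_eq(3)[OF ab(2)] in \<open>auto simp: \<phi>_def[symmetric] norm_mult[of "\<phi> n _"] intro!: AE_I2 mult_left_le_one_le\<close>)
    have int2: "integrable ?M (\<lambda>x. f x * (v x * \<phi>' n x))"
      by (rule integrable_mult_sq_int[OF f v\<phi>'(1)])
    have meas: "(\<lambda>x. f x * D1 (\<lambda>x. v x * \<phi> n x) x) \<in> borel_measurable ?M"
      by (rule borel_measurable_cong_AE_lebesgue_on[of _ "\<lambda>x. \<phi> n x * (f x * D1 v x) + f x * (v x * \<phi>' n x)"])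
         (use eq in \<open>auto simp: eq_commute\<close>)
    have "(LINT x|?M. f x * D1 (\<lambda>x. v x * \<phi> n x) x) = (LINT x|?M. \<phi> n x * (f x * D1 v x) + f x * (v x * \<phi>' n x))"
      by (rule integral_cong_AE[OF meas _ eq]) measurable
    then show ?thesis using int1 int2 by simp
  qed
  then show ?thesis
    using tendsto_add[OF lim1 lim2] by (simp add: \<phi>_def)
qed

section \<open>Solutions with compactly supported right-hand sides\<close>

text \<open>Integration by parts by means of Fubini: \<open>h t - h 0\<close> is the integral of the
  derivative over \<open>[0, t]\<close>, and exchanging the integrals leaves the tail integral
  \<open>R x\<close> of \<open>k\<close>. The tail over \<open>{x..}\<close> is closed on the left,
  so atoms of the measure are counted. The measure is kept general because the formula is applied to
  \<upsilon> and to Lebesgue measure.\<close>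

lemma integral_mult_indefinite_integral:
  fixes M :: "real measure" and k :: "real \<Rightarrow> complex"
  assumes M: "sigma_finite_measure M" "(\<lambda>t. t) \<in> borel_measurable M"
    and k: "integrable M k" "\<forall>t\<in>space M. k t \<noteq> 0 \<longrightarrow> t \<in> {0..b}"
    and h: "abs_cont_on 0 b h" and b: "0 \<le> b"
  defines "R \<equiv> (\<lambda>x. LINT t|M. k t * of_real (indicator {x..} t))"
  shows "R \<in> borel_measurable borel" "\<And>x. cmod (R x) \<le> (LINT t|M. cmod (k t))" "\<And>x. b < x \<Longrightarrow> R x = 0"
    and "(LINT t|M. k t * h t) = h 0 * (LINT t|M. k t) + (LINT x|lebesgue_on {0..b}. R x * D1 h x)"
proof -
  interpret M: sigma_finite_measure M by (rule M(1))
  interpret P: pair_sigma_finite M lborel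
    by (intro pair_sigma_finite.intro M.sigma_finite_measure_axioms sigma_finite_lborel)
  note [measurable] = M(2)
  have [measurable]: "k \<in> borel_measurable M" using k(1) by auto
  have ind_meas: "(\<lambda>z. indicator {snd z..} (fst z) :: real) \<in> borel_measurable (M \<Otimes>\<^sub>M lborel)"
  proof -
    have "(\<lambda>z. if snd z \<le> fst z then 1 else 0 :: real) \<in> borel_measurable (M \<Otimes>\<^sub>M lborel)"
      using measurable_compose[OF measurable_fst M(2), of lborel] by measurable
    then show ?thesis by (simp add: indicator_def of_bool_def)
  qed
  have "(\<lambda>z. k (fst z) * of_real (indicator {snd z..} (fst z))) \<in> borel_measurable (M \<Otimes>\<^sub>M lborel)"
    using ind_meas by measurable
  then have "(\<lambda>z. k (snd z) * of_real (indicator {fst z..} (snd z))) \<in> borel_measurable (lborel \<Otimes>\<^sub>M M)"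
    by (subst measurable_pair_swap_iff) (simp add: case_prod_unfold)
  then have "(\<lambda>x. LINT t|M. k t * of_real (indicator {x..} t)) \<in> borel_measurable lborel"
    by (intro M.borel_measurable_lebesgue_integral) (simp add: case_prod_unfold)
  then show "R \<in> borel_measurable borel" by (simp add: R_def)
  show "cmod (R x) \<le> (LINT t|M. cmod (k t))" for x
  proof -
    have "cmod (R x) \<le> (LINT t|M. cmod (k t * of_real (indicator {x..} t)))"
      unfolding R_def by (rule integral_norm_bound)
    also have "\<dots> \<le> (LINT t|M. cmod (k t))"
      using k(1) by (intro integral_mono') (auto simp: norm_mult indicator_def)
    finally show ?thesis .
  qed
  show "R x = 0" if "b < x" for x
  proof -
    have "R x = (LINT t|M. 0)"
      unfolding R_def using k(2) that
      by (intro Bochner_Integration.integral_cong) (fastforce simp: indicator_def)+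
    then show ?thesis by simp
  qed
  obtain w where w: "integrable lborel w"
      "AE x in lebesgue_on {0..b}. (h has_vector_derivative w x) (at x)"
      "\<And>x. x \<in> {0..b} \<Longrightarrow> h x = h 0 + (LINT t:{0..x}|lborel. w t)"
    using abs_cont_on_borel_derivative[OF h b] by blast
  define w' where "w' x = indicator {0..b} x *\<^sub>R w x" for x
  have w'_int: "integrable lborel w'"
    unfolding w'_def using w(1) by (intro integrable_mult_indicator) auto
  have [measurable]: "w' \<in> borel_measurable lborel" using w'_int by auto
  \<comment> \<open>The joint integrand is dominated by the product \<open>k t * w' x\<close>, which
    is integrable on the product space. The Borel version \<open>w'\<close> takes the place of
    \<open>D1 h\<close> until the inner integrals have been evaluated.\<close>
  define F where "F = (\<lambda>(t, x). k t * of_real (indicator {x..} t) * w' x)"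
  have F_int: "integrable (M \<Otimes>\<^sub>M lborel) F"
  proof (rule Bochner_Integration.integrable_bound)
    show "integrable (M \<Otimes>\<^sub>M lborel) (\<lambda>(t, x). k t * w' x)"
    proof (rule P.Fubini_integrable)
      show "(\<lambda>(t, x). k t * w' x) \<in> borel_measurable (M \<Otimes>\<^sub>M lborel)" by measurable
      show "integrable M (\<lambda>t. LINT x|lborel. norm (case (t, x) of (t, x) \<Rightarrow> k t * w' x))"
        using k(1) by (simp add: norm_mult)
      show "AE t in M. integrable lborel (\<lambda>x. case (t, x) of (t, x) \<Rightarrow> k t * w' x)"
        using w'_int by simp
    qed
    show "F \<in> borel_measurable (M \<Otimes>\<^sub>M lborel)"
      unfolding F_def case_prod_unfold using ind_meas by measurable
    show "AE z in M \<Otimes>\<^sub>M lborel. norm (F z) \<le> norm (case z of (t, x) \<Rightarrow> k t * w' x)"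
      by (intro AE_I2) (auto simp: F_def norm_mult indicator_def split: prod.splits)
  qed
  have inner1: "(LINT x|lborel. F (t, x)) = k t * (h t - h 0)" if "t \<in> space M" for t
  proof (cases "k t = 0")
    case False
    then have t: "t \<in> {0..b}" using k(2) that by blast
    have "of_real (indicator {x..} t) * w' x = indicator {0..t} x *\<^sub>R w x" for x
      using t by (auto simp: w'_def indicator_def)
    then have "(LINT x|lborel. F (t, x)) = (LINT x|lborel. k t * (indicator {0..t} x *\<^sub>R w x))"
      by (simp add: F_def mult.assoc)
    also have "\<dots> = k t * (LINT x:{0..t}|lborel. w x)"
      unfolding set_lebesgue_integral_def by (rule Bochner_Integration.integral_mult_right_zero)
    finally show ?thesis using w(3)[OF t] by simp
  qed (simp add: F_def)
  have inner2: "(LINT t|M. F (t, x)) = R x * w' x" for x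
    by (simp add: F_def R_def)
  have F_eq: "(LINT t|M. k t * (h t - h 0)) = (LINT x|lborel. R x * w' x)"
  proof -
    have "(LINT t|M. k t * (h t - h 0)) = (LINT t|M. LINT x|lborel. F (t, x))"
      by (intro Bochner_Integration.integral_cong) (simp_all add: inner1)
    also have "\<dots> = (LINT x|lborel. LINT t|M. F (t, x))"
      using P.Fubini_integral[of "\<lambda>t x. F (t, x)"] F_int by simp
    finally show ?thesis by (simp add: inner2)
  qed
  have kh_int: "integrable M (\<lambda>t. k t * (h t - h 0))"
  proof -
    have "integrable M (\<lambda>t. LINT x|lborel. F (t, x))" by (rule P.integrable_fst'[OF F_int])
    then show ?thesis
      by (rule Bochner_Integration.integrable_cong[THEN iffD1, rotated 2]) (simp_all add: inner1)
  qed
  have "(LINT t|M. k t * h t) = (LINT t|M. k t * (h t - h 0) + k t * h 0)"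
    by (simp add: algebra_simps)
  also have "\<dots> = (LINT t|M. k t * (h t - h 0)) + (LINT t|M. k t * h 0)"
    using kh_int k(1) by (intro Bochner_Integration.integral_add) auto
  also have "\<dots> = (LINT x|lborel. R x * w' x) + (LINT t|M. k t) * h 0"
    using F_eq k(1) by simp
  also have "(LINT x|lborel. R x * w' x) = (LINT x|lebesgue_on {0..b}. R x * D1 h x)"
  proof -
    have [measurable]: "R \<in> borel_measurable borel" by fact
    have [measurable]: "w \<in> borel_measurable lborel" using w(1) by auto
    have "(LINT x|lborel. R x * w' x) = (LINT x|lebesgue. indicator {0..b} x *\<^sub>R (R x * w x))"
      by (subst integral_completion) (auto simp: w'_def intro!: Bochner_Integration.integral_cong)
    also have "\<dots> = (LINT x|lebesgue_on {0..b}. R x * w x)"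
      by (simp add: integral_restrict_space)
    also have "\<dots> = (LINT x|lebesgue_on {0..b}. R x * D1 h x)"
    proof (rule integral_cong_AE)
      show eq: "AE x in lebesgue_on {0..b}. R x * w x = R x * D1 h x"
        using w(2) by eventually_elim (simp add: vector_derivative_at)
      show meas: "(\<lambda>x. R x * w x) \<in> borel_measurable (lebesgue_on {0..b})"
      proof -
        have "R \<in> borel_measurable lborel" "w \<in> borel_measurable lborel"
          using \<open>R \<in> borel_measurable borel\<close> w(1) by auto
        then have "(\<lambda>x. R x * w x) \<in> borel_measurable lborel" by (rule borel_measurable_times)
        from measurable_restrict_space1[OF measurable_completion[OF this]] show ?thesis .
      qed
      show "(\<lambda>x. R x * D1 h x) \<in> borel_measurable (lebesgue_on {0..b})"
        by (rule borel_measurable_cong_AE_lebesgue_on[OF _ meas eq]) simp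
    qed
    finally show ?thesis .
  qed
  finally show "(LINT t|M. k t * h t) = h 0 * (LINT t|M. k t) + (LINT x|lebesgue_on {0..b}. R x * D1 h x)"
    by simp
qed

lemma sq_int_bounded_finite_measure:
  assumes "finite_measure M" "f \<in> borel_measurable M" "\<And>x. x \<in> space M \<Longrightarrow> cmod (f x) \<le> B"
  shows "f \<in> sq_int M"
proof -
  have "(\<lambda>x. 1) \<in> sq_int M"
    using assms(1) by (simp add: sq_int_def finite_measure.integrable_const)
  then have "(\<lambda>x. f x * 1) \<in> sq_int M" using assms(2,3) by (rule sq_int_bounded_mult)
  then show ?thesis by simp
qed

lemma finite_measure_lebesgue_on_Ico:
  assumes "L < \<infinity>"
  shows "finite_measure (lebesgue_on (Ico L))"
proof (rule finite_measure_lebesgue_on)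
  have "Ico L \<subseteq> {0..real_of_ereal L}" using assms by (cases L) (auto simp: Ico_def)
  then show "Ico L \<in> lmeasurable"
    by (rule fmeasurableI2[rotated]) auto
qed

lemma H1_c_integral_D1:
  assumes L: "0 < L" and h: "h \<in> H1_c L"
  shows "(LINT x|lebesgue_on (Ico L). D1 h x) = - h 0"
proof -
  obtain b where b: "h \<in> H1_loc L" "b \<in> Ico L" "\<And>x. b < x \<Longrightarrow> h x = 0" using H1_cD[OF L h] by blast
  obtain c where c: "b < c" "c \<in> Ico L" using Ico_greater[OF b(2)] .
  have "(LINT x|lebesgue_on (Ico L). D1 h x) = (LINT x|lebesgue_on {0..c}. D1 h x)"
    using Icc_subset_Ico[OF c(2)] c(1) D1_eq_0_beyond[of b h, OF b(3)]
    by (intro integral_lebesgue_on_shrink) (auto simp: Ico_def not_le)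
  then show ?thesis using H1_loc_FTC[OF b(1) c(2)] b(3)[OF c(1)] by (simp add: eq_neg_iff_add_eq_0 add.commute)
qed

text \<open>The cutoff argument with the constant function 1, which is square integrable only for finite \<open>L\<close>.\<close>

lemma H_prime_star_integral_D1:
  assumes L: "0 < L" "L < \<infinity>" and h: "h \<in> H_prime_star L"
  shows "(LINT x|lebesgue_on (Ico L). D1 h x) = 0"
proof -
  obtain a b :: "nat \<Rightarrow> real" where ab: "\<And>n. 0 < a n" "\<And>n. a n < b n" "\<And>n. b n \<in> Ico L"
    "\<And>x. x \<in> Ico L \<Longrightarrow> \<exists>N. \<forall>n\<ge>N. x \<le> a n"
    "\<And>n. L = \<infinity> \<Longrightarrow> b n \<le> 2 * (b n - a n)"
    "\<And>n. L < \<infinity> \<Longrightarrow> real_of_ereal L - a n \<le> 2 * (b n - a n)"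
    using Ico_exhaust[OF L(1)] by metis
  have one: "(\<lambda>x. 1) \<in> sq_int (lebesgue_on (Ico L))"
    by (rule sq_int_bounded_finite_measure[OF finite_measure_lebesgue_on_Ico[OF L(2)], where B = 1]) auto
  note lim = cutoff_seq_form_tendsto[OF L(1) ab one h]
  have "(LINT x|lebesgue_on (Ico L). 1 * D1 (\<lambda>x. h x * cutoff (a n) (b n) x) x) = 0" for n
    using H1_c_integral_D1[OF L(1) H1_c_mult[OF L(1) H_prime_starD(1)[OF h] cutoff_H1_c(1)[OF L(1) ab(1-3)]], of n]
      H_prime_starD(2)[OF h] by simp
  with lim have "(\<lambda>n. 0) \<longlonglongrightarrow> (LINT x|lebesgue_on (Ico L). D1 h x)" by simp
  then show ?thesis by (simp add: LIMSEQ_const_iff)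
qed

locale krein_string =
  fixes L :: ereal and q :: "real \<Rightarrow> complex" and \<upsilon> :: "real measure"
  assumes L: "0 < L" and q: "q \<in> L2_loc L" and \<upsilon>: "borel_measure_on L \<upsilon>"
begin

lemma sets_\<upsilon>: "sets \<upsilon> = sets (restrict_space borel (Ico L))"
  using \<upsilon> by (simp add: borel_measure_on_def)

lemma space_\<upsilon>: "space \<upsilon> = Ico L"
  using sets_eq_imp_space_eq[OF sets_\<upsilon>] by (simp add: space_restrict_space)

lemma emeasure_\<upsilon>_Icc: "c \<in> Ico L \<Longrightarrow> emeasure \<upsilon> {0..c} < \<infinity>"
  using \<upsilon> Icc_subset_Ico by (auto simp: borel_measure_on_def)

lemma Icc_sets_\<upsilon>: "c \<in> Ico L \<Longrightarrow> {0..c} \<in> sets \<upsilon>"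
  using Icc_subset_Ico by (auto simp: sets_\<upsilon> sets_restrict_space_iff)

lemma borel_measurable_\<upsilon>: "f \<in> borel_measurable borel \<Longrightarrow> f \<in> borel_measurable \<upsilon>"
  unfolding measurable_cong_sets[OF sets_\<upsilon> refl] by (rule measurable_restrict_space1)

lemma sigma_finite_\<upsilon>: "sigma_finite_measure \<upsilon>"
proof -
  obtain a b :: "nat \<Rightarrow> real" where ab: "\<And>n. 0 < a n" "\<And>n. a n < b n" "\<And>n. b n \<in> Ico L"
    "\<And>x. x \<in> Ico L \<Longrightarrow> \<exists>N. \<forall>n\<ge>N. x \<le> a n"
    using Ico_exhaust[OF L] by metis
  show ?thesis
  proof
    show "\<exists>A. countable A \<and> A \<subseteq> sets \<upsilon> \<and> \<Union> A = space \<upsilon> \<and> (\<forall>a\<in>A. emeasure \<upsilon> a \<noteq> \<infinity>)"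
    proof (intro exI[of _ "range (\<lambda>n. {0..b n})"] conjI ballI)
      show "\<Union> (range (\<lambda>n. {0..b n})) = space \<upsilon>"
      proof (intro equalityI subsetI)
        fix x assume "x \<in> space \<upsilon>"
        then have x: "x \<in> Ico L" by (simp add: space_\<upsilon>)
        then obtain N where "x \<le> a N" using ab(4) by blast
        with x ab(2)[of N] have "x \<in> {0..b N}" by (simp add: Ico_def)
        then show "x \<in> \<Union> (range (\<lambda>n. {0..b n}))" by blast
      next
        fix x assume "x \<in> \<Union> (range (\<lambda>n. {0..b n}))"
        then show "x \<in> space \<upsilon>" using Icc_subset_Ico[OF ab(3)] by (auto simp: space_\<upsilon> simp del: atLeastAtMost_iff)
      qed
    qed (use ab(3) Icc_sets_\<upsilon> emeasure_\<upsilon>_Icc in \<open>auto simp: less_top\<close>)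
  qed
qed

lemma sq_int_\<upsilon>_compact:
  assumes "f \<in> borel_measurable borel" "c \<in> Ico L"
    "\<And>x. x \<in> {0..c} \<Longrightarrow> cmod (f x) \<le> B" "\<And>x. c < x \<Longrightarrow> f x = 0"
  shows "f \<in> sq_int \<upsilon>"
proof -
  have ind: "integrable \<upsilon> (indicat_real {0..c})"
    using Icc_sets_\<upsilon>[OF assms(2)] emeasure_\<upsilon>_Icc[OF assms(2)] by simp
  have [measurable]: "f \<in> borel_measurable \<upsilon>" by (rule borel_measurable_\<upsilon>[OF assms(1)])
  have "integrable \<upsilon> (\<lambda>x. (cmod (f x))\<^sup>2)"
  proof (rule Bochner_Integration.integrable_bound)
    show "integrable \<upsilon> (\<lambda>x. B\<^sup>2 * indicat_real {0..c} x)" using ind by simp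
    show "AE x in \<upsilon>. norm ((cmod (f x))\<^sup>2) \<le> norm (B\<^sup>2 * indicat_real {0..c} x)"
    proof (rule AE_I2)
      fix x assume "x \<in> space \<upsilon>"
      then have "0 \<le> x" by (simp add: space_\<upsilon> Ico_def)
      then show "norm ((cmod (f x))\<^sup>2) \<le> norm (B\<^sup>2 * indicat_real {0..c} x)"
        using assms(3)[of x] assms(4)[of x] by (cases "x \<le> c") (auto intro: power_mono)
    qed
  qed measurable
  then show ?thesis by (simp add: sq_int_def)
qed

lemma H1_c_sq_int_\<upsilon>:
  assumes "h \<in> H1_c L"
  shows "h \<in> sq_int \<upsilon>"
proof -
  obtain b where b: "h \<in> H1_loc L" "b \<in> Ico L" "\<And>x. b < x \<Longrightarrow> h x = 0" using H1_cD[OF L assms] by blast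
  obtain B where "\<And>x. x \<in> {0..b} \<Longrightarrow> cmod (h x) \<le> B" using H1_loc_bounded[OF b(1,2)] by blast
  then show ?thesis using b(3) by (rule sq_int_\<upsilon>_compact[OF H1_loc_borel_measurable[OF b(1)] b(2)])
qed

lemma integrable_\<upsilon>_compact:
  assumes f: "f \<in> sq_int \<upsilon>" and "c \<in> Ico L" "\<And>x. c < x \<Longrightarrow> f x = 0"
  shows "integrable \<upsilon> f"
proof -
  have "(\<lambda>x. if x \<in> {0..c} then 1 else 0) \<in> sq_int \<upsilon>"
    by (rule sq_int_\<upsilon>_compact[OF _ assms(2), where B = 1]) auto
  from integrable_mult_sq_int[OF this f]
  show ?thesis
    by (rule Bochner_Integration.integrable_cong[THEN iffD1, rotated 2])
       (use assms(3) in \<open>auto simp: space_\<upsilon> Ico_def not_le\<close>)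
qed

text \<open>For compactly supported right-hand sides, the equation \<open>-u'' = \<omega> v\<^sub>1 + \<upsilon> v\<^sub>2\<close> is solved by
  integrating twice: \<open>u' = R\<^sub>\<upsilon> - R\<^sub>q - q v\<^sub>1 + c\<close>, where \<open>R\<^sub>\<upsilon> x\<close> is the integral of \<open>v\<^sub>2\<close> over \<open>[x, L)\<close>
  with respect to \<open>\<upsilon>\<close>, \<open>R\<^sub>q x\<close> is the one of \<open>q v\<^sub>1'\<close> with respect to Lebesgue measure, and \<open>c\<close> makes \<open>u\<close>
  vanish at a finite right endpoint.\<close>

lemma solution_compact_support:
  assumes v1: "v1 \<in> H1_loc L" "\<And>x. b < x \<Longrightarrow> v1 x = 0" and b: "b \<in> Ico L"
    and v2: "v2 \<in> sq_int \<upsilon>" "\<And>x. b < x \<Longrightarrow> v2 x = 0"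
  obtains u \<Delta> where "u \<in> H_prime_star L"
    "\<And>h. h \<in> H1_c L \<or> h \<in> H_prime_star L \<Longrightarrow>
      \<Delta> * h 0 + (LINT x|lebesgue_on (Ico L). D1 u x * D1 h x) =
      - (LINT x|lebesgue_on (Ico L). q x * D1 (\<lambda>x. v1 x * h x) x) + (LINT x|\<upsilon>. v2 x * h x)"
proof -
  let ?M = "lebesgue_on (Ico L)" and ?B = "lebesgue_on {0..b}"
  have b0: "0 \<le> b" using b by (simp add: Ico_def)
  note sub = Icc_subset_Ico[OF b]
  have v2_int: "integrable \<upsilon> v2" by (rule integrable_\<upsilon>_compact[OF v2(1) b v2(2)])
  have id_\<upsilon>: "(\<lambda>t. t) \<in> borel_measurable \<upsilon>"
    unfolding measurable_cong_sets[OF sets_\<upsilon> refl] by (rule measurable_restrict_space1) simp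
  have v2_supp: "\<forall>t\<in>space \<upsilon>. v2 t \<noteq> 0 \<longrightarrow> t \<in> {0..b}"
    using v2(2) by (force simp: space_\<upsilon> Ico_def not_le)
  have D1v1: "D1 v1 \<in> sq_int ?B" by (rule L2_locD[OF H1_locD(3)[OF v1(1)] b])
  have q_B: "q \<in> sq_int ?B" by (rule L2_locD[OF q b])
  have qv': "integrable ?B (\<lambda>x. q x * D1 v1 x)" by (rule integrable_mult_sq_int[OF q_B D1v1])
  have qv: "(\<lambda>x. q x * v1 x) \<in> sq_int ?B"
    using L2_locD[OF H1_loc_mult_L2_loc[OF v1(1) q] b] by (simp add: mult.commute)
  have fin_B: "finite_measure ?B" by (simp add: finite_measure_lebesgue_on)
  have id_B: "(\<lambda>t. t) \<in> borel_measurable ?B"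
    by (intro measurable_restrict_space1 measurable_completion) simp
  define R1 where "R1 x = (LINT t|\<upsilon>. v2 t * of_real (indicator {x..} t))" for x
  define R2 where "R2 x = (LINT t|?B. (q t * D1 v1 t) * of_real (indicator {x..} t))" for x
  have B_supp: "\<forall>t\<in>space ?B. q t * D1 v1 t \<noteq> 0 \<longrightarrow> t \<in> {0..b}" by simp
  have sf_B: "sigma_finite_measure ?B"
    using fin_B by (simp add: finite_measure_def)
  \<comment> \<open>The same integration by parts serves \<open>v2\<close> with \<upsilon> and
    \<open>q * D1 v1\<close> with Lebesgue measure. The premise about \<open>h\<close> stays open:
    it is filled with \<open>v1\<close> for the facts about the tails alone, and later with the
    actual test function.\<close>
  note parts1 = integral_mult_indefinite_integral[OF sigma_finite_\<upsilon> id_\<upsilon> v2_int v2_supp _ b0, folded R1_def]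
  note parts2 = integral_mult_indefinite_integral[OF sf_B id_B qv' B_supp _ b0, folded R2_def]
  have v1_ac: "abs_cont_on 0 b v1" by (rule H1_locD(2)[OF v1(1) b])
  have R_meas: "f \<in> borel_measurable borel \<Longrightarrow> f \<in> borel_measurable ?B" for f :: "real \<Rightarrow> complex"
    by (intro measurable_restrict_space1 measurable_completion) simp
  have R1_sq: "R1 \<in> sq_int ?B"
    by (rule sq_int_bounded_finite_measure[OF fin_B R_meas[OF parts1(1)[OF v1_ac]] parts1(2)[OF v1_ac]])
  have R2_sq: "R2 \<in> sq_int ?B"
    by (rule sq_int_bounded_finite_measure[OF fin_B R_meas[OF parts2(1)[OF v1_ac]] parts2(2)[OF v1_ac]])
  define w0 where "w0 x = R1 x - R2 x - q x * v1 x" for x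
  have w0: "w0 \<in> sq_int ?B"
    using sq_int_add[OF sq_int_add[OF R1_sq sq_int_cmult[OF R2_sq, of "-1"]] sq_int_cmult[OF qv, of "-1"]]
    by (simp add: w0_def[abs_def])
  \<comment> \<open>Beyond \<open>b\<close>, the solution is the integral of \<open>w0\<close> plus
    \<open>c * x\<close>, so its limit at a finite \<open>L\<close> vanishes for exactly this
    \<open>c\<close>. On an infinite interval only the constant 0 is square integrable.\<close>
  define c where "c = (if L < \<infinity> then - (LINT x|?B. w0 x) / of_real (real_of_ereal L) else 0)"
  define w1 where "w1 x = (if x \<in> {0..b} then w0 x else 0)" for x
  have w1_B: "w1 \<in> sq_int ?B"
    by (rule sq_int_cong_AE_lebesgue_on[OF _ w0]) (auto simp: w1_def intro!: AE_I2)
  have w1: "w1 \<in> sq_int ?M"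
    by (rule sq_int_lebesgue_on_extend[OF w1_B sub]) (auto simp: w1_def)
  have const: "(\<lambda>x. c) \<in> sq_int ?M"
  proof (cases "L < \<infinity>")
    case True
    then show ?thesis
      by (intro sq_int_bounded_finite_measure[OF finite_measure_lebesgue_on_Ico, where B = "cmod c"]) auto
  next
    case False
    then show ?thesis by (simp add: c_def sq_int_def)
  qed
  define w where "w x = w1 x + c" for x
  have w: "w \<in> sq_int ?M" unfolding w_def by (rule sq_int_add[OF w1 const])
  define u where "u x = (if x \<in> Ico L then LINT t|lebesgue_on {0..x}. w t else 0)" for x
  have u_loc: "u \<in> H1_loc L" and D1u: "AE x in ?M. D1 u x = w x"
    by (rule H1_locI_integral[OF L _ L2_loc_of_sq_int[OF w], where c = 0]; simp add: u_def)+
  have u_lim: "(u \<longlongrightarrow> 0) (at_left (real_of_ereal L))" if fin: "L < \<infinity>"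
  proof -
    obtain l where l: "L = ereal l" using L fin by (cases L) auto
    have "b < l" using b by (simp add: Ico_def l)
    then have "l > 0" using b0 by simp
    have u_eq: "u x = (LINT t|?B. w0 t) + c * of_real x" if "b < x" "x < l" for x
    proof -
      have x: "x \<in> Ico L" using that b0 by (simp add: Ico_def l)
      have "integrable (lebesgue_on {0..x}) w1"
        using integrable_sq_int_Icc[OF sq_int_lebesgue_on_subset[OF w1 Icc_subset_Ico[OF x]]] by simp
      moreover have "integrable (lebesgue_on {0..x}) (\<lambda>t. c)"
        by (simp add: finite_measure.integrable_const finite_measure_lebesgue_on)
      ultimately have "u x = (LINT t|lebesgue_on {0..x}. w1 t) + (LINT t|lebesgue_on {0..x}. c)"
        using x by (simp add: u_def w_def[abs_def])
      also have "(LINT t|lebesgue_on {0..x}. c) = c * of_real x"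
        using that b0 by (simp add: measure_restrict_space scaleR_conv_of_real mult.commute)
      also have "(LINT t|lebesgue_on {0..x}. w1 t) = (LINT t|?B. w1 t)"
        using that by (intro integral_lebesgue_on_shrink) (auto simp: w1_def)
      also have "\<dots> = (LINT t|?B. w0 t)"
        by (intro Bochner_Integration.integral_cong) (auto simp: w1_def)
      finally show ?thesis .
    qed
    have "((\<lambda>x. (LINT t|?B. w0 t) + c * of_real x) \<longlongrightarrow> (LINT t|?B. w0 t) + c * of_real l) (at_left l)"
      by (intro tendsto_intros)
    moreover have "eventually (\<lambda>x. (LINT t|?B. w0 t) + c * of_real x = u x) (at_left l)"
      unfolding eventually_at_left_field
    proof (intro exI[of _ b] conjI allI impI \<open>b < l\<close>)
      show "(LINT t|?B. w0 t) + c * of_real x = u x" if "b < x" "x < l" for x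
        by (rule u_eq[OF that, symmetric])
    qed
    ultimately have "(u \<longlongrightarrow> (LINT t|?B. w0 t) + c * of_real l) (at_left l)"
      by (rule Lim_transform_eventually)
    moreover have "(LINT t|?B. w0 t) + c * of_real l = 0"
      using \<open>l > 0\<close> by (simp add: c_def l)
    ultimately have "(u \<longlongrightarrow> 0) (at_left l)" by (simp only:)
    then show ?thesis by (simp add: l)
  qed
  have u_star: "u \<in> H_prime_star L"
  proof -
    have "D1 u \<in> sq_int ?M"
      by (rule sq_int_cong_AE_lebesgue_on[OF _ w]) (use D1u in \<open>auto simp: eq_commute\<close>)
    moreover have "u 0 = 0"
    proof -
      have "AE t in lebesgue. t \<notin> {0 :: real}"
        by (rule AE_not_in) (simp flip: negligible_iff_null_sets)
      then have "AE t in lebesgue. indicator {0} t *\<^sub>R w t = 0" by eventually_elim simp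
      then have "(LINT t|lebesgue_on {0}. w t) = 0"
        by (simp add: integral_restrict_space integral_eq_zero_AE)
      then show ?thesis by (simp add: u_def)
    qed
    ultimately show ?thesis using u_loc u_lim by (simp add: H_prime_star_def H_prime_def)
  qed
  \<comment> \<open>This constant collects all coefficients of \<open>h 0\<close>: one from each of
    the two integrations by parts, and \<open>c\<close> from the integral of
    \<open>c * D1 h\<close>.\<close>
  define \<Delta> where "\<Delta> = (LINT t|\<upsilon>. v2 t) - (LINT t|?B. q t * D1 v1 t) + c"
  have "\<Delta> * h 0 + (LINT x|?M. D1 u x * D1 h x) =
      - (LINT x|?M. q x * D1 (\<lambda>x. v1 x * h x) x) + (LINT x|\<upsilon>. v2 x * h x)"
    if h_cases: "h \<in> H1_c L \<or> h \<in> H_prime_star L" for h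
  proof -
    have h: "h \<in> H1_loc L" and D1h: "D1 h \<in> sq_int ?M"
      using h_cases H1_c_subset H_prime_starD by blast+
    have D1h_B: "D1 h \<in> sq_int ?B" by (rule L2_locD[OF H1_locD(3)[OF h] b])
    have h_ac: "abs_cont_on 0 b h" by (rule H1_locD(2)[OF h b])
    \<comment> \<open>This step admits test functions without compact support. For finite
      \<open>L\<close> and \<open>h\<close> in \<open>H_prime_star L\<close>, both
      \<open>h 0\<close> and the integral of \<open>D1 h\<close> vanish; for infinite
      \<open>L\<close> the constant \<open>c\<close> is 0; for compact support the formula is the
      fundamental theorem of calculus.\<close>
    have c_D1h: "integrable ?M (\<lambda>x. c * D1 h x)" "(LINT x|?M. c * D1 h x) = - c * h 0"
    proof -
      show "integrable ?M (\<lambda>x. c * D1 h x)" by (rule integrable_mult_sq_int[OF const D1h])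
      show "(LINT x|?M. c * D1 h x) = - c * h 0"
      proof (cases "L < \<infinity>")
        case True
        have "(LINT x|?M. D1 h x) = - h 0"
          using h_cases H1_c_integral_D1[OF L] H_prime_star_integral_D1[OF L True] H_prime_starD(2) by fastforce
        then show ?thesis by simp
      qed (simp add: c_def)
    qed
    have w1h: "integrable ?M (\<lambda>x. w1 x * D1 h x)" by (rule integrable_mult_sq_int[OF w1 D1h])
    have "(LINT x|?M. D1 u x * D1 h x) = (LINT x|?M. w1 x * D1 h x + c * D1 h x)"
    proof (rule integral_cong_AE)
      note [measurable] = sq_intD(1)[OF H_prime_starD(3)[OF u_star]] sq_intD(1)[OF D1h] sq_intD(1)[OF w1]
      show "(\<lambda>x. D1 u x * D1 h x) \<in> borel_measurable ?M" by measurable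
      show "(\<lambda>x. w1 x * D1 h x + c * D1 h x) \<in> borel_measurable ?M" by measurable
      show "AE x in ?M. D1 u x * D1 h x = w1 x * D1 h x + c * D1 h x"
        using D1u by eventually_elim (simp add: w_def algebra_simps)
    qed
    also have "\<dots> = (LINT x|?M. w1 x * D1 h x) - c * h 0"
      using w1h c_D1h by simp
    also have "(LINT x|?M. w1 x * D1 h x) = (LINT x|?B. w1 x * D1 h x)"
      by (rule integral_lebesgue_on_shrink[OF sub]) (auto simp: w1_def)
    also have "\<dots> = (LINT x|?B. R1 x * D1 h x - R2 x * D1 h x - (q x * v1 x) * D1 h x)"
      by (intro Bochner_Integration.integral_cong) (auto simp: w1_def w0_def algebra_simps)
    also have "\<dots> = (LINT x|?B. R1 x * D1 h x) - (LINT x|?B. R2 x * D1 h x) - (LINT x|?B. (q x * v1 x) * D1 h x)"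
      using integrable_mult_sq_int[OF R1_sq D1h_B] integrable_mult_sq_int[OF R2_sq D1h_B]
        integrable_mult_sq_int[OF qv D1h_B] by simp
    finally have lhs: "(LINT x|?M. D1 u x * D1 h x) =
      (LINT x|?B. R1 x * D1 h x) - (LINT x|?B. R2 x * D1 h x) - (LINT x|?B. (q x * v1 x) * D1 h x) - c * h 0" .
    have rhs: "(LINT x|?M. q x * D1 (\<lambda>x. v1 x * h x) x) =
      (LINT x|?B. (q x * v1 x) * D1 h x) + (LINT x|?B. (q x * D1 v1 x) * h x)"
    proof -
      have "(LINT x|?M. q x * D1 (\<lambda>x. v1 x * h x) x) = (LINT x|?B. q x * D1 (\<lambda>x. v1 x * h x) x)"
      proof (rule integral_lebesgue_on_shrink[OF sub])
        fix x assume "x \<in> Ico L" "x \<notin> {0..b}"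
        then have "b < x" by (auto simp: Ico_def)
        then show "q x * D1 (\<lambda>x. v1 x * h x) x = 0"
          using D1_eq_0_beyond[of b "\<lambda>x. v1 x * h x" x] v1(2) by simp
      qed auto
      also have "\<dots> = (LINT x|?B. (q x * v1 x) * D1 h x + (q x * D1 v1 x) * h x)"
      proof (rule integral_cong_AE)
        have "h \<in> borel_measurable ?B" by (rule R_meas[OF H1_loc_borel_measurable[OF h]])
        note [measurable] = this sq_intD(1)[OF D1v1] sq_intD(1)[OF D1h_B] sq_intD(1)[OF q_B] sq_intD(1)[OF qv]
          sq_intD(1)[OF L2_locD[OF H1_locD(3)[OF H1_loc_mult(1)[OF L v1(1) h]] b]]
        show "(\<lambda>x. q x * D1 (\<lambda>x. v1 x * h x) x) \<in> borel_measurable ?B" by measurable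
        show "(\<lambda>x. (q x * v1 x) * D1 h x + (q x * D1 v1 x) * h x) \<in> borel_measurable ?B" by measurable
        have "AE x in ?B. D1 (\<lambda>x. v1 x * h x) x = v1 x * D1 h x + h x * D1 v1 x"
          by (rule AE_lebesgue_on_subset[OF H1_loc_mult(2)[OF L v1(1) h] sub]) auto
        then show "AE x in ?B. q x * D1 (\<lambda>x. v1 x * h x) x = (q x * v1 x) * D1 h x + (q x * D1 v1 x) * h x"
          by eventually_elim (simp add: algebra_simps)
      qed
      also have "\<dots> = (LINT x|?B. (q x * v1 x) * D1 h x) + (LINT x|?B. (q x * D1 v1 x) * h x)"
      proof (rule Bochner_Integration.integral_add)
        show "integrable ?B (\<lambda>x. q x * v1 x * D1 h x)" by (rule integrable_mult_sq_int[OF qv D1h_B])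
        have "(\<lambda>x. h x * q x) \<in> sq_int ?B" by (rule L2_locD[OF H1_loc_mult_L2_loc[OF h q] b])
        from integrable_mult_sq_int[OF this D1v1] show "integrable ?B (\<lambda>x. q x * D1 v1 x * h x)"
          by (simp add: ac_simps)
      qed
      finally show ?thesis .
    qed
    show ?thesis
      unfolding lhs rhs \<Delta>_def parts1(4)[OF h_ac] parts2(4)[OF h_ac] by (simp add: algebra_simps)
  qed
  with u_star show thesis by (rule that)
qed

end

section \<open>Self-adjointness\<close>

lemma L2_space_rep:
  assumes "G \<in> L2_space M"
  obtains g where "g \<in> sq_int M" "G = L2_class M g"
  using assms unfolding L2_space_def L2_class_def by (auto elim: quotientE)

lemma L2_class_in_space: "g \<in> sq_int M \<Longrightarrow> L2_class M g \<in> L2_space M"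
  unfolding L2_space_def L2_class_def by (rule quotientI)

lemma sq_int_AE_eq_0:
  assumes "f \<in> sq_int M" "(LINT x|M. f x * cnj (f x)) = 0"
  shows "AE x in M. f x = 0"
proof -
  have "(LINT x|M. f x * cnj (f x)) = of_real (LINT x|M. (cmod (f x))\<^sup>2)"
    by (simp only: complex_norm_square[symmetric] of_real_power[symmetric] integral_complex_of_real)
  with assms(2) have "(LINT x|M. (cmod (f x))\<^sup>2) = 0" by simp
  then have "AE x in M. (cmod (f x))\<^sup>2 = 0"
    using integral_nonneg_eq_0_iff_AE[OF sq_intD(2)[OF assms(1)]] by simp
  then show ?thesis by eventually_elim simp
qed

locale real_krein_string = krein_string +
  fixes \<omega> :: "(real \<Rightarrow> complex) \<Rightarrow> complex"
  assumes q_real: "AE x in lebesgue_on (Ico L). q x \<in> \<real>"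
    and \<omega>: "\<And>h. h \<in> H1_c L \<Longrightarrow> \<omega> h = - (LINT x|lebesgue_on (Ico L). q x * D1 h x)"
begin

section \<open>The real distribution and the sesquilinear form\<close>

abbreviation "\<Lambda> \<equiv> lebesgue_on (Ico L)"

text \<open>\<open>q\<close> is only locally square integrable, but it may be truncated to
  \<open>[0, b]\<close>, beyond which \<open>D1 h\<close> vanishes.\<close>

lemma q_D1_integrable:
  assumes h: "h \<in> H1_c L"
  shows "integrable \<Lambda> (\<lambda>x. q x * D1 h x)"
proof -
  obtain b where b: "h \<in> H1_loc L" "b \<in> Ico L" "\<And>x. b < x \<Longrightarrow> h x = 0" using H1_cD[OF L h] by blast
  have D1h: "D1 h x = 0" if "b < x" for x by (rule D1_eq_0_beyond[OF b(3) that])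
  let ?B = "lebesgue_on {0..b}"
  let ?q = "\<lambda>x. if x \<in> {0..b} then q x else 0"
  have "?q \<in> sq_int ?B"
    by (rule sq_int_cong_AE_lebesgue_on[OF _ L2_locD[OF q b(2)]]) (auto intro!: AE_I2)
  then have "?q \<in> sq_int \<Lambda>"
    by (rule sq_int_lebesgue_on_extend[OF _ Icc_subset_Ico[OF b(2)]]) auto
  from integrable_mult_sq_int[OF this H1_c_subset(2)[OF h]] show ?thesis
    by (rule Bochner_Integration.integrable_cong[THEN iffD1, rotated 2])
       (use D1h in \<open>auto simp: Ico_def not_le\<close>)
qed

lemma \<omega>_lincomb:
  assumes f: "f \<in> H1_c L" and h: "h \<in> H1_c L"
  shows "\<omega> (\<lambda>x. f x + a * h x) = \<omega> f + a * \<omega> h"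
proof -
  note F = H1_c_subset(1)[OF f] and H = H1_c_subset(1)[OF h]
  note c = H1_c_lincomb[OF L f h, of a]
  have "(LINT x|\<Lambda>. q x * D1 (\<lambda>x. f x + a * h x) x) = (LINT x|\<Lambda>. q x * D1 f x + a * (q x * D1 h x))"
  proof (rule integral_cong_AE)
    show "AE x in \<Lambda>. q x * D1 (\<lambda>x. f x + a * h x) x = q x * D1 f x + a * (q x * D1 h x)"
      using H1_loc_lincomb(2)[OF L F H, of a] by eventually_elim (simp add: algebra_simps)
  qed (use q_D1_integrable[OF f] q_D1_integrable[OF h] q_D1_integrable[OF c] in auto)
  then show ?thesis
    using q_D1_integrable[OF f] q_D1_integrable[OF h] by (simp add: \<omega>[OF f] \<omega>[OF h] \<omega>[OF c] algebra_simps)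
qed

text \<open>This is how the reality of \<omega> enters the proof: conjugation passes through
  \<open>q\<close> because \<open>q\<close> is real almost everywhere.\<close>

lemma \<omega>_cnj:
  assumes h: "h \<in> H1_c L"
  shows "\<omega> (\<lambda>x. cnj (h x)) = cnj (\<omega> h)"
proof -
  note c = H1_c_cnj[OF L h]
  have "(LINT x|\<Lambda>. q x * D1 (\<lambda>x. cnj (h x)) x) = (LINT x|\<Lambda>. cnj (q x * D1 h x))"
  proof (rule integral_cong_AE)
    show "AE x in \<Lambda>. q x * D1 (\<lambda>x. cnj (h x)) x = cnj (q x * D1 h x)"
      using H1_loc_cnj(2)[OF L H1_c_subset(1)[OF h]] q_real
      by eventually_elim (auto simp: Reals_cnj_iff)
    show "(\<lambda>x. cnj (q x * D1 h x)) \<in> borel_measurable \<Lambda>"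
      using q_D1_integrable[OF h] by (intro borel_measurable_cnj) auto
  qed (use q_D1_integrable[OF c] in auto)
  also have "\<dots> = cnj (LINT x|\<Lambda>. q x * D1 h x)" by (rule Bochner_Integration.integral_cnj)
  finally show ?thesis by (simp add: \<omega>[OF h] \<omega>[OF c])
qed

lemma form_lincomb:
  assumes f: "f \<in> H_prime_star L" and h: "h \<in> H1_c L" "k \<in> H1_c L"
  shows "(LINT x|\<Lambda>. D1 f x * D1 (\<lambda>x. h x + a * k x) x) = (LINT x|\<Lambda>. D1 f x * D1 h x) + a * (LINT x|\<Lambda>. D1 f x * D1 k x)"
proof -
  note Df = H_prime_starD(3)[OF f]
  have int: "integrable \<Lambda> (\<lambda>x. D1 f x * D1 h x)" if "h \<in> H1_c L" for h
    by (rule integrable_mult_sq_int[OF Df H1_c_subset(2)[OF that]])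
  have "(LINT x|\<Lambda>. D1 f x * D1 (\<lambda>x. h x + a * k x) x) = (LINT x|\<Lambda>. D1 f x * D1 h x + a * (D1 f x * D1 k x))"
  proof (rule integral_cong_AE)
    show "AE x in \<Lambda>. D1 f x * D1 (\<lambda>x. h x + a * k x) x = D1 f x * D1 h x + a * (D1 f x * D1 k x)"
      using H1_loc_lincomb(2)[OF L H1_c_subset(1)[OF h(1)] H1_c_subset(1)[OF h(2)], of a]
      by eventually_elim (simp add: algebra_simps)
  qed (use int[OF h(1)] int[OF h(2)] int[OF H1_c_lincomb[OF L h]] in auto)
  then show ?thesis using int[OF h(1)] int[OF h(2)] by simp
qed

text \<open>The scalar product conjugates a derivative, whereas the weak equation differentiates a
  conjugated test function; the two agree almost everywhere.\<close>

lemma form_cnj: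
  assumes f: "f \<in> H_prime_star L" and h: "h \<in> H1_loc L" "D1 h \<in> sq_int \<Lambda>"
  shows "(LINT x|\<Lambda>. D1 f x * cnj (D1 h x)) = (LINT x|\<Lambda>. D1 f x * D1 (\<lambda>x. cnj (h x)) x)"
proof (rule integral_cong_AE)
  note [measurable] = sq_intD(1)[OF H_prime_starD(3)[OF f]] sq_intD(1)[OF h(2)]
  note eq = H1_loc_cnj(2)[OF L h(1)]
  have [measurable]: "(\<lambda>x. cnj (D1 h x)) \<in> borel_measurable \<Lambda>" by measurable
  have [measurable]: "D1 (\<lambda>x. cnj (h x)) \<in> borel_measurable \<Lambda>"
    by (rule borel_measurable_cong_AE_lebesgue_on[of _ "\<lambda>x. cnj (D1 h x)"]) (use eq in \<open>auto simp: eq_commute\<close>)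
  show "(\<lambda>x. D1 f x * cnj (D1 h x)) \<in> borel_measurable \<Lambda>" by measurable
  show "(\<lambda>x. D1 f x * D1 (\<lambda>x. cnj (h x)) x) \<in> borel_measurable \<Lambda>" by measurable
  show "AE x in \<Lambda>. D1 f x * cnj (D1 h x) = D1 f x * D1 (\<lambda>x. cnj (h x)) x"
    using eq by eventually_elim simp
qed

lemma cnj_form:
  assumes "f \<in> H_prime_star L" "h \<in> H_prime_star L"
  shows "cnj (LINT x|\<Lambda>. D1 h x * cnj (D1 f x)) = (LINT x|\<Lambda>. D1 f x * cnj (D1 h x))"
  by (simp add: Bochner_Integration.integral_cnj[symmetric] mult.commute del: Bochner_Integration.integral_cnj)

text \<open>The constant \<Delta> is made explicit and the second component is a representative, so
  that the analysis runs without quotients and existential quantifiers.\<close>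

definition solves :: "(real \<Rightarrow> complex) \<Rightarrow> (real \<Rightarrow> complex) \<Rightarrow> (real \<Rightarrow> complex) \<Rightarrow> complex \<Rightarrow> bool" where
  "solves f g1 g2 \<Delta> \<longleftrightarrow> (\<forall>h\<in>H1_c L. \<Delta> * h 0 + (LINT x|\<Lambda>. D1 f x * D1 h x)
     = \<omega> (\<lambda>x. g1 x * h x) + (LINT x|\<upsilon>. g2 x * h x))"

text \<open>Membership in the adjoint relation, written out for representatives; equivalence classes
  return only in the final assembly.\<close>

definition adjoint_pair ::
  "(real \<Rightarrow> complex) \<Rightarrow> (real \<Rightarrow> complex) \<Rightarrow> (real \<Rightarrow> complex) \<Rightarrow> (real \<Rightarrow> complex) \<Rightarrow> bool" where
  "adjoint_pair f1 f2 g1 g2 \<longleftrightarrow> (\<forall>u1\<in>H_prime_star L. \<forall>u2\<in>sq_int \<upsilon>. \<forall>v1\<in>H_prime_star L. \<forall>v2\<in>sq_int \<upsilon>. \<forall>\<Delta>.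
     solves u1 v1 v2 \<Delta> \<longrightarrow> (AE x in \<upsilon>. u2 x = v1 x) \<longrightarrow>
     (LINT x|\<Lambda>. D1 g1 x * cnj (D1 u1 x)) + (LINT x|\<upsilon>. g2 x * cnj (u2 x)) =
     (LINT x|\<Lambda>. D1 f1 x * cnj (D1 v1 x)) + (LINT x|\<upsilon>. f2 x * cnj (v2 x)))"

lemma T_relI:
  "((f1, L2_class \<upsilon> f2), (g1, L2_class \<upsilon> g2)) \<in> T_rel L \<omega> \<upsilon>"
  if "f1 \<in> H_prime_star L" "f2 \<in> sq_int \<upsilon>" "g1 \<in> H_prime_star L" "g2 \<in> sq_int \<upsilon>"
    "solves f1 g1 g2 \<Delta>" "AE x in \<upsilon>. f2 x = g1 x"
  using that unfolding T_rel_def solves_def by blast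

lemma T_rel_symmetric:
  assumes f: "f1 \<in> H_prime_star L" "g1 \<in> H_prime_star L" "g2 \<in> sq_int \<upsilon>" "solves f1 g1 g2 \<Delta>"
    and f2: "f2 \<in> sq_int \<upsilon>" "AE x in \<upsilon>. f2 x = g1 x"
    and u: "u1 \<in> H_prime_star L" "v1 \<in> H_prime_star L" "v2 \<in> sq_int \<upsilon>" "solves u1 v1 v2 \<Delta>'"
    and u2: "u2 \<in> sq_int \<upsilon>" "AE x in \<upsilon>. u2 x = v1 x"
  shows "(LINT x|\<Lambda>. D1 g1 x * cnj (D1 u1 x)) + (LINT x|\<upsilon>. g2 x * cnj (u2 x)) =
    (LINT x|\<Lambda>. D1 f1 x * cnj (D1 v1 x)) + (LINT x|\<upsilon>. f2 x * cnj (v2 x))"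
proof -
  obtain a b :: "nat \<Rightarrow> real" where ab: "\<And>n. 0 < a n" "\<And>n. a n < b n" "\<And>n. b n \<in> Ico L"
    "\<And>x. x \<in> Ico L \<Longrightarrow> \<exists>N. \<forall>n\<ge>N. x \<le> a n"
    "\<And>n. L = \<infinity> \<Longrightarrow> b n \<le> 2 * (b n - a n)"
    "\<And>n. L < \<infinity> \<Longrightarrow> real_of_ereal L - a n \<le> 2 * (b n - a n)"
    using Ico_exhaust[OF L] by metis
  define \<phi> where "\<phi> n = cutoff (a n) (b n)" for n
  have \<phi>: "\<phi> n \<in> H1_c L" for n unfolding \<phi>_def by (rule cutoff_H1_c(1)[OF L ab(1-3)])
  have \<phi>_cnj: "cnj (\<phi> n x) = \<phi> n x" for n x by (simp add: \<phi>_def cutoff_def)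
  have \<phi>_\<upsilon>: "cutoff (a n) (b n) \<in> borel_measurable \<upsilon>" for n
    using sq_intD(1)[OF H1_c_sq_int_\<upsilon>[OF \<phi>[of n]]] by (simp add: \<phi>_def)
  have meas_\<upsilon>: "k \<in> borel_measurable \<upsilon>" if "k \<in> H_prime_star L" for k
    by (rule borel_measurable_\<upsilon>[OF H1_loc_borel_measurable[OF H_prime_starD(1)[OF that]]])
  note [measurable] = meas_\<upsilon>[OF f(2)] meas_\<upsilon>[OF u(2)] sq_intD(1)[OF f(3)] sq_intD(1)[OF u(3)]
    sq_intD(1)[OF f2(1)] sq_intD(1)[OF u2(1)]
  let ?v = "\<lambda>x. cnj (v1 x)" and ?g = "\<lambda>x. cnj (g1 x)"
  have v: "?v \<in> H_prime_star L" and g: "?g \<in> H_prime_star L"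
    by (rule H_prime_star_cnj[OF L u(2)], rule H_prime_star_cnj[OF L f(2)])
  have test_v: "(\<lambda>x. ?v x * \<phi> n x) \<in> H1_c L" and test_g: "(\<lambda>x. ?g x * \<phi> n x) \<in> H1_c L" for n
    by (rule H1_c_mult[OF L H_prime_starD(1)[OF v] \<phi>], rule H1_c_mult[OF L H_prime_starD(1)[OF g] \<phi>])
  \<comment> \<open>\<open>v1\<close> itself is not known to be square integrable with respect to
    \<upsilon>; integrability of the product is inherited from \<open>u2\<close>, with which
    \<open>v1\<close> agrees almost everywhere.\<close>
  have int1: "integrable \<upsilon> (\<lambda>x. g2 x * cnj (v1 x))"
  proof (rule integrable_cong_AE_imp[OF integrable_mult_sq_int[OF f(3) sq_int_cnj[OF u2(1)]]])
    show "AE x in \<upsilon>. g2 x * cnj (u2 x) = g2 x * cnj (v1 x)" using u2(2) by eventually_elim simp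
  qed measurable
  have int2: "integrable \<upsilon> (\<lambda>x. v2 x * cnj (g1 x))"
  proof (rule integrable_cong_AE_imp[OF integrable_mult_sq_int[OF u(3) sq_int_cnj[OF f2(1)]]])
    show "AE x in \<upsilon>. v2 x * cnj (f2 x) = v2 x * cnj (g1 x)" using f2(2) by eventually_elim simp
  qed measurable
  have \<upsilon>1: "(LINT x|\<upsilon>. g2 x * cnj (v1 x)) = (LINT x|\<upsilon>. g2 x * cnj (u2 x))"
  proof (rule integral_cong_AE)
    show "AE x in \<upsilon>. g2 x * cnj (v1 x) = g2 x * cnj (u2 x)" using u2(2) by eventually_elim simp
  qed measurable
  have \<upsilon>2: "(LINT x|\<upsilon>. v2 x * cnj (g1 x)) = (LINT x|\<upsilon>. v2 x * cnj (f2 x))"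
  proof (rule integral_cong_AE)
    show "AE x in \<upsilon>. v2 x * cnj (g1 x) = v2 x * cnj (f2 x)" using f2(2) by eventually_elim simp
  qed measurable
  define A where "A n = (LINT x|\<Lambda>. D1 f1 x * D1 (\<lambda>x. ?v x * \<phi> n x) x) - (LINT x|\<upsilon>. \<phi> n x * (g2 x * ?v x))" for n
  define B where "B n = (LINT x|\<Lambda>. D1 u1 x * D1 (\<lambda>x. ?g x * \<phi> n x) x) - (LINT x|\<upsilon>. \<phi> n x * (v2 x * ?g x))" for n
  \<comment> \<open>The term with \<Delta> drops out because the test function inherits a zero at 0
    from \<open>v1\<close>. What remains is \<omega> at a product symmetric in \<open>g1\<close> and
    \<open>cnj v1\<close>.\<close>
  have A: "A n = \<omega> (\<lambda>x. g1 x * (?v x * \<phi> n x))" for n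
    using f(4)[unfolded solves_def, rule_format, OF test_v[of n]] H_prime_starD(2)[OF u(2)]
    by (simp add: A_def ac_simps)
  have B: "B n = \<omega> (\<lambda>x. v1 x * (?g x * \<phi> n x))" for n
    using u(4)[unfolded solves_def, rule_format, OF test_g[of n]] H_prime_starD(2)[OF f(2)]
    by (simp add: B_def ac_simps)
  \<comment> \<open>The arguments of \<omega> in \<open>A n\<close> and \<open>B n\<close> are
    complex conjugates of each other, as the cutoff functions are real.\<close>
  have AB: "A n = cnj (B n)" for n
    using \<omega>_cnj[OF H1_c_mult[OF L H_prime_starD(1)[OF u(2)] test_g[of n]]]
    by (simp add: A B \<phi>_cnj ac_simps)
  have space_sub: "space \<upsilon> \<subseteq> Ico L" by (simp add: space_\<upsilon>)
  have limA: "A \<longlonglongrightarrow> (LINT x|\<Lambda>. D1 f1 x * D1 ?v x) - (LINT x|\<upsilon>. g2 x * ?v x)"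
    unfolding A_def \<phi>_def
    by (intro tendsto_diff cutoff_seq_form_tendsto[OF L ab H_prime_starD(3)[OF f(1)] v]
        cutoff_seq_integral_tendsto[OF ab(2,4) space_sub \<phi>_\<upsilon> int1])
  have limB: "B \<longlonglongrightarrow> (LINT x|\<Lambda>. D1 u1 x * D1 ?g x) - (LINT x|\<upsilon>. v2 x * ?g x)"
    unfolding B_def \<phi>_def
    by (intro tendsto_diff cutoff_seq_form_tendsto[OF L ab H_prime_starD(3)[OF u(1)] g]
        cutoff_seq_integral_tendsto[OF ab(2,4) space_sub \<phi>_\<upsilon> int2])
  have "A \<longlonglongrightarrow> cnj ((LINT x|\<Lambda>. D1 u1 x * D1 ?g x) - (LINT x|\<upsilon>. v2 x * ?g x))"
    using tendsto_cnj[OF limB] by (simp add: AB[abs_def])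
  from LIMSEQ_unique[OF limA this]
  have "(LINT x|\<Lambda>. D1 f1 x * D1 ?v x) - (LINT x|\<upsilon>. g2 x * ?v x) =
    cnj (LINT x|\<Lambda>. D1 u1 x * D1 ?g x) - cnj (LINT x|\<upsilon>. v2 x * ?g x)" by simp
  moreover have "(LINT x|\<Lambda>. D1 f1 x * D1 ?v x) = (LINT x|\<Lambda>. D1 f1 x * cnj (D1 v1 x))"
    by (rule form_cnj[OF f(1) H_prime_starD(1,3)[OF u(2)], symmetric])
  moreover have "cnj (LINT x|\<Lambda>. D1 u1 x * D1 ?g x) = (LINT x|\<Lambda>. D1 g1 x * cnj (D1 u1 x))"
    using form_cnj[OF u(1) H_prime_starD(1,3)[OF f(2)]] cnj_form[OF f(2) u(1)] by simp
  moreover have "cnj (LINT x|\<upsilon>. v2 x * ?g x) = (LINT x|\<upsilon>. f2 x * cnj (v2 x))"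
    unfolding \<upsilon>2 by (simp add: Bochner_Integration.integral_cnj[symmetric] mult.commute del: Bochner_Integration.integral_cnj)
  ultimately show ?thesis using \<upsilon>1 by (simp add: algebra_simps)
qed

text \<open>The conjugates of \<open>h\<close> and \<open>k\<close> are the data \<open>v1\<close>
  and \<open>v2\<close> of an explicit element of the relation, whose solution is \<open>u\<close>.
  The pairing produces the integral of \<open>D1 g1 * cnj (D1 u)\<close>, which the equation for
  \<open>u\<close>, tested with \<open>cnj g1\<close> and conjugated, turns into terms with
  \<open>h\<close> and \<open>k\<close>; so \<open>u\<close> disappears from the identity.\<close>

lemma adjoint_tested:
  assumes f: "f1 \<in> H_prime_star L" "f2 \<in> sq_int \<upsilon>" and g: "g1 \<in> H_prime_star L" "g2 \<in> sq_int \<upsilon>"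
    and adj: "adjoint_pair f1 f2 g1 g2"
    and h: "h \<in> H1_c L" "h 0 = 0"
    and k: "k \<in> sq_int \<upsilon>" "b \<in> Ico L" "\<And>x. b < x \<Longrightarrow> k x = 0"
  shows "\<omega> (\<lambda>x. g1 x * h x) + (LINT x|\<upsilon>. g1 x * k x) + (LINT x|\<upsilon>. g2 x * h x) =
    (LINT x|\<Lambda>. D1 f1 x * D1 h x) + (LINT x|\<upsilon>. f2 x * k x)"
proof -
  define v1 where "v1 x = cnj (h x)" for x
  define v2 where "v2 x = cnj (k x)" for x
  have v1: "v1 \<in> H1_c L" unfolding v1_def by (rule H1_c_cnj[OF L h(1)])
  have v1_star: "v1 \<in> H_prime_star L"
    by (rule H1_c_imp_H_prime_star[OF L v1]) (simp add: v1_def h(2))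
  have v2: "v2 \<in> sq_int \<upsilon>" unfolding v2_def by (rule sq_int_cnj[OF k(1)])
  obtain c where c: "c \<in> Ico L" "\<And>x. c < x \<Longrightarrow> v1 x = 0" using H1_cD[OF L v1] by blast
  have d: "max b c \<in> Ico L" using k(2) c(1) by (auto simp: max_def)
  obtain u \<Delta> where u: "u \<in> H_prime_star L"
    and u_eq: "\<And>h. h \<in> H1_c L \<or> h \<in> H_prime_star L \<Longrightarrow>
      \<Delta> * h 0 + (LINT x|\<Lambda>. D1 u x * D1 h x) =
      - (LINT x|\<Lambda>. q x * D1 (\<lambda>x. v1 x * h x) x) + (LINT x|\<upsilon>. v2 x * h x)"
    using solution_compact_support[OF H1_c_subset(1)[OF v1] _ d v2] c(2) k(3)
    by (auto simp: v2_def)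
  have "solves u v1 v2 \<Delta>"
    unfolding solves_def
  proof
    fix h' assume h': "h' \<in> H1_c L"
    then show "\<Delta> * h' 0 + (LINT x|\<Lambda>. D1 u x * D1 h' x) = \<omega> (\<lambda>x. v1 x * h' x) + (LINT x|\<upsilon>. v2 x * h' x)"
      using u_eq[of h'] \<omega>[OF H1_c_mult[OF L H1_c_subset(1)[OF v1] h']] by simp
  qed
  \<comment> \<open>The second component paired with \<open>u\<close> is chosen to be
    \<open>v1\<close> itself, which is square integrable for \<upsilon> because of its compact
    support; the equation \<open>u2 = v1\<close> then holds trivially.\<close>
  with adj[unfolded adjoint_pair_def, rule_format, OF u H1_c_sq_int_\<upsilon>[OF v1] v1_star v2]
  have main: "(LINT x|\<Lambda>. D1 g1 x * cnj (D1 u x)) + (LINT x|\<upsilon>. g2 x * h x) =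
      (LINT x|\<Lambda>. D1 f1 x * cnj (D1 v1 x)) + (LINT x|\<upsilon>. f2 x * k x)"
    by (simp add: v1_def[abs_def] v2_def)
  let ?g = "\<lambda>x. cnj (g1 x)"
  have g': "?g \<in> H_prime_star L" by (rule H_prime_star_cnj[OF L g(1)])
  have gv: "(\<lambda>x. v1 x * ?g x) \<in> H1_c L"
    using H1_c_mult[OF L H_prime_starD(1)[OF g'] v1] by (simp add: mult.commute)
  \<comment> \<open>Here the weak equation of \<open>u\<close> is needed for a test function that
    lies only in \<open>H_prime_star L\<close>. Its value at 0 is zero, which removes
    \<Delta>.\<close>
  have "(LINT x|\<Lambda>. D1 u x * D1 ?g x) = \<omega> (\<lambda>x. v1 x * ?g x) + (LINT x|\<upsilon>. v2 x * ?g x)"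
    using u_eq[of ?g] g' H_prime_starD(2)[OF g(1)] \<omega>[OF gv] by simp
  then have "cnj (LINT x|\<Lambda>. D1 u x * D1 ?g x) = cnj (\<omega> (\<lambda>x. v1 x * ?g x)) + cnj (LINT x|\<upsilon>. v2 x * ?g x)"
    by simp
  moreover have "cnj (LINT x|\<Lambda>. D1 u x * D1 ?g x) = (LINT x|\<Lambda>. D1 g1 x * cnj (D1 u x))"
    using form_cnj[OF u H_prime_starD(1,3)[OF g(1)]] cnj_form[OF g(1) u] by simp
  moreover have "cnj (\<omega> (\<lambda>x. v1 x * ?g x)) = \<omega> (\<lambda>x. g1 x * h x)"
    using \<omega>_cnj[OF gv] by (simp add: v1_def mult.commute)
  moreover have "cnj (LINT x|\<upsilon>. v2 x * ?g x) = (LINT x|\<upsilon>. g1 x * k x)"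
    by (simp add: v2_def Bochner_Integration.integral_cnj[symmetric] mult.commute del: Bochner_Integration.integral_cnj)
  moreover have "(LINT x|\<Lambda>. D1 f1 x * cnj (D1 v1 x)) = (LINT x|\<Lambda>. D1 f1 x * D1 h x)"
    using form_cnj[OF f(1) H_prime_starD(1,3)[OF v1_star]] by (simp add: v1_def)
  ultimately show ?thesis using main by simp
qed

lemma adjoint_imp_T_rel:
  assumes f: "f1 \<in> H_prime_star L" "f2 \<in> sq_int \<upsilon>" and g: "g1 \<in> H_prime_star L" "g2 \<in> sq_int \<upsilon>"
    and adj: "adjoint_pair f1 f2 g1 g2"
  shows "\<exists>\<Delta>. solves f1 g1 g2 \<Delta>" "AE x in \<upsilon>. f2 x = g1 x"
proof -
  note test = adjoint_tested[OF f g adj]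
  obtain a b :: "nat \<Rightarrow> real" where ab: "\<And>n. 0 < a n" "\<And>n. a n < b n" "\<And>n. b n \<in> Ico L"
    "\<And>x. x \<in> Ico L \<Longrightarrow> \<exists>N. \<forall>n\<ge>N. x \<le> a n"
    using Ico_exhaust[OF L] by metis
  have zero: "(\<lambda>x. 0) \<in> H1_c L"
    using H1_c_lincomb[OF L cutoff_H1_c(1)[OF L ab(1-3)[of 0]] cutoff_H1_c(1)[OF L ab(1-3)[of 0]], of "- 1"] by simp
  \<comment> \<open>The comparison is localized because admissible \<open>k\<close> vanish beyond
    some point of \<open>[0, L)\<close>, and \<open>g1\<close> is bounded, hence square integrable
    for \<upsilon>, on each \<open>[0, b n]\<close>.\<close>
  have "AE x in \<upsilon>. x \<in> {0..b n} \<longrightarrow> f2 x = g1 x" for n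
  proof -
    let ?\<chi> = "\<lambda>x. if x \<in> {0..b n} then 1 else 0 :: complex"
    obtain B where B: "\<And>x. x \<in> {0..b n} \<Longrightarrow> cmod (g1 x) \<le> B"
      using H1_loc_bounded[OF H_prime_starD(1)[OF g(1)] ab(3)[of n]] by blast
    have [measurable]: "g1 \<in> borel_measurable borel" by (rule H1_loc_borel_measurable[OF H_prime_starD(1)[OF g(1)]])
    have g\<chi>: "(\<lambda>x. ?\<chi> x * g1 x) \<in> sq_int \<upsilon>"
      by (rule sq_int_\<upsilon>_compact[OF _ ab(3)[of n], where B = B]) (use B in auto)
    have f\<chi>: "(\<lambda>x. ?\<chi> x * f2 x) \<in> sq_int \<upsilon>"
      by (rule sq_int_bounded_mult[OF f(2), where B = 1]) (auto intro: borel_measurable_\<upsilon>)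
    \<comment> \<open>Testing with \<open>h = 0\<close> and with \<open>k\<close> the conjugate of
      the truncated difference of \<open>f2\<close> and \<open>g1\<close> makes the squared norm of
      this difference vanish.\<close>
    define d where "d x = ?\<chi> x * f2 x + (- 1) * (?\<chi> x * g1 x)" for x
    have d: "d \<in> sq_int \<upsilon>" unfolding d_def by (rule sq_int_add[OF f\<chi> sq_int_cmult[OF g\<chi>]])
    have "(LINT x|\<upsilon>. g1 x * cnj (d x)) = (LINT x|\<upsilon>. f2 x * cnj (d x))"
      using test[OF zero _ sq_int_cnj[OF d] ab(3)[of n]] \<omega>[OF zero] by (simp add: d_def)
    then have eq: "(LINT x|\<upsilon>. (?\<chi> x * g1 x) * cnj (d x)) = (LINT x|\<upsilon>. (?\<chi> x * f2 x) * cnj (d x))"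
    proof -
      have "(\<lambda>x. k x * cnj (d x)) = (\<lambda>x. (?\<chi> x * k x) * cnj (d x))" for k :: "real \<Rightarrow> complex"
        by (auto simp: d_def fun_eq_iff)
      then show ?thesis
        using \<open>(LINT x|\<upsilon>. g1 x * cnj (d x)) = (LINT x|\<upsilon>. f2 x * cnj (d x))\<close> by metis
    qed
    have "(LINT x|\<upsilon>. d x * cnj (d x)) = (LINT x|\<upsilon>. (?\<chi> x * f2 x) * cnj (d x) - (?\<chi> x * g1 x) * cnj (d x))"
      by (intro Bochner_Integration.integral_cong) (auto simp: d_def algebra_simps)
    also have "\<dots> = 0"
      using integrable_mult_sq_int[OF f\<chi> sq_int_cnj[OF d]] integrable_mult_sq_int[OF g\<chi> sq_int_cnj[OF d]] eq
      by (simp del: mult_if_delta)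
    finally have "AE x in \<upsilon>. d x = 0" by (rule sq_int_AE_eq_0[OF d])
    then show ?thesis by eventually_elim (auto simp: d_def)
  qed
  then have "AE x in \<upsilon>. \<forall>n. x \<in> {0..b n} \<longrightarrow> f2 x = g1 x" unfolding AE_all_countable by blast
  then show "AE x in \<upsilon>. f2 x = g1 x"
  proof (rule AE_mp, intro AE_I2 impI)
    fix x assume "x \<in> space \<upsilon>" and *: "\<forall>n. x \<in> {0..b n} \<longrightarrow> f2 x = g1 x"
    then have x: "x \<in> Ico L" by (simp add: space_\<upsilon>)
    then obtain N where "x \<le> a N" using ab(4) by blast
    with x ab(2)[of N] have "x \<in> {0..b N}" by (simp add: Ico_def)
    with * show "f2 x = g1 x" by blast
  qed
  define h0 where "h0 = cutoff (a 0) (b 0)"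
  have h0: "h0 \<in> H1_c L" unfolding h0_def by (rule cutoff_H1_c(1)[OF L ab(1-3)])
  have h0_0: "h0 0 = 1" using cutoff_eq(1)[OF ab(2)[of 0], of 0] ab(1)[of 0] by (simp add: h0_def)
  have k0: "(\<lambda>x. 0) \<in> sq_int \<upsilon>" by (simp add: sq_int_def)
  have test0: "\<omega> (\<lambda>x. g1 x * h x) + (LINT x|\<upsilon>. g2 x * h x) = (LINT x|\<Lambda>. D1 f1 x * D1 h x)"
    if "h \<in> H1_c L" "h 0 = 0" for h
    using test[OF that k0 ab(3)[of 0]] by simp
  \<comment> \<open>\<Delta> is the defect of the equation at the reference function
    \<open>h0\<close>, for which \<open>h0 0 = 1\<close>. Subtracting \<open>h 0 * h0\<close> from
    an arbitrary \<open>h\<close> gives a test function vanishing at 0, for which the equation is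
    already known; linearity does the rest.\<close>
  define \<Delta> where "\<Delta> = \<omega> (\<lambda>x. g1 x * h0 x) + (LINT x|\<upsilon>. g2 x * h0 x) - (LINT x|\<Lambda>. D1 f1 x * D1 h0 x)"
  have "solves f1 g1 g2 \<Delta>"
    unfolding solves_def
  proof
    fix h assume h: "h \<in> H1_c L"
    define k where "k x = h x + (- h 0) * h0 x" for x
    have k: "k \<in> H1_c L" unfolding k_def by (rule H1_c_lincomb[OF L h h0])
    note g1 = H_prime_starD(1)[OF g(1)]
    have "\<omega> (\<lambda>x. g1 x * k x) = \<omega> (\<lambda>x. g1 x * h x) + (- h 0) * \<omega> (\<lambda>x. g1 x * h0 x)"
      using \<omega>_lincomb[OF H1_c_mult[OF L g1 h] H1_c_mult[OF L g1 h0], of "- h 0"]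
      by (simp add: k_def algebra_simps)
    moreover have "(LINT x|\<upsilon>. g2 x * k x) = (LINT x|\<upsilon>. g2 x * h x + (- h 0) * (g2 x * h0 x))"
      by (simp add: k_def algebra_simps)
    then have "(LINT x|\<upsilon>. g2 x * k x) = (LINT x|\<upsilon>. g2 x * h x) + (- h 0) * (LINT x|\<upsilon>. g2 x * h0 x)"
      using integrable_mult_sq_int[OF g(2) H1_c_sq_int_\<upsilon>[OF h]] integrable_mult_sq_int[OF g(2) H1_c_sq_int_\<upsilon>[OF h0]]
      by simp
    moreover have "(LINT x|\<Lambda>. D1 f1 x * D1 k x) = (LINT x|\<Lambda>. D1 f1 x * D1 h x) + (- h 0) * (LINT x|\<Lambda>. D1 f1 x * D1 h0 x)"
      unfolding k_def by (rule form_lincomb[OF f(1) h h0])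
    moreover have "k 0 = 0" by (simp add: k_def h0_0)
    ultimately show "\<Delta> * h 0 + (LINT x|\<Lambda>. D1 f1 x * D1 h x) = \<omega> (\<lambda>x. g1 x * h x) + (LINT x|\<upsilon>. g2 x * h x)"
      using test0[OF k] unfolding \<Delta>_def by algebra
  qed
  then show "\<exists>\<Delta>. solves f1 g1 g2 \<Delta>" by blast
qed

section \<open>From representatives back to the Hilbert space\<close>

lemma H_inner_class:
  assumes "f2 \<in> sq_int \<upsilon>" "g2 \<in> sq_int \<upsilon>"
  shows "H_inner L \<upsilon> (f1, L2_class \<upsilon> f2) (g1, L2_class \<upsilon> g2) =
    (LINT x|\<Lambda>. D1 f1 x * cnj (D1 g1 x)) + (LINT x|\<upsilon>. f2 x * cnj (g2 x))"
  using L2_inner_class[OF assms] by (simp add: H_inner_def)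

lemma self_adjoint_T_rel: "self_adjoint_rel (H_space L \<upsilon>) (H_inner L \<upsilon>) (T_rel L \<omega> \<upsilon>)"
  unfolding self_adjoint_rel_def
proof (intro equalityI subsetI)
  have T_cases: thesis if "p \<in> T_rel L \<omega> \<upsilon>"
    "\<And>f1 f2 g1 g2 \<Delta>. \<lbrakk>p = ((f1, L2_class \<upsilon> f2), (g1, L2_class \<upsilon> g2)); f1 \<in> H_prime_star L; f2 \<in> sq_int \<upsilon>;
      g1 \<in> H_prime_star L; g2 \<in> sq_int \<upsilon>; solves f1 g1 g2 \<Delta>; AE x in \<upsilon>. f2 x = g1 x\<rbrakk> \<Longrightarrow> thesis" for p thesis
    using that unfolding T_rel_def solves_def by blast
  fix p assume "p \<in> T_rel L \<omega> \<upsilon>"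
  then obtain f1 f2 g1 g2 \<Delta> where p: "p = ((f1, L2_class \<upsilon> f2), (g1, L2_class \<upsilon> g2))"
    and f: "f1 \<in> H_prime_star L" "f2 \<in> sq_int \<upsilon>" and g: "g1 \<in> H_prime_star L" "g2 \<in> sq_int \<upsilon>"
    and s: "solves f1 g1 g2 \<Delta>" "AE x in \<upsilon>. f2 x = g1 x" by (rule T_cases)
  have "H_inner L \<upsilon> (g1, L2_class \<upsilon> g2) u = H_inner L \<upsilon> (f1, L2_class \<upsilon> f2) v"
    if "(u, v) \<in> T_rel L \<omega> \<upsilon>" for u v
    using that
  proof (rule T_cases)
    fix u1 u2 v1 v2 \<Delta>'
    assume uv: "(u, v) = ((u1, L2_class \<upsilon> u2), (v1, L2_class \<upsilon> v2))"
      and u: "u1 \<in> H_prime_star L" "u2 \<in> sq_int \<upsilon>" and v: "v1 \<in> H_prime_star L" "v2 \<in> sq_int \<upsilon>"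
      and s': "solves u1 v1 v2 \<Delta>'" "AE x in \<upsilon>. u2 x = v1 x"
    show ?thesis
      using T_rel_symmetric[OF f(1) g s(1) f(2) s(2) u(1) v s'(1) u(2) s'(2)] uv f g u v
      by (simp add: H_inner_class)
  qed
  then show "p \<in> adjoint_rel (H_space L \<upsilon>) (H_inner L \<upsilon>) (T_rel L \<omega> \<upsilon>)"
    using f g by (auto simp: adjoint_rel_def p H_space_def L2_class_in_space)
next
  fix p assume "p \<in> adjoint_rel (H_space L \<upsilon>) (H_inner L \<upsilon>) (T_rel L \<omega> \<upsilon>)"
  then obtain F G where p: "p = (F, G)" "F \<in> H_space L \<upsilon>" "G \<in> H_space L \<upsilon>"
    and adj: "\<And>u v. (u, v) \<in> T_rel L \<omega> \<upsilon> \<Longrightarrow> H_inner L \<upsilon> G u = H_inner L \<upsilon> F v"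
    unfolding adjoint_rel_def by blast
  obtain f1 f2 where F: "F = (f1, L2_class \<upsilon> f2)" "f1 \<in> H_prime_star L" "f2 \<in> sq_int \<upsilon>"
    using p(2) unfolding H_space_def by (metis L2_space_rep SigmaE)
  obtain g1 g2 where G: "G = (g1, L2_class \<upsilon> g2)" "g1 \<in> H_prime_star L" "g2 \<in> sq_int \<upsilon>"
    using p(3) unfolding H_space_def by (metis L2_space_rep SigmaE)
  have "adjoint_pair f1 f2 g1 g2"
    unfolding adjoint_pair_def
  proof (intro ballI allI impI)
    fix u1 u2 v1 v2 \<Delta>
    assume uv: "u1 \<in> H_prime_star L" "u2 \<in> sq_int \<upsilon>" "v1 \<in> H_prime_star L" "v2 \<in> sq_int \<upsilon>"
      "solves u1 v1 v2 \<Delta>" "AE x in \<upsilon>. u2 x = v1 x"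
    show "(LINT x|\<Lambda>. D1 g1 x * cnj (D1 u1 x)) + (LINT x|\<upsilon>. g2 x * cnj (u2 x)) =
      (LINT x|\<Lambda>. D1 f1 x * cnj (D1 v1 x)) + (LINT x|\<upsilon>. f2 x * cnj (v2 x))"
      using adj[OF T_relI[OF uv]] uv F(3) G(3) by (simp add: F(1) G(1) H_inner_class)
  qed
  from adjoint_imp_T_rel[OF F(2,3) G(2,3) this]
  obtain \<Delta> where "solves f1 g1 g2 \<Delta>" "AE x in \<upsilon>. f2 x = g1 x" by blast
  then show "p \<in> T_rel L \<omega> \<upsilon>"
    unfolding p F(1) G(1) by (rule T_relI[OF F(2,3) G(2,3)])
qed

end

theorem theorem4p1:
  fixes L :: ereal
    and \<omega> :: "(real \<Rightarrow> complex) \<Rightarrow> complex"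
    and \<upsilon> :: "real measure"
  assumes "0 < L"
    and "\<omega> \<in> Hm1_loc L"
    and "real_valued_distr L \<omega>"
    and "borel_measure_on L \<upsilon>"
  shows "self_adjoint_rel (H_space L \<upsilon>) (H_inner L \<upsilon>) (T_rel L \<omega> \<upsilon>)"
proof -
  from assms(3) obtain q where q: "q \<in> L2_loc L" "AE x in lebesgue_on (Ico L). q x \<in> \<real>"
    "\<And>h. h \<in> H1_c L \<Longrightarrow> \<omega> h = - (LINT x|lebesgue_on (Ico L). q x * D1 h x)"
    unfolding real_valued_distr_def by blast
  interpret real_krein_string L q \<upsilon> \<omega>
    using assms q by unfold_locales auto
  show ?thesis by (rule self_adjoint_T_rel)
qed

end
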